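(* Let $\mathbb{F}$ be a field of characteristic zero. Let $\delta>0$ be an arbitrary constant and let $k:\mathbb{N}\to\mathbb{N}$ be any non-decreasing function with $k(d)=o(\sqrt{\log d})$; let $\tilde{k}(d)=k(d^{\log d})$. Suppose $\{P_{k(d),d}\}_{d\in\mathbb{N}}$ is an explicit family of polynomials such that, for each $d$, $P_{k,d}$ (with $k=k(d)$) is $k$-variate, $\deg(P_{k,d})=d$, and $P_{k,d}\notin\mathcal{C}(k,d,d^{\delta})$, i.e. $P_{k,d}$ requires algebraic circuits of size at least $d^{\delta}$. Then there are explicit hitting sets of size $s^{O(\tilde{k}(s)^2)}$ for the class $\mathcal{C}(s,s,s)$.
   Context: An algebraic circuit over $\mathbb{F}$ is a directed acyclic graph whose internal nodes are labelled by $+$ and $\times$, whose leaves are labelled by variables or field constants, and whose edges may carry arbitrary field constants that scale the value passing through them. Its size is its number of gates (independent of constants). $\mathcal{C}(m,D,s)$ denotes the class of $m$-variate polynomials of total degree at most $D$ computable by algebraic circuits of size at most $s$. A hitting set for a class $\mathcal{C}$ of $m$-variate polynomials is a set $H\subseteq\mathbb{F}^m$ such that every nonzero $f\in\mathcal{C}$ satisfies $f(\mathbf{a})\neq 0$ for some $\mathbf{a}\in H$; it is explicit if it can be output by a deterministic algorithm in time polynomial in its size. The polynomial family is explicit in the sense that there is a deterministic algorithm that, on input $d$, outputs $P_{k,d}$ as a sum of monomials in time polynomial in $d^{k(d)}$ (the number of possible monomials). The family is assumed to contain a polynomial of degree $d$ for every $d\in\mathbb{N}$. *)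

theory Defs
  imports Complex_Main "HOL-Library.Poly_Mapping" "HOL-Library.Landau_Symbols"
begin

section \<open>Multivariate polynomials\<close>

text \<open>A monomial maps the variables \<open>x\<^sub>0, x\<^sub>1, \<dots>\<close> to their exponents; a polynomial maps monomials
  to their coefficients. The ring operations are those of \<open>HOL-Library.Poly_Mapping\<close>.\<close>

type_synonym 'a mpoly = "(nat \<Rightarrow>\<^sub>0 nat) \<Rightarrow>\<^sub>0 'a"

definition mconst :: "'a::zero \<Rightarrow> 'a mpoly" where
  "mconst c = Poly_Mapping.single 0 c"

definition mvar :: "nat \<Rightarrow> 'a::zero_neq_one mpoly" where
  "mvar i = Poly_Mapping.single (Poly_Mapping.single i 1) 1"

definition variate :: "nat \<Rightarrow> 'a::zero mpoly \<Rightarrow> bool" where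
  "variate m p \<longleftrightarrow> (\<forall>mon \<in> Poly_Mapping.keys p. Poly_Mapping.keys mon \<subseteq> {..<m})"

definition mon_degree :: "(nat \<Rightarrow>\<^sub>0 nat) \<Rightarrow> nat" where
  "mon_degree mon = (\<Sum>i\<in>Poly_Mapping.keys mon. Poly_Mapping.lookup mon i)"

text \<open>The zero polynomial has degree 0 here.\<close>

definition total_degree :: "'a::zero mpoly \<Rightarrow> nat" where
  "total_degree p = Max (insert 0 (mon_degree ` Poly_Mapping.keys p))"

definition mpoly_eval :: "(nat \<Rightarrow> 'a::comm_semiring_1) \<Rightarrow> 'a mpoly \<Rightarrow> 'a" where
  "mpoly_eval a p =
     (\<Sum>mon\<in>Poly_Mapping.keys p. Poly_Mapping.lookup p mon *
        (\<Prod>i\<in>Poly_Mapping.keys mon. a i ^ Poly_Mapping.lookup mon i))"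


section \<open>Algebraic circuits\<close>

text \<open>The nodes of a circuit are the positions of a list. An internal node carries the list of its
  incoming edges, each given by its scalar and its source; fan-in is unbounded and parallel edges
  are allowed. Leaves are gates too, so the size of a circuit is its number of nodes.\<close>

datatype 'a gate =
    Input nat
  | Scalar 'a
  | Plus_Gate "('a \<times> nat) list"
  | Times_Gate "('a \<times> nat) list"

type_synonym 'a circuit = "'a gate list"

fun in_edges :: "'a gate \<Rightarrow> ('a \<times> nat) list" where
  "in_edges (Plus_Gate es) = es"
| "in_edges (Times_Gate es) = es"
| "in_edges _ = []"

fun gate_ok :: "nat \<Rightarrow> nat \<Rightarrow> 'a gate \<Rightarrow> bool" where
  "gate_ok m n (Input i) \<longleftrightarrow> i < m"
| "gate_ok m n (Scalar c) \<longleftrightarrow> True"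
| "gate_ok m n (Plus_Gate es) \<longleftrightarrow> es \<noteq> [] \<and> (\<forall>(c, j) \<in> set es. j < n)"
| "gate_ok m n (Times_Gate es) \<longleftrightarrow> es \<noteq> [] \<and> (\<forall>(c, j) \<in> set es. j < n)"

definition circuit_edges :: "'a circuit \<Rightarrow> (nat \<times> nat) set" where
  "circuit_edges C = {(j, i). i < length C \<and> j \<in> snd ` set (in_edges (C ! i))}"

definition is_circuit :: "nat \<Rightarrow> 'a circuit \<Rightarrow> bool" where
  "is_circuit m C \<longleftrightarrow> (\<forall>g \<in> set C. gate_ok m (length C) g) \<and> acyclic (circuit_edges C)"

fun gate_value :: "(nat \<Rightarrow> 'a mpoly) \<Rightarrow> 'a::comm_ring_1 gate \<Rightarrow> 'a mpoly" where
  "gate_value v (Input i) = mvar i"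
| "gate_value v (Scalar c) = mconst c"
| "gate_value v (Plus_Gate es) = (\<Sum>(c, j)\<leftarrow>es. mconst c * v j)"
| "gate_value v (Times_Gate es) = (\<Prod>(c, j)\<leftarrow>es. mconst c * v j)"

text \<open>By acyclicity the equations for \<open>v\<close> have exactly one solution on the nodes of \<open>C\<close>.\<close>

definition computes :: "'a::comm_ring_1 circuit \<Rightarrow> 'a mpoly \<Rightarrow> bool" where
  "computes C p \<longleftrightarrow>
     (\<exists>v out. (\<forall>i < length C. v i = gate_value v (C ! i)) \<and> out < length C \<and> v out = p)"

definition circuit_class :: "nat \<Rightarrow> nat \<Rightarrow> real \<Rightarrow> 'a::comm_ring_1 mpoly set" where
  "circuit_class m D s =
     {p. variate m p \<and> total_degree p \<le> D \<and>
         (\<exists>C. is_circuit m C \<and> real (length C) \<le> s \<and> computes C p)}"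


section \<open>Hitting sets\<close>

text \<open>Points of \<open>\<bbbF>\<^sup>m\<close> are lists of length \<open>m\<close>.\<close>

definition hitting_set :: "nat \<Rightarrow> 'a::comm_ring_1 mpoly set \<Rightarrow> 'a list set \<Rightarrow> bool" where
  "hitting_set m \<C> H \<longleftrightarrow>
     H \<subseteq> {a. length a = m} \<and>
     (\<forall>f \<in> \<C>. f \<noteq> 0 \<longrightarrow> (\<exists>a \<in> H. mpoly_eval (\<lambda>i. a ! i) f \<noteq> 0))"


section \<open>Deterministic algorithms\<close>

text \<open>The machine model is the WHILE language over binary trees (Jones, \<^emph>\<open>Computability and
  Complexity from a Programming Perspective\<close>). An assignment costs the size of the value it stores,
  so that subtrees are never shared for free; up to a polynomial, running time is then that of a
  Turing machine. The input is read from and the output is left in variable 0, all other variables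
  are initially \<open>Leaf\<close>.\<close>

datatype tree = Leaf | Node tree tree

datatype texp = Get nat | LeafE | NodeE texp texp | LeftE texp | RightE texp

type_synonym tstate = "nat \<Rightarrow> tree"

fun left_of :: "tree \<Rightarrow> tree" where
  "left_of Leaf = Leaf"
| "left_of (Node l r) = l"

fun right_of :: "tree \<Rightarrow> tree" where
  "right_of Leaf = Leaf"
| "right_of (Node l r) = r"

fun texp_value :: "texp \<Rightarrow> tstate \<Rightarrow> tree" where
  "texp_value (Get x) \<sigma> = \<sigma> x"
| "texp_value LeafE \<sigma> = Leaf"
| "texp_value (NodeE e1 e2) \<sigma> = Node (texp_value e1 \<sigma>) (texp_value e2 \<sigma>)"
| "texp_value (LeftE e) \<sigma> = left_of (texp_value e \<sigma>)"
| "texp_value (RightE e) \<sigma> = right_of (texp_value e \<sigma>)"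

datatype prog =
    Skip
  | Assign nat texp
  | Seq prog prog
  | If texp prog prog
  | While texp prog

text \<open>\<open>exec c \<sigma> t \<tau>\<close>: started in state \<open>\<sigma>\<close>, program \<open>c\<close> halts in state \<open>\<tau>\<close> after time \<open>t\<close>.
  A test succeeds iff its value is not \<open>Leaf\<close>.\<close>

inductive exec :: "prog \<Rightarrow> tstate \<Rightarrow> nat \<Rightarrow> tstate \<Rightarrow> bool" where
  exec_Skip: "exec Skip \<sigma> 1 \<sigma>"
| exec_Assign: "exec (Assign x e) \<sigma> (Suc (size (texp_value e \<sigma>))) (\<sigma>(x := texp_value e \<sigma>))"
| exec_Seq: "exec c1 \<sigma> t1 \<sigma>' \<Longrightarrow> exec c2 \<sigma>' t2 \<sigma>'' \<Longrightarrow> exec (Seq c1 c2) \<sigma> (t1 + t2) \<sigma>''"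
| exec_If_True: "texp_value e \<sigma> \<noteq> Leaf \<Longrightarrow> exec c1 \<sigma> t \<sigma>' \<Longrightarrow> exec (If e c1 c2) \<sigma> (Suc t) \<sigma>'"
| exec_If_False: "texp_value e \<sigma> = Leaf \<Longrightarrow> exec c2 \<sigma> t \<sigma>' \<Longrightarrow> exec (If e c1 c2) \<sigma> (Suc t) \<sigma>'"
| exec_While_False: "texp_value e \<sigma> = Leaf \<Longrightarrow> exec (While e c) \<sigma> 1 \<sigma>"
| exec_While_True: "texp_value e \<sigma> \<noteq> Leaf \<Longrightarrow> exec c \<sigma> t1 \<sigma>' \<Longrightarrow>
    exec (While e c) \<sigma>' t2 \<sigma>'' \<Longrightarrow> exec (While e c) \<sigma> (Suc (t1 + t2)) \<sigma>''"

definition outputs_in_time :: "prog \<Rightarrow> tree \<Rightarrow> tree \<Rightarrow> nat \<Rightarrow> bool" where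
  "outputs_in_time c inp outp t \<longleftrightarrow> (\<exists>\<tau>. exec c ((\<lambda>_. Leaf)(0 := inp)) t \<tau> \<and> \<tau> 0 = outp)"

text \<open>Field elements are output symbolically, as arithmetic expressions over a fixed finite list
  \<open>cs\<close> of constants of the field. Over the rationals this is the usual bit representation up to
  polynomial overhead: an expression of size \<open>n\<close> has a value of \<open>O(n)\<close> bits, and a rational
  of \<open>n\<close> bits has an expression of size \<open>O(n)\<close>. Since expressions are written out in full,
  there is no unit-cost field arithmetic (in characteristic zero, repeated squaring at unit cost
  would make numbers of exponentially many bits available).\<close>

datatype fexp = FConst nat | FAdd fexp fexp | FSub fexp fexp | FMul fexp fexp | FDiv fexp fexp

fun fexp_value :: "'a::field list \<Rightarrow> fexp \<Rightarrow> 'a" where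
  "fexp_value cs (FConst i) = (if i < length cs then cs ! i else 0)"
| "fexp_value cs (FAdd a b) = fexp_value cs a + fexp_value cs b"
| "fexp_value cs (FSub a b) = fexp_value cs a - fexp_value cs b"
| "fexp_value cs (FMul a b) = fexp_value cs a * fexp_value cs b"
| "fexp_value cs (FDiv a b) = fexp_value cs a / fexp_value cs b"

text \<open>Natural numbers are encoded in unary.\<close>

fun enc_nat :: "nat \<Rightarrow> tree" where
  "enc_nat 0 = Leaf"
| "enc_nat (Suc n) = Node Leaf (enc_nat n)"

fun enc_list :: "('b \<Rightarrow> tree) \<Rightarrow> 'b list \<Rightarrow> tree" where
  "enc_list enc [] = Leaf"
| "enc_list enc (x # xs) = Node (enc x) (enc_list enc xs)"

fun enc_fexp :: "fexp \<Rightarrow> tree" where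
  "enc_fexp (FConst i) = Node (enc_nat 0) (enc_nat i)"
| "enc_fexp (FAdd a b) = Node (enc_nat 1) (Node (enc_fexp a) (enc_fexp b))"
| "enc_fexp (FSub a b) = Node (enc_nat 2) (Node (enc_fexp a) (enc_fexp b))"
| "enc_fexp (FMul a b) = Node (enc_nat 3) (Node (enc_fexp a) (enc_fexp b))"
| "enc_fexp (FDiv a b) = Node (enc_nat 4) (Node (enc_fexp a) (enc_fexp b))"

definition enc_term :: "fexp \<times> nat list \<Rightarrow> tree" where
  "enc_term = (\<lambda>(c, es). Node (enc_fexp c) (enc_list enc_nat es))"


section \<open>Explicitness\<close>

text \<open>A polynomial in \<open>k\<close> variables is output as a list of terms, each consisting of a coefficient
  and a vector of \<open>k\<close> exponents. A time bound \<open>c * N ^ c + c\<close> with a constant \<open>c\<close> says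
  \<^emph>\<open>polynomial in N\<close>.\<close>

definition explicit_poly_family :: "(nat \<Rightarrow> nat) \<Rightarrow> (nat \<Rightarrow> 'a::field mpoly) \<Rightarrow> bool" where
  "explicit_poly_family k P \<longleftrightarrow>
     (\<exists>A cs c. \<forall>d. \<exists>ts t.
        outputs_in_time A (enc_nat d) (enc_list enc_term ts) t \<and>
        t \<le> c * (d ^ k d) ^ c + c \<and>
        (\<forall>(a, es) \<in> set ts. length es = k d) \<and>
        P d = (\<Sum>(a, es)\<leftarrow>ts. Poly_Mapping.single (Poly_Mapping.nth es) (fexp_value cs a)))"

definition explicit_set_family :: "(nat \<Rightarrow> 'a::field list set) \<Rightarrow> bool" where
  "explicit_set_family H \<longleftrightarrow>
     (\<exists>A cs c. \<forall>s. \<exists>L t.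
        outputs_in_time A (enc_nat s) (enc_list (enc_list enc_fexp) L) t \<and>
        t \<le> c * card (H s) ^ c + c \<and>
        H s = set (map (map (fexp_value cs)) L))"

text \<open>Logarithms are to base 2; \<open>d powr log 2 d\<close> is rounded down to a natural number.\<close>

definition ktilde :: "(nat \<Rightarrow> nat) \<Rightarrow> nat \<Rightarrow> nat" where
  "ktilde k d = k (nat \<lfloor>real d powr log 2 (real d)\<rfloor>)"

end

theory Submission
  imports Defs "HOL-Computational_Algebra.Polynomial" "HOL-Library.FuncSet"
begin

text \<open>For a polynomial \<open>Q\<close> in \<open>K\<close> variables let \<open>\<Delta>\<^sub>i(x, y)\<close> be the coefficient of \<open>t\<^sup>i\<close> in
  \<open>Q(x + t y)\<close>. Suppose that a nonzero \<open>f\<close> of small degree and circuit size vanishes identically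
  on \<open>(\<Delta>\<^sub>0, \<dots>, \<Delta>\<^sub>s\<^sub>-\<^sub>1)\<close>. Fixing variables and differentiating turns \<open>f\<close> into a differential
  equation of some order \<open>m < s\<close> for \<open>Q\<close> whose separant does not vanish. Around a suitable
  centre this equation determines the homogeneous parts of \<open>Q\<close> of degree \<open>> m\<close> one after the
  other: a first-order Taylor expansion yields the \<open>m\<close>-th derivative of the next part in each of
  \<open>(m + 1)\<^sup>K\<close> grid directions, and Euler's relation recovers from these the part itself and its
  lower derivatives. Hence \<open>Q\<close> has circuits of size \<open>s\<^sup>O\<^sup>(\<^sup>K\<^sup>)\<close> times a fixed power of \<open>deg Q\<close>.

  Taking for \<open>Q\<close> the hard polynomial of degree \<open>d\<close> with all exponents expanded in a base that is
  a small power of \<open>d\<close>, the degree becomes so small that this contradicts the lower bound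
  \<open>d\<^sup>\<delta>\<close>, provided that \<open>d\<close> is at least \<open>s\<^sup>C\<^sup>k\<^sup>(\<^sup>d\<^sup>)\<close> for a large constant \<open>C\<close>. So
  \<open>f(\<Delta>\<^sub>0, \<dots>, \<Delta>\<^sub>s\<^sub>-\<^sub>1)\<close> is a nonzero polynomial, and it is nonzero at some point of a grid.

  The number \<open>ktilde k s\<close> itself is too expensive to compute. Instead the program runs through
  \<open>j = 1, 2, \<dots>\<close> until \<open>k(d) \<le> j\<close> for \<open>d = (s + 2)\<^sup>C\<^sup>j\<close>; for large \<open>s\<close> this happens
  at some \<open>j \<le> ktilde k s\<close>, since \<open>ktilde k s = o(log s)\<close>. Padding the grid image with arbitrary
  further points makes the running time polynomial in the cardinality of the set.\<close>

section \<open>Evaluation of multivariate polynomials\<close>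

text \<open>From one homogeneous part to the next the reconstruction must add gates, not multiply
  them. The recurrence for degree q uses the derivatives of order 0 to m of all earlier parts but
  delivers only the one of order m; Euler's relation regains the others from a fixed grid of
  directions, so every degree costs the same number of gates. This number contains a factor deg Q
  from interpolation, and the total is quadratic in deg Q: useless against d^\<delta> with small
  \<delta>. Hence the digit expansion: with d = b^L and L + 1 digits the degree is about b =
  d^(1/L), the number of variables grows only by the factor L + 1, and P comes back by substituting
  powers of its variables, one gate each. Taking d = (s + 2)^(C j) with k(d) \<le> j makes the
  factors s^K polynomial in x = (s + 2)^j, hence small powers of d. The grid of seeds has side
  x^O(1) and dimension O(j), so its size is (s + 2)^O(j^2): the square in the final exponent.
  Characteristic zero enters through division by binomials and Taylor factors and through the supply
  of nodes.\<close>

abbreviation lookup where "lookup \<equiv> Poly_Mapping.lookup"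
abbreviation keys where "keys \<equiv> Poly_Mapping.keys"

definition mon_eval :: "(nat \<Rightarrow> 'b::comm_semiring_1) \<Rightarrow> (nat \<Rightarrow>\<^sub>0 nat) \<Rightarrow> 'b" where
  "mon_eval x mon = (\<Prod>i\<in>keys mon. x i ^ lookup mon i)"

text \<open>The coefficient map \<open>h\<close> lets one notion of evaluation take values in the
  field, in \<open>'a poly\<close> and in \<open>'a poly poly\<close>, where \<open>h\<close> embeds
  the constants.\<close>

definition aeval :: "('a::zero \<Rightarrow> 'b::comm_semiring_1) \<Rightarrow> (nat \<Rightarrow> 'b) \<Rightarrow> 'a mpoly \<Rightarrow> 'b" where
  "aeval h x p = (\<Sum>mon\<in>keys p. h (lookup p mon) * mon_eval x mon)"

lemma mpoly_eval_eq_aeval: "mpoly_eval x p = aeval (\<lambda>c. c) x p"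
  by (simp add: mpoly_eval_def aeval_def mon_eval_def)

lemma mon_eval_superset:
  assumes "finite I" "keys mon \<subseteq> I"
  shows "mon_eval x mon = (\<Prod>i\<in>I. x i ^ lookup mon i)"
  unfolding mon_eval_def using assms
  by (intro prod.mono_neutral_left) (auto simp: not_in_keys_iff_lookup_eq_zero)

lemma mon_eval_0 [simp]: "mon_eval x 0 = 1"
  by (simp add: mon_eval_def)

lemma mon_eval_add: "mon_eval x (m1 + m2) = mon_eval x m1 * mon_eval x m2"
proof -
  have "mon_eval x (m1 + m2) = (\<Prod>i\<in>keys m1 \<union> keys m2. x i ^ lookup (m1 + m2) i)"
    by (rule mon_eval_superset) (auto simp: Poly_Mapping.keys_add)
  also have "\<dots> = (\<Prod>i\<in>keys m1 \<union> keys m2. x i ^ lookup m1 i) *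
      (\<Prod>i\<in>keys m1 \<union> keys m2. x i ^ lookup m2 i)"
    by (simp add: lookup_add power_add prod.distrib)
  also have "(\<Prod>i\<in>keys m1 \<union> keys m2. x i ^ lookup m1 i) = mon_eval x m1"
    by (rule mon_eval_superset [symmetric]) auto
  also have "(\<Prod>i\<in>keys m1 \<union> keys m2. x i ^ lookup m2 i) = mon_eval x m2"
    by (rule mon_eval_superset [symmetric]) auto
  finally show ?thesis .
qed

lemma mon_eval_cong:
  assumes "\<And>i. i \<in> keys mon \<Longrightarrow> x i = y i"
  shows "mon_eval x mon = mon_eval y mon"
  using assms by (simp add: mon_eval_def)

lemma aeval_superset:
  assumes "finite M" "keys p \<subseteq> M" "h 0 = 0"
  shows "aeval h x p = (\<Sum>mon\<in>M. h (lookup p mon) * mon_eval x mon)"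
  unfolding aeval_def using assms
  by (intro sum.mono_neutral_left) (auto simp: not_in_keys_iff_lookup_eq_zero)

lemma aeval_0 [simp]: "aeval h x 0 = 0"
  by (simp add: aeval_def)

lemma aeval_add:
  assumes "h 0 = 0" "\<And>a b. h (a + b) = h a + h b"
  shows "aeval h x (p + q) = aeval h x p + aeval h x q"
proof -
  have "aeval h x (p + q) = (\<Sum>mon\<in>keys p \<union> keys q. h (lookup (p + q) mon) * mon_eval x mon)"
    by (rule aeval_superset) (auto simp: Poly_Mapping.keys_add assms)
  also have "\<dots> = (\<Sum>mon\<in>keys p \<union> keys q. h (lookup p mon) * mon_eval x mon) +
      (\<Sum>mon\<in>keys p \<union> keys q. h (lookup q mon) * mon_eval x mon)"
    by (simp add: lookup_add assms(2) ring_distribs sum.distrib)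
  also have "(\<Sum>mon\<in>keys p \<union> keys q. h (lookup p mon) * mon_eval x mon) = aeval h x p"
    by (rule aeval_superset [symmetric]) (auto simp: assms)
  also have "(\<Sum>mon\<in>keys p \<union> keys q. h (lookup q mon) * mon_eval x mon) = aeval h x q"
    by (rule aeval_superset [symmetric]) (auto simp: assms)
  finally show ?thesis .
qed

lemma aeval_single:
  assumes "h 0 = 0"
  shows "aeval h x (Poly_Mapping.single mon c) = h c * mon_eval x mon"
  by (cases "c = 0") (simp_all add: aeval_def assms)

lemma aeval_sum_list:
  assumes "h 0 = 0" "\<And>a b. h (a + b) = h a + h b"
  shows "aeval h x (\<Sum>y\<leftarrow>ys. f y) = (\<Sum>y\<leftarrow>ys. aeval h x (f y))"
  by (induction ys) (simp_all add: aeval_add [OF assms])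

lemma aeval_cong:
  assumes "\<And>mon i. mon \<in> keys p \<Longrightarrow> i \<in> keys mon \<Longrightarrow> x i = y i"
  shows "aeval h x p = aeval h y p"
  unfolding aeval_def
  by (intro sum.cong arg_cong2[of _ _ _ _ "(*)"] mon_eval_cong refl) (use assms in auto)

lemma variate_aeval_cong:
  assumes "variate n p" "\<And>i. i < n \<Longrightarrow> x i = y i"
  shows "aeval h x p = aeval h y p"
  using assms by (intro aeval_cong) (auto simp: variate_def)

lemma aeval_hom:
  fixes \<phi> :: "'b::comm_semiring_1 \<Rightarrow> 'c::comm_semiring_1"
  assumes "\<phi> 0 = 0" "\<phi> 1 = 1" "\<And>a b. \<phi> (a + b) = \<phi> a + \<phi> b" "\<And>a b. \<phi> (a * b) = \<phi> a * \<phi> b"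
  shows "\<phi> (aeval h x p) = aeval (\<lambda>c. \<phi> (h c)) (\<lambda>i. \<phi> (x i)) p"
proof -
  have sum: "\<phi> (sum f I) = (\<Sum>i\<in>I. \<phi> (f i))" for f :: "(nat \<Rightarrow>\<^sub>0 nat) \<Rightarrow> 'b" and I
    by (induction I rule: infinite_finite_induct) (simp_all add: assms)
  have pow: "\<phi> (a ^ n) = \<phi> a ^ n" for a and n :: nat
    by (induction n) (simp_all add: assms)
  have prod: "\<phi> (prod f I) = (\<Prod>i\<in>I. \<phi> (f i))" for f :: "nat \<Rightarrow> 'b" and I
    by (induction I rule: infinite_finite_induct) (simp_all add: assms)
  show ?thesis by (simp add: aeval_def mon_eval_def sum prod pow assms)
qed

text \<open>Induction over the way a value is built from constants and variables. The parameter
  \<open>u\<close> makes it relational: over \<open>bool\<close> it compares two evaluations of the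
  same polynomial, over the field it tracks the dependence on one coordinate.\<close>

lemma aeval_closed:
  fixes Pr :: "('u \<Rightarrow> 'b::comm_semiring_1) \<Rightarrow> bool"
  assumes const: "\<And>c. Pr (\<lambda>u. h c)"
    and var: "\<And>mon i. mon \<in> keys p \<Longrightarrow> i \<in> keys mon \<Longrightarrow> Pr (\<lambda>u. x u i)"
    and zero: "Pr (\<lambda>u. 0)" and one: "Pr (\<lambda>u. 1)"
    and add: "\<And>f g. Pr f \<Longrightarrow> Pr g \<Longrightarrow> Pr (\<lambda>u. f u + g u)"
    and mult: "\<And>f g. Pr f \<Longrightarrow> Pr g \<Longrightarrow> Pr (\<lambda>u. f u * g u)"
  shows "Pr (\<lambda>u. aeval h (x u) p)"
proof -
  have sum: "Pr (\<lambda>u. \<Sum>i\<in>I. f i u)" if "finite I" "\<And>i. i \<in> I \<Longrightarrow> Pr (f i)"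
    for f :: "(nat \<Rightarrow>\<^sub>0 nat) \<Rightarrow> 'u \<Rightarrow> 'b" and I
    using that by (induction I) (auto intro: zero add)
  have pow: "Pr (\<lambda>u. f u ^ n)" if "Pr f" for f and n :: nat
    using that by (induction n) (auto intro: one mult)
  have prod: "Pr (\<lambda>u. \<Prod>i\<in>I. f i u)" if "finite I" "\<And>i. i \<in> I \<Longrightarrow> Pr (f i)"
    for f :: "nat \<Rightarrow> 'u \<Rightarrow> 'b" and I
    using that by (induction I) (auto intro: one mult)
  show ?thesis unfolding aeval_def mon_eval_def
    by (intro sum prod pow mult const) (auto intro: var)
qed

section \<open>Evaluation respects the ring operations\<close>

lemma mpoly_eval_add: "mpoly_eval x (p + q) = mpoly_eval x p + mpoly_eval x q"
  by (simp add: mpoly_eval_eq_aeval aeval_add)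

lemma mpoly_eval_single: "mpoly_eval x (Poly_Mapping.single mon c) = c * mon_eval x mon"
  by (simp add: mpoly_eval_eq_aeval aeval_single)

lemma mpoly_eval_0 [simp]: "mpoly_eval x 0 = 0"
  by (simp add: mpoly_eval_eq_aeval)

lemma mpoly_eval_1 [simp]: "mpoly_eval x 1 = 1"
  using mpoly_eval_single[of x 0 1] by simp

lemma mpoly_eval_sum: "mpoly_eval x (sum f I) = (\<Sum>i\<in>I. mpoly_eval x (f i))"
  by (induction I rule: infinite_finite_induct) (simp_all add: mpoly_eval_add)

lemma mpoly_eval_minus:
  fixes p q :: "'a::comm_ring_1 mpoly"
  shows "mpoly_eval x (p - q) = mpoly_eval x p - mpoly_eval x q"
  using mpoly_eval_add[of x "p - q" q] by (simp add: algebra_simps)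

lemma mpoly_sum_singles: "p = (\<Sum>mon\<in>keys p. Poly_Mapping.single mon (lookup p mon))"
proof (rule poly_mapping_eqI)
  fix m
  have "lookup (\<Sum>mon\<in>keys p. Poly_Mapping.single mon (lookup p mon)) m =
      (\<Sum>mon\<in>keys p. if mon = m then lookup p m else 0)"
    by (auto simp: lookup_sum lookup_single when_def intro!: sum.cong)
  also have "\<dots> = lookup p m"
    by (simp add: not_in_keys_iff_lookup_eq_zero)
  finally show "lookup p m = lookup (\<Sum>mon\<in>keys p. Poly_Mapping.single mon (lookup p mon)) m" ..
qed

lemma mpoly_eval_mult: "mpoly_eval x (p * q) = mpoly_eval x p * mpoly_eval x q"
proof -
  have "p * q = (\<Sum>m1\<in>keys p. \<Sum>m2\<in>keys q.
      Poly_Mapping.single m1 (lookup p m1) * Poly_Mapping.single m2 (lookup q m2))"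
    using mpoly_sum_singles[of p] mpoly_sum_singles[of q] by (metis (mono_tags, lifting) sum.cong sum_product)
  then have "mpoly_eval x (p * q) = (\<Sum>m1\<in>keys p. \<Sum>m2\<in>keys q.
      (lookup p m1 * mon_eval x m1) * (lookup q m2 * mon_eval x m2))"
    by (simp add: mpoly_eval_sum mult_single mpoly_eval_single mon_eval_add mult_ac)
  also have "\<dots> = mpoly_eval x p * mpoly_eval x q"
    by (simp add: mpoly_eval_eq_aeval aeval_def sum_product)
  finally show ?thesis .
qed

lemma mpoly_eval_sum_list: "mpoly_eval x (\<Sum>y\<leftarrow>ys. f y) = (\<Sum>y\<leftarrow>ys. mpoly_eval x (f y))"
  by (induction ys) (simp_all add: mpoly_eval_add)

lemma mpoly_eval_prod_list: "mpoly_eval x (\<Prod>y\<leftarrow>ys. f y) = (\<Prod>y\<leftarrow>ys. mpoly_eval x (f y))"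
  by (induction ys) (simp_all add: mpoly_eval_mult)

lemma mpoly_eval_mconst [simp]: "mpoly_eval x (mconst c) = c"
  by (simp add: mconst_def mpoly_eval_single)

lemma mpoly_eval_mvar [simp]: "mpoly_eval x (mvar i) = x i"
  by (simp add: mvar_def mpoly_eval_single mon_eval_def)

lemma mpoly_eval_cong:
  assumes "variate n p" "\<And>i. i < n \<Longrightarrow> x i = y i"
  shows "mpoly_eval x p = mpoly_eval y p"
  using variate_aeval_cong[OF assms] by (simp add: mpoly_eval_eq_aeval)

section \<open>Univariate polynomials\<close>

lemma poly_eqI_infinite:
  fixes p q :: "'a::field_char_0 poly"
  assumes "\<And>x. poly p x = poly q x"
  shows "p = q"
  using poly_all_0_iff_0[of "p - q"] assms by simp

definition lagrange :: "'a::field set \<Rightarrow> 'a \<Rightarrow> 'a poly" where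
  "lagrange S c = (\<Prod>c'\<in>S - {c}. smult (inverse (c - c')) [:- c', 1:])"

lemma poly_lagrange: "poly (lagrange S c) u = (\<Prod>c'\<in>S - {c}. (u - c') * inverse (c - c'))"
  by (simp add: lagrange_def poly_prod algebra_simps)

lemma poly_lagrange_node:
  assumes "finite S" "c \<in> S" "c' \<in> S"
  shows "poly (lagrange S c) c' = (if c' = c then 1 else 0)"
proof (cases "c' = c")
  case True
  then show ?thesis by (auto simp: poly_lagrange intro!: prod.neutral right_inverse)
next
  case False
  then have "(\<Prod>x\<in>S - {c}. (c' - x) * inverse (c - x)) = 0"
    using assms by (intro prod_zero bexI[of _ c']) auto
  then show ?thesis using False by (simp add: poly_lagrange)
qed

lemma degree_lagrange_le:
  assumes "finite S" "card S = Suc n" "c \<in> S"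
  shows "degree (lagrange S c) \<le> n"
proof -
  have "degree (lagrange S c) \<le> sum (degree \<circ> (\<lambda>c'. smult (inverse (c - c')) [:- c', 1:])) (S - {c})"
    unfolding lagrange_def using assms(1) by (intro degree_prod_sum_le) auto
  also have "\<dots> \<le> (\<Sum>c'\<in>S - {c}. 1)"
    by (intro sum_mono) simp
  finally show ?thesis using assms by simp
qed

lemma lagrange_interpolation:
  fixes p :: "'a::field poly"
  assumes S: "finite S" "card S = Suc n" and p: "degree p \<le> n"
  shows "p = (\<Sum>c\<in>S. smult (poly p c) (lagrange S c))"
proof (rule poly_eqI_degree)
  fix x assume x: "x \<in> S"
  have "poly (\<Sum>c\<in>S. smult (poly p c) (lagrange S c)) x = (\<Sum>c\<in>S. if x = c then poly p c else 0)"
    using x S by (simp add: poly_sum poly_lagrange_node if_distrib cong: if_cong sum.cong)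
  also have "\<dots> = poly p x" using x S by simp
  finally show "poly p x = poly (\<Sum>c\<in>S. smult (poly p c) (lagrange S c)) x" ..
next
  show "degree p < card S" using S p by simp
  have "degree (\<Sum>c\<in>S. smult (poly p c) (lagrange S c)) \<le> n"
    using S by (intro degree_sum_le) (auto intro: order.trans[OF degree_smult_le] degree_lagrange_le)
  then show "degree (\<Sum>c\<in>S. smult (poly p c) (lagrange S c)) < card S" using S by simp
qed

lemma coeff_by_interpolation:
  fixes p :: "'a::field poly"
  assumes S: "finite S" "card S = Suc n" and p: "degree p \<le> n"
  shows "coeff p r = (\<Sum>c\<in>S. coeff (lagrange S c) r * poly p c)"
  by (subst lagrange_interpolation[OF assms]) (simp add: coeff_sum mult_ac)

definition nodes :: "nat \<Rightarrow> 'a::field_char_0 set" where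
  "nodes n = of_nat ` {..n}"

lemma nodes_props [simp]: "finite (nodes n)" "card (nodes n) = Suc n"
  by (simp_all add: nodes_def card_image inj_on_def)

section \<open>Functions that are polynomial in each coordinate\<close>

definition polydeg :: "nat \<Rightarrow> ('a::comm_semiring_0 \<Rightarrow> 'a) \<Rightarrow> bool" where
  "polydeg n f \<longleftrightarrow> (\<exists>p. degree p \<le> n \<and> (\<forall>u. f u = poly p u))"

lemma polydeg_const [simp]: "polydeg n (\<lambda>u. c)"
  unfolding polydeg_def by (rule exI[of _ "[:c:]"]) simp

lemma polydeg_id: "n \<ge> 1 \<Longrightarrow> polydeg n (\<lambda>u::'a::comm_semiring_1. u)"
  unfolding polydeg_def by (rule exI[of _ "[:0, 1:]"]) simp

lemma polydeg_add: "polydeg n f \<Longrightarrow> polydeg n g \<Longrightarrow> polydeg n (\<lambda>u. f u + g u)"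
  unfolding polydeg_def by (metis degree_add_le poly_add)

lemma polydeg_mono: "polydeg n f \<Longrightarrow> n \<le> n' \<Longrightarrow> polydeg n' f"
  unfolding polydeg_def by (meson order.trans)

lemma polydeg_mult: "polydeg n f \<Longrightarrow> polydeg n' g \<Longrightarrow> polydeg (n + n') (\<lambda>u. f u * g u)"
  for f g :: "'a::comm_semiring_1 \<Rightarrow> 'a"
  unfolding polydeg_def by (metis (no_types, lifting) add_mono degree_mult_le order.trans poly_mult)

lemma polydeg_cmult: "polydeg n f \<Longrightarrow> polydeg n (\<lambda>u. c * f u)"
  for f :: "'a::comm_semiring_1 \<Rightarrow> 'a"
  using polydeg_mult[of 0 "\<lambda>u. c" n f] by simp

lemma polydeg_sum: "(\<And>i. i \<in> I \<Longrightarrow> polydeg n (f i)) \<Longrightarrow> polydeg n (\<lambda>u. \<Sum>i\<in>I. f i u)"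
  by (induction I rule: infinite_finite_induct) (auto intro: polydeg_add)

text \<open>Individual degree at most \<open>n\<close> in the first \<open>K\<close> coordinates;
  further coordinates are parameters. Being a property of functions, it also applies to coefficients
  of auxiliary polynomials.\<close>

definition sep :: "nat \<Rightarrow> nat \<Rightarrow> ((nat \<Rightarrow> 'a::comm_semiring_0) \<Rightarrow> 'a) \<Rightarrow> bool" where
  "sep K n f \<longleftrightarrow> (\<forall>v<K. \<forall>y. polydeg n (\<lambda>u. f (y(v := u))))"

text \<open>Tensor product of univariate Lagrange interpolations, peeling off the last coordinate.
  Each coordinate has its own node set because the grid of directions is later moved away from the
  zeros of the separant.\<close>

lemma grid_interpolation:
  fixes f :: "(nat \<Rightarrow> 'a::field) \<Rightarrow> 'a"
  assumes "sep K n f" "\<And>v. v < K \<Longrightarrow> finite (S v) \<and> card (S v) = Suc n"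
  shows "f y = (\<Sum>b\<in>PiE {..<K} S. f (\<lambda>v. if v < K then b v else y v) *
      (\<Prod>v<K. poly (lagrange (S v) (b v)) (y v)))"
  using assms
proof (induction K arbitrary: y)
  case 0
  then show ?case by simp
next
  case (Suc K)
  let ?l = "\<lambda>b v. poly (lagrange (S v) (b v)) (y v)"
  have sep: "sep K n f" using Suc.prems(1) by (simp add: sep_def)
  have K: "finite (S K)" "card (S K) = Suc n" using Suc.prems(2)[of K] by auto
  obtain p where p: "degree p \<le> n" "\<And>u. f (y(K := u)) = poly p u"
    using Suc.prems(1) unfolding sep_def polydeg_def by blast
  have "f y = poly p (y K)" using p(2)[of "y K"] by simp
  also have "\<dots> = (\<Sum>c\<in>S K. f (y(K := c)) * poly (lagrange (S K) c) (y K))"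
    by (subst lagrange_interpolation[OF K p(1)]) (simp add: poly_sum p(2))
  also have "\<dots> = (\<Sum>c\<in>S K. (\<Sum>b\<in>PiE {..<K} S. f (\<lambda>v. if v < K then b v else (y(K := c)) v) *
      (\<Prod>v<K. ?l b v)) * poly (lagrange (S K) c) (y K))"
    using Suc.prems(2) by (intro sum.cong refl arg_cong2[of _ _ _ _ "(*)"], subst Suc.IH[OF sep]) auto
  also have "\<dots> = (\<Sum>c\<in>S K. \<Sum>b\<in>PiE {..<K} S. f (\<lambda>v. if v < Suc K then (b(K := c)) v else y v) *
      (\<Prod>v<Suc K. ?l (b(K := c)) v))"
  proof (intro sum.cong refl, unfold sum_distrib_right, intro sum.cong refl)
    fix c b
    have "(\<lambda>v. if v < K then b v else (y(K := c)) v) = (\<lambda>v. if v < Suc K then (b(K := c)) v else y v)"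
      by (auto simp: fun_eq_iff less_Suc_eq)
    moreover have "(\<Prod>v<K. ?l (b(K := c)) v) = (\<Prod>v<K. ?l b v)"
      by (intro prod.cong) auto
    ultimately show "f (\<lambda>v. if v < K then b v else (y(K := c)) v) * (\<Prod>v<K. ?l b v) * poly (lagrange (S K) c) (y K) =
        f (\<lambda>v. if v < Suc K then (b(K := c)) v else y v) * (\<Prod>v<Suc K. ?l (b(K := c)) v)"
      by (simp add: mult.assoc)
  qed
  also have "\<dots> = (\<Sum>b\<in>PiE {..<Suc K} S. f (\<lambda>v. if v < Suc K then b v else y v) *
      (\<Prod>v<Suc K. ?l b v))"
    unfolding sum.cartesian_product
    by (rule sum.reindex_bij_witness[of _ "\<lambda>b. (b K, b(K := undefined))" "\<lambda>(c, b). b(K := c)"])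
      (auto simp: PiE_def extensional_def Pi_def fun_upd_def fun_eq_iff)
  finally show ?case .
qed

lemma sep_vanish:
  fixes f :: "(nat \<Rightarrow> 'a::field) \<Rightarrow> 'a"
  assumes "sep K n f" "\<And>v. v < K \<Longrightarrow> finite (S v) \<and> card (S v) = Suc n"
    and "\<And>x. (\<forall>v<K. x v \<in> S v) \<Longrightarrow> f x = 0"
  shows "f y = 0"
proof -
  have "f (\<lambda>v. if v < K then b v else y v) = 0" if "b \<in> PiE {..<K} S" for b
    using that by (intro assms(3)) auto
  then show ?thesis
    by (intro trans[OF grid_interpolation[OF assms(1,2)]] sum.neutral ballI) auto
qed

section \<open>Straight-line derivations\<close>

text \<open>Gates act on functions of the point rather than on polynomials, so that substitution is
  composition. The set \<open>A\<close> holds what is already available; the scalars are the edge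
  constants of the circuit model.\<close>

definition gate_step :: "nat \<Rightarrow> ((nat \<Rightarrow> 'a::comm_ring_1) \<Rightarrow> 'a) set \<Rightarrow> ((nat \<Rightarrow> 'a) \<Rightarrow> 'a) \<Rightarrow> bool" where
  "gate_step m A f \<longleftrightarrow>
     (\<exists>i<m. f = (\<lambda>x. x i)) \<or> (\<exists>c. f = (\<lambda>x. c)) \<or>
     (\<exists>es. es \<noteq> [] \<and> snd ` set es \<subseteq> A \<and> f = (\<lambda>x. \<Sum>(c, g)\<leftarrow>es. c * g x)) \<or>
     (\<exists>es. es \<noteq> [] \<and> snd ` set es \<subseteq> A \<and> f = (\<lambda>x. \<Prod>(c, g)\<leftarrow>es. c * g x))"

inductive slp :: "nat \<Rightarrow> ((nat \<Rightarrow> 'a::comm_ring_1) \<Rightarrow> 'a) set \<Rightarrow> ((nat \<Rightarrow> 'a) \<Rightarrow> 'a) list \<Rightarrow> bool"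
  for m A where
  slp_Nil: "slp m A []"
| slp_snoc: "slp m A L \<Longrightarrow> gate_step m (A \<union> set L) f \<Longrightarrow> slp m A (L @ [f])"

text \<open>\<open>N\<close> counts only new gates: members of \<open>A\<close> are free, and an
  intermediate result shared by several members of \<open>B\<close> is paid for once.\<close>

definition derivable :: "nat \<Rightarrow> ((nat \<Rightarrow> 'a::comm_ring_1) \<Rightarrow> 'a) set \<Rightarrow> ((nat \<Rightarrow> 'a) \<Rightarrow> 'a) set \<Rightarrow> nat \<Rightarrow> bool" where
  "derivable m A B N \<longleftrightarrow> (\<exists>L. length L \<le> N \<and> slp m A L \<and> B \<subseteq> A \<union> set L)"

lemma gate_step_mono: "gate_step m A f \<Longrightarrow> A \<subseteq> A' \<Longrightarrow> gate_step m A' f"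
proof (unfold gate_step_def[of m A], elim disjE)
  assume "\<exists>es. es \<noteq> [] \<and> snd ` set es \<subseteq> A \<and> f = (\<lambda>x. \<Sum>(c, g)\<leftarrow>es. c * g x)" and A: "A \<subseteq> A'"
  then obtain es where "es \<noteq> []" "snd ` set es \<subseteq> A" "f = (\<lambda>x. \<Sum>(c, g)\<leftarrow>es. c * g x)"
    by blast
  then have "\<exists>es. es \<noteq> [] \<and> snd ` set es \<subseteq> A' \<and> f = (\<lambda>x. \<Sum>(c, g)\<leftarrow>es. c * g x)"
    using A by (intro exI[of _ es]) auto
  then show ?thesis unfolding gate_step_def by (intro disjI2 disjI1)
next
  assume "\<exists>es. es \<noteq> [] \<and> snd ` set es \<subseteq> A \<and> f = (\<lambda>x. \<Prod>(c, g)\<leftarrow>es. c * g x)" and A: "A \<subseteq> A'"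
  then obtain es where "es \<noteq> []" "snd ` set es \<subseteq> A" "f = (\<lambda>x. \<Prod>(c, g)\<leftarrow>es. c * g x)"
    by blast
  then have "\<exists>es. es \<noteq> [] \<and> snd ` set es \<subseteq> A' \<and> f = (\<lambda>x. \<Prod>(c, g)\<leftarrow>es. c * g x)"
    using A by (intro exI[of _ es]) auto
  then show ?thesis unfolding gate_step_def by (intro disjI2)
qed (auto simp: gate_step_def)

lemma slp_append:
  assumes "slp m A L1" "slp m A' L2" "A' \<subseteq> A \<union> set L1"
  shows "slp m A (L1 @ L2)"
  using assms(2)
proof induction
  case slp_Nil
  then show ?case using assms(1) by simp
next
  case (slp_snoc L f)
  have "gate_step m (A \<union> set (L1 @ L)) f"
    using slp_snoc.hyps(2) by (rule gate_step_mono) (use assms(3) in auto)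
  from slp.slp_snoc[OF slp_snoc.IH this] show ?case by simp
qed

lemma derivable_trans:
  assumes "derivable m A B N1" "derivable m (A \<union> B) C N2"
  shows "derivable m A (B \<union> C) (N1 + N2)"
proof -
  obtain L1 L2 where "length L1 \<le> N1" "slp m A L1" "B \<subseteq> A \<union> set L1"
    "length L2 \<le> N2" "slp m (A \<union> B) L2" "C \<subseteq> A \<union> B \<union> set L2"
    using assms unfolding derivable_def by blast
  then show ?thesis unfolding derivable_def
    by (intro exI[of _ "L1 @ L2"]) (auto intro: slp_append)
qed

lemma derivable_mono:
  assumes "derivable m A B N" "A \<subseteq> A'" "B' \<subseteq> A' \<union> B" "N \<le> N'"
  shows "derivable m A' B' N'"
proof -
  obtain L where L: "length L \<le> N" "slp m A L" "B \<subseteq> A \<union> set L"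
    using assms unfolding derivable_def by blast
  have "slp m A' L"
    using slp_append[OF slp_Nil L(2), of A'] assms(2) by simp
  then show ?thesis unfolding derivable_def using L assms by (intro exI[of _ L]) auto
qed

lemma derivable_refl: "B \<subseteq> A \<Longrightarrow> derivable m A B 0"
  unfolding derivable_def by (intro exI[of _ "[]"]) (auto intro: slp_Nil)

lemma derivable_step: "gate_step m A f \<Longrightarrow> derivable m A {f} 1"
  unfolding derivable_def using slp_snoc[OF slp_Nil, of m A f]
  by (intro exI[of _ "[f]"]) auto

lemma derivable_family:
  assumes "finite I" "\<And>i. i \<in> I \<Longrightarrow> derivable m A (B i) n"
  shows "derivable m A (\<Union>i\<in>I. B i) (card I * n)"
  using assms
proof (induction I)
  case empty
  then show ?case by (simp add: derivable_refl)
next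
  case (insert i I)
  have "derivable m (A \<union> (\<Union>i\<in>I. B i)) (B i) n"
    by (rule derivable_mono[OF insert.prems[of i]]) auto
  with insert have "derivable m A ((\<Union>i\<in>I. B i) \<union> B i) (card I * n + n)"
    by (intro derivable_trans) auto
  then show ?case using insert.hyps by (simp add: Un_commute add.commute)
qed

lemma derivable_steps:
  assumes "finite I" "\<And>i. i \<in> I \<Longrightarrow> gate_step m A (f i)"
  shows "derivable m A (f ` I) (card I)"
  using derivable_family[OF assms(1), of m A "\<lambda>i. {f i}" 1] derivable_step assms(2)
  by (auto simp: UNION_singleton_eq_range)

lemma gate_step_var: "i < m \<Longrightarrow> gate_step m A (\<lambda>x. x i)"
  unfolding gate_step_def by blast

lemma gate_step_const: "gate_step m A (\<lambda>x. c)"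
  unfolding gate_step_def by blast

text \<open>A gate must have an incoming edge; an empty sum or product is a constant gate.\<close>

lemma gate_step_sum:
  assumes "finite I" "\<And>i. i \<in> I \<Longrightarrow> g i \<in> A"
  shows "gate_step m A (\<lambda>x. \<Sum>i\<in>I. c i * g i x)"
proof (cases "I = {}")
  case True
  then show ?thesis by (simp add: gate_step_const)
next
  case False
  obtain xs where xs: "set xs = I" "distinct xs" using assms(1) finite_distinct_list by blast
  have "(\<Sum>(c, g)\<leftarrow>map (\<lambda>i. (c i, g i)) xs. c * g x) = (\<Sum>i\<in>I. c i * g i x)" for x
    using sum.distinct_set_conv_list[OF xs(2), of "\<lambda>i. c i * g i x"] xs(1) by (simp add: o_def)
  then show ?thesis unfolding gate_step_def using xs assms False
    by (intro disjI2 disjI1 exI[of _ "map (\<lambda>i. (c i, g i)) xs"]) auto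
qed

lemma gate_step_prod:
  assumes "finite I" "\<And>i. i \<in> I \<Longrightarrow> g i \<in> A"
  shows "gate_step m A (\<lambda>x. \<Prod>i\<in>I. c i * g i x)"
proof (cases "I = {}")
  case True
  then show ?thesis by (simp add: gate_step_const)
next
  case False
  obtain xs where xs: "set xs = I" "distinct xs" using assms(1) finite_distinct_list by blast
  have "(\<Prod>(c, g)\<leftarrow>map (\<lambda>i. (c i, g i)) xs. c * g x) = (\<Prod>i\<in>I. c i * g i x)" for x
    using prod.distinct_set_conv_list[OF xs(2), of "\<lambda>i. c i * g i x"] xs(1) by (simp add: o_def)
  then show ?thesis unfolding gate_step_def using xs assms False
    by (intro disjI2 exI[of _ "map (\<lambda>i. (c i, g i)) xs"]) auto
qed

lemma gate_step_mult:
  assumes "g \<in> A" "h \<in> A"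
  shows "gate_step m A (\<lambda>x. g x * h x)"
  using gate_step_prod[of "{True, False}" "\<lambda>b. if b then g else h" A m "\<lambda>_. 1"] assms
  by simp

lemma gate_step_power:
  assumes "g \<in> A"
  shows "gate_step m A (\<lambda>x. g x ^ n)"
  using gate_step_prod[of "{..<n}" "\<lambda>_. g" A m "\<lambda>_. 1"] assms by simp

lemma gate_step_affine:
  assumes "g \<in> A" "(\<lambda>x. 1) \<in> A"
  shows "gate_step m A (\<lambda>x. a * g x + c)"
  using gate_step_sum[of "{True, False}" "\<lambda>b. if b then g else (\<lambda>x. 1)" A m "\<lambda>b. if b then a else c"] assms
  by simp

section \<open>Translation between circuits and derivations\<close>

lemma acyclic_maximal:
  assumes "acyclic r" "finite T" "T \<noteq> {}"
  shows "\<exists>i\<in>T. \<forall>j\<in>T. (i, j) \<notin> r"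
proof -
  have "finite (r \<inter> T \<times> T)" using assms(2) by simp
  moreover have "acyclic (r \<inter> T \<times> T)" using assms(1) by (rule acyclic_subset) simp
  ultimately have "wf ((r \<inter> T \<times> T)\<inverse>)"
    by (simp add: finite_acyclic_wf_converse)
  then obtain i where "i \<in> T" "\<And>j. (j, i) \<in> (r \<inter> T \<times> T)\<inverse> \<Longrightarrow> j \<notin> T"
    by (rule wfE_min'[OF _ assms(3)]) blast
  then show ?thesis by blast
qed

text \<open>The nodes of \<open>C\<close>, evaluated at the functions \<open>w\<close>, become gates
  over \<open>A\<close>, and input nodes are members of \<open>A\<close>. This is how the circuit of
  an annihilator is run on computed arguments.\<close>

lemma derivable_substitute:
  fixes f :: "'a::comm_ring_1 mpoly"
  assumes C: "is_circuit n C" "computes C f" and w: "\<And>i. i < n \<Longrightarrow> w i \<in> A"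
  shows "derivable m A {\<lambda>x. mpoly_eval (\<lambda>i. w i x) f} (length C)"
proof -
  obtain v out where v: "\<And>i. i < length C \<Longrightarrow> v i = gate_value v (C ! i)"
    and out: "out < length C" "v out = f"
    using C(2) unfolding computes_def by blast
  define F where "F i = (\<lambda>x. mpoly_eval (\<lambda>i. w i x) (v i))" for i
  let ?r = "circuit_edges C"
  \<comment> \<open>The list \<open>C\<close> need not be in topological order, so the induction
    runs over predecessor-closed sets of nodes: a node without successor in \<open>T\<close> is
    removed and becomes the last gate.\<close>
  have "derivable m A (F ` T) (card T)"
    if "T \<subseteq> {..<length C}" "\<And>j i. (j, i) \<in> ?r \<Longrightarrow> i \<in> T \<Longrightarrow> j \<in> T" for T
    using that
  proof (induction "card T" arbitrary: T)
    case 0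
    then have "T = {}" using finite_subset by fastforce
    then show ?case by (simp add: derivable_refl)
  next
    case (Suc t)
    have "finite T" using Suc.prems(1) finite_subset by blast
    moreover have "T \<noteq> {}" using Suc.hyps(2) by auto
    ultimately obtain i where i: "i \<in> T" "\<And>j. j \<in> T \<Longrightarrow> (i, j) \<notin> ?r"
      using acyclic_maximal[of ?r T] C(1) unfolding is_circuit_def by blast
    have iC: "i < length C" using i(1) Suc.prems(1) by auto
    have card: "card (T - {i}) = t" using Suc.hyps(2) i(1) \<open>finite T\<close> by simp
    have 1: "derivable m A (F ` (T - {i})) (card (T - {i}))"
      using Suc.hyps(1)[of "T - {i}"] card Suc.prems i by auto
    have 2: "derivable m (A \<union> F ` (T - {i})) {F i} 1"
    proof -
      have ok: "gate_ok n (length C) (C ! i)" using C(1) iC unfolding is_circuit_def by simp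
      have pred: "j \<in> T - {i}" if "(c, j) \<in> set (in_edges (C ! i))" for c j
      proof -
        have "(j, i) \<in> ?r" using that iC unfolding circuit_edges_def by force
        then show ?thesis using Suc.prems(2) i by blast
      qed
      show ?thesis
      proof (cases "C ! i")
        case (Input j)
        then have "F i = w j" using v[OF iC] by (simp add: F_def)
        then have "derivable m (A \<union> F ` (T - {i})) {F i} 0"
          using w[of j] ok Input by (intro derivable_refl) auto
        then show ?thesis by (rule derivable_mono) auto
      next
        case (Scalar c)
        then have "F i = (\<lambda>x. c)" using v[OF iC] by (simp add: F_def)
        then show ?thesis by (metis derivable_step gate_step_const)
      next
        case (Plus_Gate es)
        then have "F i = (\<lambda>x. \<Sum>(c, g)\<leftarrow>map (\<lambda>(c, j). (c, F j)) es. c * g x)"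
          using v[OF iC] by (simp add: F_def mpoly_eval_sum_list mpoly_eval_prod_list mpoly_eval_mult o_def case_prod_unfold)
        then show ?thesis using ok pred Plus_Gate
          by (intro derivable_step, unfold gate_step_def)
            (intro disjI2 disjI1 exI[of _ "map (\<lambda>(c, j). (c, F j)) es"], auto)
      next
        case (Times_Gate es)
        then have "F i = (\<lambda>x. \<Prod>(c, g)\<leftarrow>map (\<lambda>(c, j). (c, F j)) es. c * g x)"
          using v[OF iC] by (simp add: F_def mpoly_eval_sum_list mpoly_eval_prod_list mpoly_eval_mult o_def case_prod_unfold)
        then show ?thesis using ok pred Times_Gate
          by (intro derivable_step, unfold gate_step_def)
            (intro disjI2 exI[of _ "map (\<lambda>(c, j). (c, F j)) es"], auto)
      qed
    qed
    have "derivable m A (F ` (T - {i}) \<union> {F i}) (t + 1)"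
      using derivable_trans[OF 1 2] unfolding card .
    moreover have "F ` (T - {i}) \<union> {F i} = F ` T" using i(1) by auto
    ultimately show ?case using Suc.hyps(2) by simp
  qed
  note topological = this
  have "j < length C" if "(j, i) \<in> circuit_edges C" for j i
  proof -
    have "i < length C" "j \<in> snd ` set (in_edges (C ! i))"
      using that by (auto simp: circuit_edges_def)
    moreover from this have "gate_ok n (length C) (C ! i)"
      using C(1) by (simp add: is_circuit_def)
    ultimately show ?thesis by (cases "C ! i") auto
  qed
  then have "derivable m A (F ` {..<length C}) (length C)"
    using topological[of "{..<length C}"] by simp
  then show ?thesis
    by (rule derivable_mono) (use out in \<open>auto simp: F_def\<close>)
qed

text \<open>A derivation from nothing is already in topological order. Having
  \<open>gate_ok m i\<close> at position \<open>i\<close> makes all edges point backwards, which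
  later gives acyclicity.\<close>

lemma slp_circuit:
  fixes L :: "((nat \<Rightarrow> 'a::comm_ring_1) \<Rightarrow> 'a) list"
  assumes "slp m {} L"
  shows "\<exists>C v. length C = length L \<and>
    (\<forall>i<length C. gate_ok m i (C ! i) \<and> v i = gate_value v (C ! i) \<and> (\<forall>x. mpoly_eval x (v i) = (L ! i) x))"
  using assms
proof induction
  case slp_Nil
  then show ?case by simp
next
  case (slp_snoc L f)
  then obtain C v where C: "length C = length L"
    "\<And>i. i < length C \<Longrightarrow> gate_ok m i (C ! i)" "\<And>i. i < length C \<Longrightarrow> v i = gate_value v (C ! i)"
    "\<And>i x. i < length C \<Longrightarrow> mpoly_eval x (v i) = (L ! i) x"
    by blast
  let ?n = "length C"
  \<comment> \<open>The same function may occur several times in \<open>L\<close>; any of its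
    positions will do.\<close>
  define pos where "pos g = (SOME j. j < length L \<and> L ! j = g)" for g
  have pos: "pos g < length L \<and> L ! pos g = g" if "g \<in> set L" for g
    unfolding pos_def using someI_ex[of "\<lambda>j. j < length L \<and> L ! j = g"] that
    by (simp add: in_set_conv_nth)
  have gv: "gate_value v' g = gate_value v g" if "\<And>i. i < ?n \<Longrightarrow> v' i = v i" "gate_ok m k g" "k \<le> ?n"
    for v' k and g :: "'a gate"
  proof -
    have "v' j = v j" if "(c, j) \<in> set (in_edges g)" for c j
      using that \<open>gate_ok m k g\<close> \<open>k \<le> ?n\<close> \<open>\<And>i. i < ?n \<Longrightarrow> v' i = v i\<close> by (cases g) fastforce+
    then show ?thesis
      by (cases g) (auto intro!: arg_cong[of _ _ sum_list] arg_cong[of _ _ prod_list])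
  qed
  have "\<exists>g. gate_ok m ?n g \<and> (\<forall>x. mpoly_eval x (gate_value v g) = f x)"
  proof -
    consider (var) i where "i < m" "f = (\<lambda>x. x i)" | (const) c where "f = (\<lambda>x. c)"
      | (plus) es where "es \<noteq> []" "snd ` set es \<subseteq> set L" "f = (\<lambda>x. \<Sum>(c, g)\<leftarrow>es. c * g x)"
      | (times) es where "es \<noteq> []" "snd ` set es \<subseteq> set L" "f = (\<lambda>x. \<Prod>(c, g)\<leftarrow>es. c * g x)"
      using slp_snoc.hyps(2) unfolding gate_step_def by auto
    then show ?thesis
    proof cases
      case var
      then show ?thesis by (intro exI[of _ "Input i"]) simp
    next
      case const
      then show ?thesis by (intro exI[of _ "Scalar c"]) simp
    next
      case plus
      have eq: "mpoly_eval x (v (pos (snd e))) = snd e x" if "e \<in> set es" for e x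
        using C(4)[of "pos (snd e)"] pos[of "snd e"] plus that C(1) by auto
      show ?thesis
        using plus pos C(1) eq
        by (intro exI[of _ "Plus_Gate (map (\<lambda>(c, g). (c, pos g)) es)"])
          (auto simp: mpoly_eval_sum_list mpoly_eval_prod_list mpoly_eval_mult o_def case_prod_unfold cong: map_cong)
    next
      case times
      have eq: "mpoly_eval x (v (pos (snd e))) = snd e x" if "e \<in> set es" for e x
        using C(4)[of "pos (snd e)"] pos[of "snd e"] times that C(1) by auto
      show ?thesis
        using times pos C(1) eq
        by (intro exI[of _ "Times_Gate (map (\<lambda>(c, g). (c, pos g)) es)"])
          (auto simp: mpoly_eval_sum_list mpoly_eval_prod_list mpoly_eval_mult o_def case_prod_unfold cong: map_cong)
    qed
  qed
  then obtain g where g: "gate_ok m ?n g" "\<And>x. mpoly_eval x (gate_value v g) = f x" by blast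
  let ?v = "v(?n := gate_value v g)"
  have gv': "gate_value ?v h = gate_value v h" if "gate_ok m k h" "k \<le> ?n" for k h
    by (rule gv[OF _ that]) simp
  show ?case
  proof (intro exI conjI allI impI)
    show "length (C @ [g]) = length (L @ [f])" using C(1) by simp
    fix i assume i: "i < length (C @ [g])"
    have i_cases: "i < ?n \<or> i = ?n" using i by auto
    show ok: "gate_ok m i ((C @ [g]) ! i)"
      using i_cases C(2) g(1) by (auto simp: nth_append)
    show eq: "?v i = gate_value ?v ((C @ [g]) ! i)"
      using i_cases gv'[OF ok] C(3) by (auto simp: nth_append)
    fix x
    show "mpoly_eval x (?v i) = ((L @ [f]) ! i) x"
      using i_cases C(1,4) g(2) by (auto simp: nth_append)
  qed
qed

text \<open>The circuit computes some polynomial that has the same values as \<open>f\<close>;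
  \<open>inj\<close> identifies the two.\<close>

lemma derivable_circuit_class:
  fixes f :: "'a::field_char_0 mpoly"
  assumes "derivable m {} {\<lambda>x. mpoly_eval x f} N" "real N \<le> s"
    and inj: "\<And>q::'a mpoly. (\<And>x. mpoly_eval x q = mpoly_eval x f) \<Longrightarrow> q = f"
    and f: "variate m f" "total_degree f \<le> D"
  shows "f \<in> circuit_class m D s"
proof -
  obtain L where L: "length L \<le> N" "slp m {} L" "(\<lambda>x. mpoly_eval x f) \<in> set L"
    using assms(1) unfolding derivable_def by auto
  obtain C :: "'a circuit" and v where C: "length C = length L"
    "\<And>i. i < length C \<Longrightarrow> gate_ok m i (C ! i)" "\<And>i. i < length C \<Longrightarrow> v i = gate_value v (C ! i)"
    "\<And>i x. i < length C \<Longrightarrow> mpoly_eval x (v i) = (L ! i) x"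
    using slp_circuit[OF L(2)] by blast
  obtain out where out: "out < length L" "L ! out = (\<lambda>x. mpoly_eval x f)"
    using L(3) by (auto simp: in_set_conv_nth)
  have "v out = f" by (rule inj) (use C(1) C(4)[of out] out in simp)
  have mono: "gate_ok m (length C) g" if "gate_ok m i g" "i \<le> length C" for g :: "'a gate" and i
    using that by (cases g) auto
  have "circuit_edges C \<subseteq> {(j, i). j < i}"
    unfolding circuit_edges_def using C(2) by (fastforce elim!: gate_ok.elims)
  moreover have "acyclic {(j, i::nat). j < i}"
    using wf_acyclic[OF wf_less] by simp
  ultimately have "acyclic (circuit_edges C)" using acyclic_subset by blast
  then have "is_circuit m C"
    using C(2) mono by (force simp: is_circuit_def in_set_conv_nth)
  moreover have "computes C f" unfolding computes_def
    using C out \<open>v out = f\<close> by (intro exI[of _ v] exI[of _ out]) auto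
  moreover have "real (length C) \<le> s" using L(1) C(1) assms(2) by simp
  ultimately show ?thesis using f unfolding circuit_class_def by blast
qed

section \<open>Nonzero polynomials over infinite fields\<close>

lemma digit_sum_less:
  fixes e :: "nat \<Rightarrow> nat"
  assumes "\<And>i. i < n \<Longrightarrow> e i < B"
  shows "(\<Sum>i<n. e i * B ^ i) < B ^ n"
  using assms
proof (induction n)
  case (Suc n)
  have "(\<Sum>i<n. e i * B ^ i) < B ^ n" using Suc by simp
  moreover have "e n * B ^ n \<le> (B - 1) * B ^ n" using Suc.prems[of n] by (intro mult_right_mono) auto
  moreover have "(B - 1) * B ^ n + B ^ n = B ^ Suc n" using Suc.prems[of n] by (cases B) auto
  ultimately show ?case unfolding sum.lessThan_Suc by linarith
qed simp

lemma digit_sum_inj: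
  fixes e e' :: "nat \<Rightarrow> nat"
  assumes "\<And>i. i < n \<Longrightarrow> e i < B" "\<And>i. i < n \<Longrightarrow> e' i < B"
    and "(\<Sum>i<n. e i * B ^ i) = (\<Sum>i<n. e' i * B ^ i)" "i < n"
  shows "e i = e' i"
  using assms
proof (induction n arbitrary: i)
  case (Suc n)
  have less: "(\<Sum>i<n. e i * B ^ i) < B ^ n" "(\<Sum>i<n. e' i * B ^ i) < B ^ n"
    using Suc.prems by (auto intro!: digit_sum_less)
  have "((\<Sum>i<n. e i * B ^ i) + e n * B ^ n) div B ^ n = ((\<Sum>i<n. e' i * B ^ i) + e' n * B ^ n) div B ^ n"
    using Suc.prems(3) by simp
  moreover have "B ^ n \<noteq> 0" using less by linarith
  ultimately have "e n = e' n" using less by (simp add: div_mult_self1 del: power_eq_0_iff)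
  show ?case
  proof (cases "i = n")
    case False
    have "(\<Sum>i<n. e i * B ^ i) = (\<Sum>i<n. e' i * B ^ i)"
      using Suc.prems(3) \<open>e n = e' n\<close> by simp
    moreover have "i < n" using False Suc.prems(4) by simp
    ultimately show ?thesis using Suc.IH[of i] Suc.prems(1,2) by (meson less_SucI)
  qed (use \<open>e n = e' n\<close> in simp)
qed simp

text \<open>Kronecker substitution of \<open>t ^ B ^ i\<close> for the \<open>i\<close>-th variable,
  with \<open>B\<close> above all exponents: uniqueness of base-\<open>B\<close> digits keeps
  distinct monomials apart, and a univariate polynomial that vanishes everywhere is zero.\<close>

lemma mpoly_eval_nonzero:
  fixes p :: "'a::field_char_0 mpoly"
  assumes "p \<noteq> 0"
  shows "\<exists>x. mpoly_eval x p \<noteq> 0"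
proof (rule ccontr)
  assume zero: "\<not> ?thesis"
  let ?V = "\<Union>mon\<in>keys p. keys mon"
  let ?E = "insert 0 (\<Union>mon\<in>keys p. lookup mon ` keys mon)"
  define n where "n = Suc (Max (insert 0 ?V))"
  define B where "B = Suc (Max ?E)"
  have n: "i < n" if "mon \<in> keys p" "i \<in> keys mon" for mon i
    unfolding n_def using that by (auto intro!: Max_ge simp: less_Suc_eq_le)
  have B: "lookup mon i < B" if "mon \<in> keys p" for mon i
  proof -
    have "lookup mon i \<in> ?E"
    proof (cases "i \<in> keys mon")
      case True
      then show ?thesis using that by blast
    next
      case False
      then have "lookup mon i = 0" by (simp add: in_keys_iff)
      then show ?thesis by simp
    qed
    then show ?thesis unfolding B_def by (auto intro!: Max_ge simp: less_Suc_eq_le)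
  qed
  define w where "w mon = (\<Sum>i<n. lookup mon i * B ^ i)" for mon
  define q where "q = (\<Sum>mon\<in>keys p. monom (lookup p mon) (w mon))"
  have "poly q t = 0" for t
  proof -
    have "mon_eval (\<lambda>i. t ^ B ^ i) mon = t ^ w mon" if "mon \<in> keys p" for mon
    proof -
      have "mon_eval (\<lambda>i. t ^ B ^ i) mon = (\<Prod>i<n. (t ^ B ^ i) ^ lookup mon i)"
        by (rule mon_eval_superset) (use n that in auto)
      also have "\<dots> = t ^ w mon"
        by (simp add: w_def power_sum power_mult [symmetric] mult.commute)
      finally show ?thesis .
    qed
    then have "poly q t = mpoly_eval (\<lambda>i. t ^ B ^ i) p"
      by (simp add: q_def poly_sum poly_monom mpoly_eval_eq_aeval aeval_def)
    then show ?thesis using zero by simp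
  qed
  then have "q = 0" using poly_all_0_iff_0 by blast
  obtain m where m: "m \<in> keys p" using assms by (metis keys_eq_empty ex_in_conv)
  have "w mon = w m \<longleftrightarrow> mon = m" if "mon \<in> keys p" for mon
  proof
    assume eq: "w mon = w m"
    show "mon = m"
    proof (rule poly_mapping_eqI)
      fix i
      show "lookup mon i = lookup m i"
      proof (cases "i < n")
        case True
        with digit_sum_inj[of n "lookup mon" B "lookup m"] eq B that m show ?thesis
          by (simp add: w_def)
      next
        case False
        then show ?thesis using n that m by (metis in_keys_iff)
      qed
    qed
  qed simp
  then have "coeff q (w m) = (\<Sum>mon\<in>keys p. if mon = m then lookup p m else 0)"
    unfolding q_def coeff_sum by (intro sum.cong) (auto simp: coeff_monom)
  also have "\<dots> = lookup p m" using m by simp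
  finally show False using \<open>q = 0\<close> m by (simp add: in_keys_iff)
qed

lemma mpoly_eqI:
  fixes p q :: "'a::field_char_0 mpoly"
  assumes "\<And>x. mpoly_eval x p = mpoly_eval x q"
  shows "p = q"
  using mpoly_eval_nonzero[of "p - q"] assms by (auto simp: mpoly_eval_minus)

section \<open>Degree bookkeeping\<close>

lemma mon_degree_le_total_degree:
  "mon \<in> keys p \<Longrightarrow> mon_degree mon \<le> total_degree p"
  unfolding total_degree_def by (intro Max_ge) auto

text \<open>Graded version of \<open>aeval_closed\<close>: each variable has weight \<open>e\<close>
  and weights add under products, so total degree \<open>D\<close> gives weight
  \<open>D * e\<close>.\<close>

lemma aeval_graded:
  fixes Pr :: "nat \<Rightarrow> ('u \<Rightarrow> 'b::comm_semiring_1) \<Rightarrow> bool"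
  assumes deg: "\<And>mon. mon \<in> keys p \<Longrightarrow> mon_degree mon \<le> D"
    and const: "\<And>n c. Pr n (\<lambda>u. h c)"
    and var: "\<And>mon i. mon \<in> keys p \<Longrightarrow> i \<in> keys mon \<Longrightarrow> Pr e (\<lambda>u. x u i)"
    and zero: "\<And>n. Pr n (\<lambda>u. 0)" and one: "\<And>n. Pr n (\<lambda>u. 1)"
    and mono: "\<And>n n' f. Pr n f \<Longrightarrow> n \<le> n' \<Longrightarrow> Pr n' f"
    and add: "\<And>n f g. Pr n f \<Longrightarrow> Pr n g \<Longrightarrow> Pr n (\<lambda>u. f u + g u)"
    and mult: "\<And>n n' f g. Pr n f \<Longrightarrow> Pr n' g \<Longrightarrow> Pr (n + n') (\<lambda>u. f u * g u)"
  shows "Pr (D * e) (\<lambda>u. aeval h (x u) p)"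
proof -
  have sum: "Pr n (\<lambda>u. \<Sum>i\<in>I. f i u)" if "finite I" "\<And>i. i \<in> I \<Longrightarrow> Pr n (f i)"
    for f :: "(nat \<Rightarrow>\<^sub>0 nat) \<Rightarrow> 'u \<Rightarrow> 'b" and I n
    using that by (induction I) (auto intro: zero add)
  have pow: "Pr (k * n) (\<lambda>u. f u ^ k)" if "Pr n f" for f and n k :: nat
    using that by (induction k) (auto intro: one mult)
  have prod: "Pr (sum n I) (\<lambda>u. \<Prod>i\<in>I. f i u)" if "finite I" "\<And>i. i \<in> I \<Longrightarrow> Pr (n i) (f i)"
    for f :: "nat \<Rightarrow> 'u \<Rightarrow> 'b" and I and n :: "nat \<Rightarrow> nat"
    using that by (induction I) (auto intro: one mult)
  have mon: "Pr (D * e) (\<lambda>u. h (lookup p mon) * mon_eval (x u) mon)" if "mon \<in> keys p" for mon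
  proof -
    have "Pr (\<Sum>i\<in>keys mon. lookup mon i * e) (\<lambda>u. \<Prod>i\<in>keys mon. x u i ^ lookup mon i)"
      by (intro prod pow var[OF that]) auto
    then have "Pr (0 + (\<Sum>i\<in>keys mon. lookup mon i * e))
        (\<lambda>u. h (lookup p mon) * (\<Prod>i\<in>keys mon. x u i ^ lookup mon i))"
      by (intro mult const)
    moreover have "(\<Sum>i\<in>keys mon. lookup mon i * e) \<le> D * e"
      using deg[OF that] by (simp add: mon_degree_def flip: sum_distrib_right)
    ultimately show ?thesis unfolding mon_eval_def by (auto intro: mono)
  qed
  show ?thesis unfolding aeval_def by (intro sum mon) auto
qed

lemma polydeg_coeff_mult:
  fixes F G :: "'a::comm_semiring_1 \<Rightarrow> 'a poly"
  assumes "\<And>r. polydeg n (\<lambda>u. coeff (F u) r)" "\<And>r. polydeg n' (\<lambda>u. coeff (G u) r)"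
  shows "polydeg (n + n') (\<lambda>u. coeff (F u * G u) r)"
  unfolding coeff_mult by (intro polydeg_sum polydeg_mult assms)

lemma polydeg_coeff_affine_power:
  "polydeg k (\<lambda>u::'a::comm_semiring_1. coeff ([:y, u:] ^ k) r)"
proof (cases "r \<le> k")
  case True
  have "polydeg k (\<lambda>u::'a. of_nat (k choose r) * y ^ (k - r) * u ^ r)"
    unfolding polydeg_def
    by (rule exI[of _ "monom (of_nat (k choose r) * y ^ (k - r)) r"])
      (use True in \<open>auto simp: poly_monom intro: order.trans[OF degree_monom_le]\<close>)
  then show ?thesis using True by (simp add: coeff_linear_poly_power mult_ac)
next
  case False
  have "degree ([:y, u:] ^ k) \<le> k" for u :: 'a
    by (rule order.trans[OF degree_power_le]) auto
  then have "coeff ([:y, u:] ^ k) r = 0" for u :: 'a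
    using False by (meson coeff_eq_0 le_less_trans not_le)
  then show ?thesis by simp
qed

lemma pcompose_power: "pcompose (p ^ n) q = pcompose p q ^ n"
  by (induction n) (simp_all add: pcompose_mult pcompose_1)

lemma polydeg_coeff_pcompose:
  fixes l :: "'a::comm_ring_1 poly"
  assumes "degree l \<le> n"
  shows "polydeg n (\<lambda>u. coeff (pcompose l [:y, u:]) r)"
proof -
  have "coeff (pcompose l [:y, u:]) r = (\<Sum>k\<le>n. coeff l k * coeff ([:y, u:] ^ k) r)" for u
  proof -
    have "pcompose l q = (\<Sum>k\<le>n. smult (coeff l k) (q ^ k))" for q
      by (subst poly_as_sum_of_monoms'[OF assms, symmetric])
        (simp add: pcompose_sum monom_altdef pcompose_smult pcompose_power pcompose_pCons)
    then show ?thesis by (simp add: coeff_sum)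
  qed
  then show ?thesis
    by (auto intro!: polydeg_sum polydeg_cmult intro: polydeg_mono[OF polydeg_coeff_affine_power])
qed

section \<open>The generator\<close>

abbreviation const_poly :: "'a::zero \<Rightarrow> 'a poly" where "const_poly c \<equiv> [:c:]"
abbreviation const_poly2 :: "'a::zero \<Rightarrow> 'a poly poly" where "const_poly2 c \<equiv> [:[:c:]:]"

text \<open>Up to the factor i!, this is the i-th derivative of \<open>Q\<close> at \<open>x\<close>
  in direction \<open>y\<close>.\<close>

definition Delta :: "'a::comm_ring_1 mpoly \<Rightarrow> nat \<Rightarrow> (nat \<Rightarrow> 'a) \<Rightarrow> (nat \<Rightarrow> 'a) \<Rightarrow> 'a" where
  "Delta Q i x y = coeff (aeval const_poly (\<lambda>v. [:x v, y v:]) Q) i"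

text \<open>The outer variable \<open>\<lambda>\<close> scales the displacement \<open>z + t y\<close> from the centre \<open>a\<close>;
  \<open>hcoeff Q a q i z y\<close> is the coefficient of \<open>\<lambda>\<^sup>q t\<^sup>i\<close> in \<open>Q (a + \<lambda> (z + t y))\<close>.\<close>

definition Phi :: "'a::comm_ring_1 mpoly \<Rightarrow> (nat \<Rightarrow> 'a) \<Rightarrow> (nat \<Rightarrow> 'a) \<Rightarrow> (nat \<Rightarrow> 'a) \<Rightarrow> 'a poly poly" where
  "Phi Q a z y = aeval const_poly2 (\<lambda>v. [:[:a v:], [:z v, y v:]:]) Q"

definition hcoeff :: "'a::comm_ring_1 mpoly \<Rightarrow> (nat \<Rightarrow> 'a) \<Rightarrow> nat \<Rightarrow> nat \<Rightarrow> (nat \<Rightarrow> 'a) \<Rightarrow> (nat \<Rightarrow> 'a) \<Rightarrow> 'a" where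
  "hcoeff Q a q i z y = coeff (coeff (Phi Q a z y) q) i"

lemma hcoeff_cong:
  assumes "variate K Q" "\<And>v. v < K \<Longrightarrow> z v = z' v" "\<And>v. v < K \<Longrightarrow> y v = y' v"
  shows "hcoeff Q a q i z y = hcoeff Q a q i z' y'"
proof -
  have "Phi Q a z y = Phi Q a z' y'"
    unfolding Phi_def using assms by (intro variate_aeval_cong[OF assms(1)]) auto
  then show ?thesis by (simp add: hcoeff_def)
qed

lemma Delta_cong:
  assumes "variate K Q" "\<And>v. v < K \<Longrightarrow> x v = x' v" "\<And>v. v < K \<Longrightarrow> y v = y' v"
  shows "Delta Q i x y = Delta Q i x' y'"
  unfolding Delta_def using assms
  by (intro arg_cong2[of _ _ _ _ coeff] variate_aeval_cong[OF assms(1)]) auto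

text \<open>Each factor t comes with a factor \<lambda>.\<close>

lemma hcoeff_eq_0_inner: "i > q \<Longrightarrow> hcoeff Q a q i z y = 0"
proof -
  let ?P = "\<lambda>F :: unit \<Rightarrow> 'a poly poly. \<forall>q i. i > q \<longrightarrow> coeff (coeff (F ()) q) i = 0"
  have "?P (\<lambda>u. aeval const_poly2 (\<lambda>v. [:[:a v:], [:z v, y v:]:]) Q)"
  proof (rule aeval_closed)
    fix f g :: "unit \<Rightarrow> 'a poly poly"
    assume fg: "?P f" "?P g"
    show "?P (\<lambda>u. f u * g u)"
    proof (intro allI impI)
      fix q i :: nat assume "q < i"
      have "coeff (coeff (f ()) k) l * coeff (coeff (g ()) (q - k)) (i - l) = 0"
        if "k \<le> q" "l \<le> i" for k l
      proof (cases "k < l")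
        case False
        then have "q - k < i - l" using that \<open>q < i\<close> by linarith
        then show ?thesis using fg by simp
      qed (use fg in simp)
      then show "coeff (coeff (f () * g ()) q) i = 0"
        by (simp add: coeff_mult coeff_sum)
    qed
  qed (auto simp: coeff_pCons split: nat.splits)
  then show "i > q \<Longrightarrow> hcoeff Q a q i z y = 0" by (simp add: hcoeff_def Phi_def)
qed

text \<open>In Q(a + \<lambda> (z + t y)) a term with \<lambda>^q t^i takes exactly
  \<open>q - i\<close> factors from \<open>z\<close>.\<close>

lemma hcoeff_scale:
  assumes "i \<le> q"
  shows "hcoeff Q a q i (\<lambda>v. c * z v) y = c ^ (q - i) * hcoeff Q a q i z y"
proof -
  \<comment> \<open>The vanishing for \<open>i > q\<close> is carried along: the truncated
    subtraction \<open>q - i\<close> would otherwise break the case of products.\<close>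
  let ?P = "\<lambda>F :: bool \<Rightarrow> 'a poly poly. (\<forall>b q i. i > q \<longrightarrow> coeff (coeff (F b) q) i = 0) \<and>
    (\<forall>q i. i \<le> q \<longrightarrow> coeff (coeff (F True) q) i = c ^ (q - i) * coeff (coeff (F False) q) i)"
  have "?P (\<lambda>b. aeval const_poly2 (\<lambda>v. [:[:a v:], [:if b then c * z v else z v, y v:]:]) Q)"
  proof (rule aeval_closed)
    fix f g :: "bool \<Rightarrow> 'a poly poly"
    assume fg: "?P f" "?P g"
    have 1: "coeff (coeff (f b * g b) q) i = 0" if "q < i" for b q i
    proof -
      have "coeff (coeff (f b) k) l * coeff (coeff (g b) (q - k)) (i - l) = 0"
        if "k \<le> q" "l \<le> i" for k l
      proof (cases "k < l")
        case False
        then have "q - k < i - l" using that \<open>q < i\<close> by linarith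
        then show ?thesis using fg by simp
      qed (use fg in simp)
      then show ?thesis by (simp add: coeff_mult coeff_sum)
    qed
    have 2: "coeff (coeff (f True * g True) q) i = c ^ (q - i) * coeff (coeff (f False * g False) q) i"
      if "i \<le> q" for q i
    proof -
      have "coeff (coeff (f True) k) l * coeff (coeff (g True) (q - k)) (i - l) =
          c ^ (q - i) * (coeff (coeff (f False) k) l * coeff (coeff (g False) (q - k)) (i - l))"
        if kl: "k \<le> q" "l \<le> i" for k l
      proof (cases "l \<le> k \<and> i - l \<le> q - k")
        case True
        have exps: "q - i = (k - l) + (q - k - (i - l))" using kl True by linarith
        then have "c ^ (q - i) = c ^ (k - l) * c ^ (q - k - (i - l))"
          using kl by (metis power_add exps)
        moreover have "coeff (coeff (f True) k) l = c ^ (k - l) * coeff (coeff (f False) k) l"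
          "coeff (coeff (g True) (q - k)) (i - l) = c ^ (q - k - (i - l)) * coeff (coeff (g False) (q - k)) (i - l)"
          using fg True by blast+
        ultimately show ?thesis by (simp add: mult_ac)
      next
        case False
        then consider "k < l" | "q - k < i - l" by linarith
        then show ?thesis using fg by cases simp_all
      qed
      then show ?thesis by (simp add: coeff_mult coeff_sum sum_distrib_left)
    qed
    show "?P (\<lambda>b. f b * g b)" using 1 2 by blast
  next
    fix f g :: "bool \<Rightarrow> 'a poly poly"
    assume "?P f" "?P g"
    then show "?P (\<lambda>b. f b + g b)" by (simp add: distrib_left)
  qed (auto simp: coeff_pCons split: nat.splits)
  then show ?thesis using assms by (simp add: hcoeff_def Phi_def)
qed

lemma coeff_affine2:
  "coeff [:[:a:], [:z, y:]:] q = (if q = 0 then [:a:] else if q = 1 then [:z, y:] else 0)"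
  "coeff [:z, y:] r = (if r = 0 then z else if r = 1 then y else 0)"
  "coeff [:a:] r = (if r = 0 then a else 0)"
  by (auto simp: coeff_pCons split: nat.splits)

lemma sep_hcoeff_y: "sep K i (\<lambda>y. hcoeff Q a q i z y)"
  unfolding sep_def
proof (intro allI impI)
  fix v y
  let ?P = "\<lambda>F :: 'a \<Rightarrow> 'a poly poly. \<forall>q i. polydeg i (\<lambda>u. coeff (coeff (F u) q) i)"
  have "?P (\<lambda>u. aeval const_poly2 (\<lambda>w. [:[:a w:], [:z w, (y(v := u)) w:]:]) Q)"
  proof (rule aeval_closed)
    fix f g :: "'a \<Rightarrow> 'a poly poly"
    assume fg: "?P f" "?P g"
    show "?P (\<lambda>u. f u * g u)"
    proof (intro allI)
      fix q i :: nat
      have "polydeg i (\<lambda>u. coeff (coeff (f u) k) l * coeff (coeff (g u) (q - k)) (i - l))"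
        if "l \<le> i" for k l
      proof -
        have "polydeg (l + (i - l)) (\<lambda>u. coeff (coeff (f u) k) l * coeff (coeff (g u) (q - k)) (i - l))"
          by (rule polydeg_mult) (use fg in blast)+
        then show ?thesis using that by simp
      qed
      then show "polydeg i (\<lambda>u. coeff (coeff (f u * g u) q) i)"
        unfolding coeff_mult coeff_sum by (intro polydeg_sum) auto
    qed
  next
    fix i
    show "?P (\<lambda>u. [:[:a i:], [:z i, (y(v := u)) i:]:])"
    proof (intro allI)
      fix q r :: nat
      show "polydeg r (\<lambda>u. coeff (coeff [:[:a i:], [:z i, (y(v := u)) i:]:] q) r)"
        by (cases "i = v"; cases "q = 0"; cases "q = 1"; cases "r = 0"; cases "r = 1")
          (simp_all add: coeff_affine2 polydeg_id)
    qed
  qed (auto simp: coeff_pCons polydeg_add split: nat.splits)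
  then show "polydeg i (\<lambda>u. hcoeff Q a q i z (y(v := u)))"
    by (simp add: hcoeff_def Phi_def)
qed

text \<open>Homogeneity would even give \<open>q - i\<close>. The bound \<open>q\<close> is what
  allows the parts of degree at most \<open>m\<close> to be interpolated with \<open>m + 1\<close>
  nodes per coordinate.\<close>

lemma sep_hcoeff_z: "sep K q (\<lambda>z. hcoeff Q a q i z y)"
  unfolding sep_def
proof (intro allI impI)
  fix v z
  let ?P = "\<lambda>F :: 'a \<Rightarrow> 'a poly poly. \<forall>q i. polydeg q (\<lambda>u. coeff (coeff (F u) q) i)"
  have "?P (\<lambda>u. aeval const_poly2 (\<lambda>w. [:[:a w:], [:(z(v := u)) w, y w:]:]) Q)"
  proof (rule aeval_closed)
    fix f g :: "'a \<Rightarrow> 'a poly poly"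
    assume fg: "?P f" "?P g"
    show "?P (\<lambda>u. f u * g u)"
    proof (intro allI)
      fix q i :: nat
      have "polydeg q (\<lambda>u. coeff (coeff (f u) k) l * coeff (coeff (g u) (q - k)) (i - l))"
        if "k \<le> q" for k l
      proof -
        have "polydeg (k + (q - k)) (\<lambda>u. coeff (coeff (f u) k) l * coeff (coeff (g u) (q - k)) (i - l))"
          by (rule polydeg_mult) (use fg in blast)+
        then show ?thesis using that by simp
      qed
      then show "polydeg q (\<lambda>u. coeff (coeff (f u * g u) q) i)"
        unfolding coeff_mult coeff_sum by (intro polydeg_sum) auto
    qed
  next
    fix i
    show "?P (\<lambda>u. [:[:a i:], [:(z(v := u)) i, y i:]:])"
    proof (intro allI)
      fix q r :: nat
      show "polydeg q (\<lambda>u. coeff (coeff [:[:a i:], [:(z(v := u)) i, y i:]:] q) r)"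
        by (cases "i = v"; cases "q = 0"; cases "q = 1"; cases "r = 0"; cases "r = 1")
          (simp_all add: coeff_affine2 polydeg_id)
    qed
  qed (auto simp: coeff_pCons polydeg_add split: nat.splits)
  then show "polydeg q (\<lambda>u. hcoeff Q a q i (z(v := u)) y)"
    by (simp add: hcoeff_def Phi_def)
qed

section \<open>Specialising the auxiliary variables\<close>

lemma poly_aeval: "poly (aeval const_poly x p) t = mpoly_eval (\<lambda>i. poly (x i) t) p"
  by (simp add: mpoly_eval_eq_aeval aeval_hom[of "\<lambda>q. poly q t"])

lemma poly_aeval2: "poly (aeval const_poly2 x p) t = aeval const_poly (\<lambda>i. poly (x i) t) p"
  by (simp add: aeval_hom[of "\<lambda>q. poly q t"])

lemma map_poly_aeval2:
  fixes p :: "'a::comm_ring_1 mpoly"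
  shows "map_poly (\<lambda>q. poly q t) (aeval const_poly2 x p) =
    aeval const_poly (\<lambda>i. map_poly (\<lambda>q. poly q t) (x i)) p"
proof -
  have "map_poly (\<lambda>q. poly q t) (F * G) = map_poly (\<lambda>q. poly q t) F * map_poly (\<lambda>q. poly q t) G"
    for F G :: "'a poly poly"
    by (intro poly_eqI) (simp add: coeff_map_poly coeff_mult poly_sum)
  moreover have "map_poly (\<lambda>q. poly q t) (F + G) = map_poly (\<lambda>q. poly q t) F + map_poly (\<lambda>q. poly q t) G"
    for F G :: "'a poly poly"
    by (intro poly_eqI) (simp add: coeff_map_poly)
  moreover have "map_poly (\<lambda>q. poly q t) (const_poly2 c) = const_poly c" for c :: 'a
    by (intro poly_eqI) (simp add: coeff_map_poly coeff_pCons split: nat.splits)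
  ultimately show ?thesis
    by (subst aeval_hom[of "map_poly (\<lambda>q. poly q t)"]) (auto simp: map_poly_1')
qed

lemma degree_aeval_le:
  fixes x :: "nat \<Rightarrow> 'b::comm_ring_1 poly"
  assumes "total_degree p \<le> D"
    and "\<And>c. degree (h c) = 0" "\<And>i. degree (x i) \<le> e"
  shows "degree (aeval h x p) \<le> D * e"
proof (rule aeval_graded[of p D "\<lambda>n (F :: unit \<Rightarrow> 'b poly). degree (F ()) \<le> n" h e "\<lambda>_. x"])
  show "mon_degree mon \<le> D" if "mon \<in> keys p" for mon
    using mon_degree_le_total_degree[OF that] assms(1) by simp
qed (use assms in \<open>auto intro: degree_add_le order.trans[OF degree_mult_le] add_mono\<close>)

lemma degree_Phi_le:
  assumes "total_degree Q \<le> dd"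
  shows "degree (Phi Q a z y) \<le> dd"
  using degree_aeval_le[OF assms, of const_poly2 "\<lambda>v. [:[:a v:], [:z v, y v:]:]" 1]
  by (simp add: Phi_def)

lemma Delta_0: "Delta Q 0 x y = mpoly_eval x Q"
  using poly_aeval[of "\<lambda>v. [:x v, y v:]" Q 0] by (simp add: Delta_def flip: poly_0_coeff_0)

lemma Delta_shift1:
  assumes "total_degree Q \<le> dd"
  shows "Delta Q i (\<lambda>v. a v + z v) y = (\<Sum>q\<le>dd. hcoeff Q a q i z y)"
proof -
  have "aeval const_poly (\<lambda>v. [:a v + z v, y v:]) Q = poly (Phi Q a z y) 1"
    by (simp add: Phi_def poly_aeval2)
  also have "\<dots> = poly (\<Sum>q\<le>dd. monom (coeff (Phi Q a z y) q) q) 1"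
    using degree_Phi_le[OF assms] by (simp add: poly_as_sum_of_monoms')
  also have "\<dots> = (\<Sum>q\<le>dd. coeff (Phi Q a z y) q)"
    by (simp add: poly_sum poly_monom)
  finally show ?thesis by (simp add: Delta_def hcoeff_def coeff_sum)
qed

text \<open>As a polynomial in \<alpha>, the generator on the ray from the centre has the quantities
  \<open>hcoeff\<close> as coefficients, and the part of degree \<open>q\<close> enters coordinate
  \<open>i\<close> at exponent \<open>q - i\<close>. The recurrence exploits that this exponent
  varies with the coordinate.\<close>

lemma Delta_shift:
  assumes "total_degree Q \<le> dd"
  shows "Delta Q i (\<lambda>v. a v + \<alpha> * z v) y = (\<Sum>q\<in>{i..dd}. \<alpha> ^ (q - i) * hcoeff Q a q i z y)"
proof -
  have "Delta Q i (\<lambda>v. a v + \<alpha> * z v) y = (\<Sum>q\<le>dd. hcoeff Q a q i (\<lambda>v. \<alpha> * z v) y)"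
    by (rule Delta_shift1[OF assms])
  also have "\<dots> = (\<Sum>q\<in>{i..dd}. hcoeff Q a q i (\<lambda>v. \<alpha> * z v) y)"
    by (intro sum.mono_neutral_right) (auto simp: hcoeff_eq_0_inner not_le)
  finally show ?thesis by (simp add: hcoeff_scale)
qed

text \<open>Here t is specialised before the coefficient of \<lambda> is extracted, so that
  identities between polynomials in t can be checked pointwise.\<close>

lemma poly_Phi_coeff:
  "poly (coeff (Phi Q a z y) q) t = coeff (aeval const_poly (\<lambda>v. [:a v, z v + t * y v:]) Q) q"
proof -
  have "poly (coeff (Phi Q a z y) q) t = coeff (map_poly (\<lambda>p. poly p t) (Phi Q a z y)) q"
    by (simp add: coeff_map_poly)
  also have "map_poly (\<lambda>p. poly p t) [:[:a v:], [:z v, y v:]:] = [:a v, z v + t * y v:]" for v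
    by (intro poly_eqI) (simp add: coeff_map_poly coeff_pCons split: nat.splits)
  then have "map_poly (\<lambda>p. poly p t) (Phi Q a z y) = aeval const_poly (\<lambda>v. [:a v, z v + t * y v:]) Q"
    by (simp add: Phi_def map_poly_aeval2)
  finally show ?thesis .
qed

section \<open>Euler's relation and grids of directions\<close>

lemma coeff_linear_power_monom:
  fixes \<sigma> c :: "'a::comm_ring_1"
  shows "coeff ([:1, \<sigma>:] ^ n * monom c i) m = (if i \<le> m then of_nat (n choose (m - i)) * \<sigma> ^ (m - i) * c else 0)"
proof (cases "i \<le> m \<and> n < m - i")
  case True
  have "degree ([:1, \<sigma>:] ^ n) \<le> n" by (rule order.trans[OF degree_power_le]) auto
  then have "coeff ([:1, \<sigma>:] ^ n) (m - i) = 0" using True by (intro coeff_eq_0) auto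
  then show ?thesis using True by (simp add: mult.commute[of _ "monom c i"] coeff_monom_mult binomial_eq_0)
next
  case False
  then show ?thesis
    by (auto simp: mult.commute[of _ "monom c i"] coeff_monom_mult coeff_linear_poly_power)
qed

text \<open>Euler's relation as a generating function: z + t (y + \<sigma> z) = (1 + t \<sigma>) z +
  t y, and homogeneity pulls out \<open>(1 + t * \<sigma>) ^ (q - i)\<close>.\<close>

lemma hcoeff_shift_y:
  fixes Q :: "'a::field_char_0 mpoly"
  assumes "m \<le> q"
  shows "hcoeff Q a q m z (\<lambda>v. y v + \<sigma> * z v) =
    (\<Sum>i\<le>m. of_nat (q - i choose (m - i)) * \<sigma> ^ (m - i) * hcoeff Q a q i z y)"
proof -
  let ?R = "\<Sum>i\<le>q. [:1, \<sigma>:] ^ (q - i) * monom (hcoeff Q a q i z y) i"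
  have "coeff (Phi Q a z (\<lambda>v. y v + \<sigma> * z v)) q = ?R"
  proof (rule poly_eqI_infinite)
    fix t
    have "poly (coeff (Phi Q a z (\<lambda>v. y v + \<sigma> * z v)) q) t =
        poly (coeff (Phi Q a (\<lambda>v. (1 + t * \<sigma>) * z v) y) q) t"
      by (simp add: poly_Phi_coeff algebra_simps)
    also have "coeff (Phi Q a (\<lambda>v. (1 + t * \<sigma>) * z v) y) q =
        (\<Sum>i\<le>q. monom (hcoeff Q a q i (\<lambda>v. (1 + t * \<sigma>) * z v) y) i)"
      unfolding hcoeff_def
      by (rule poly_as_sum_of_monoms'[symmetric], rule degree_le)
        (auto simp: hcoeff_eq_0_inner simp flip: hcoeff_def)
    also have "poly \<dots> t = poly ?R t"
      unfolding poly_sum by (intro sum.cong refl) (simp add: poly_monom hcoeff_scale)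
    finally show "poly (coeff (Phi Q a z (\<lambda>v. y v + \<sigma> * z v)) q) t = poly ?R t" .
  qed
  then have "hcoeff Q a q m z (\<lambda>v. y v + \<sigma> * z v) = coeff ?R m" by (simp add: hcoeff_def)
  also have "\<dots> = (\<Sum>i\<le>q. if i \<le> m then of_nat (q - i choose (m - i)) * \<sigma> ^ (m - i) * hcoeff Q a q i z y else 0)"
    by (simp add: coeff_sum coeff_linear_power_monom)
  also have "\<dots> = (\<Sum>i\<le>m. of_nat (q - i choose (m - i)) * \<sigma> ^ (m - i) * hcoeff Q a q i z y)"
    using assms by (intro sum.mono_neutral_cong_right) auto
  finally show ?thesis .
qed

text \<open>Coefficients that express all derivatives of order at most \<open>m\<close> of a homogeneous polynomial
  through its directional derivatives of order exactly \<open>m\<close> along the grid directions.\<close>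

definition grid_coeff :: "nat \<Rightarrow> nat \<Rightarrow> (nat \<Rightarrow> 'a::field set) \<Rightarrow> (nat \<Rightarrow> 'a) \<Rightarrow> (nat \<Rightarrow> 'a) \<Rightarrow> nat \<Rightarrow>
    (nat \<Rightarrow> 'a) \<Rightarrow> 'a" where
  "grid_coeff K m S y b i z = coeff (\<Prod>v<K. pcompose (lagrange (S v) (b v)) [:y v, z v:]) (m - i)"

text \<open>The derivative of order \<open>m\<close> in direction y + \<sigma> z is computed twice:
  by \<open>hcoeff_shift_y\<close>, and by interpolation on the grid of directions. Comparing the
  coefficients of \<sigma>^(m - i) isolates the derivative of order \<open>i\<close>; in
  characteristic zero its binomial factor is nonzero because \<open>m \<le> q\<close>.\<close>

lemma hcoeff_from_grid:
  fixes Q :: "'a::field_char_0 mpoly"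
  assumes "variate K Q" "\<And>v. v < K \<Longrightarrow> finite (S v) \<and> card (S v) = Suc m" "i \<le> m" "m \<le> q"
  shows "of_nat (q - i choose (m - i)) * hcoeff Q a q i z y =
    (\<Sum>b\<in>PiE {..<K} S. hcoeff Q a q m z b * grid_coeff K m S y b i z)"
proof -
  let ?L = "\<Sum>i\<le>m. monom (of_nat (q - i choose (m - i)) * hcoeff Q a q i z y) (m - i)"
  let ?R = "\<Sum>b\<in>PiE {..<K} S. smult (hcoeff Q a q m z b)
      (\<Prod>v<K. pcompose (lagrange (S v) (b v)) [:y v, z v:])"
  have "?L = ?R"
  proof (rule poly_eqI_infinite)
    fix \<sigma>
    let ?y = "\<lambda>v. y v + \<sigma> * z v"
    have "poly ?L \<sigma> = hcoeff Q a q m z ?y"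
      by (simp add: poly_sum poly_monom hcoeff_shift_y[OF assms(4)] mult_ac)
    also have "\<dots> = (\<Sum>b\<in>PiE {..<K} S. hcoeff Q a q m z (\<lambda>v. if v < K then b v else ?y v) *
        (\<Prod>v<K. poly (lagrange (S v) (b v)) (?y v)))"
      by (rule grid_interpolation[OF sep_hcoeff_y assms(2)])
    also have "\<dots> = (\<Sum>b\<in>PiE {..<K} S. hcoeff Q a q m z b *
        (\<Prod>v<K. poly (lagrange (S v) (b v)) (?y v)))"
      by (intro sum.cong refl arg_cong2[of _ _ _ _ "(*)"] hcoeff_cong[OF assms(1)]) auto
    also have "\<dots> = poly ?R \<sigma>"
      by (simp add: poly_sum poly_prod poly_pcompose)
    finally show "poly ?L \<sigma> = poly ?R \<sigma>" .
  qed
  then have "coeff ?L (m - i) = coeff ?R (m - i)" by simp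
  moreover have "coeff ?L (m - i) =
      (\<Sum>i'\<le>m. if i' = i then of_nat (q - i choose (m - i)) * hcoeff Q a q i z y else 0)"
    unfolding coeff_sum using assms(3) by (intro sum.cong) (auto simp: coeff_monom)
  ultimately show ?thesis using assms(3) by (simp add: coeff_sum grid_coeff_def)
qed

text \<open>Each coordinate of \<open>z\<close> occurs in one factor only. Hence these coefficients
  are obtained from the same Lagrange basis in \<open>z\<close> as the parts of small
  degree.\<close>

lemma sep_grid_coeff:
  fixes S :: "nat \<Rightarrow> 'a::field_char_0 set"
  assumes "\<And>v. v < K \<Longrightarrow> finite (S v) \<and> card (S v) = Suc m" "\<And>v. v < K \<Longrightarrow> b v \<in> S v"
  shows "sep K m (grid_coeff K m S y b i)"
  unfolding sep_def grid_coeff_def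
proof (intro allI impI)
  fix w z assume w: "w < K"
  let ?R = "\<Prod>v\<in>{..<K} - {w}. pcompose (lagrange (S v) (b v)) [:y v, z v:]"
  have "(\<Prod>v<K. pcompose (lagrange (S v) (b v)) [:y v, (z(w := u)) v:]) =
      pcompose (lagrange (S w) (b w)) [:y w, u:] * ?R" for u
    using w by (subst prod.remove[of _ w]) (auto intro!: arg_cong2[of _ _ _ _ "(*)"] prod.cong)
  moreover have "polydeg (m + 0) (\<lambda>u. coeff (pcompose (lagrange (S w) (b w)) [:y w, u:] * ?R) (m - i))"
    using assms w by (intro polydeg_coeff_mult polydeg_coeff_pcompose degree_lagrange_le) auto
  ultimately show "polydeg m (\<lambda>u. coeff (\<Prod>v<K. pcompose (lagrange (S v) (b v)) [:y v, (z(w := u)) v:]) (m - i))"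
    by simp
qed

section \<open>Annihilators and separants\<close>

text \<open>Up to factorials, the coefficients \<open>T_coeff f m c j\<close> are the derivatives of \<open>f\<close> in its
  \<open>m\<close>-th variable, after the later variables have been set to the constants \<open>c\<close>.\<close>

definition T_shift :: "nat \<Rightarrow> (nat \<Rightarrow> 'b::comm_ring_1) \<Rightarrow> (nat \<Rightarrow> 'b) \<Rightarrow> nat \<Rightarrow> 'b poly" where
  "T_shift m c w i = (if i < m then [:w i:] else if i = m then [:w m, 1:] else [:c i:])"

definition T_coeff :: "'a::comm_ring_1 mpoly \<Rightarrow> nat \<Rightarrow> (nat \<Rightarrow> 'a) \<Rightarrow> nat \<Rightarrow> (nat \<Rightarrow> 'a) \<Rightarrow> 'a" where
  "T_coeff f m c j w = coeff (aeval const_poly (T_shift m c w) f) j"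

lemma poly_T_shift:
  "poly (aeval const_poly (T_shift m c w) f) t =
    mpoly_eval (\<lambda>i. if i < m then w i else if i = m then w m + t else c i) f"
  by (simp add: poly_aeval T_shift_def if_distrib[of "\<lambda>q. poly q t"] cong: if_cong)

text \<open>Take \<open>m + 1\<close> least such that fixing the variables from \<open>m + 1\<close>
  on can leave a nonzero polynomial that still vanishes on all \<open>D p\<close>. By minimality
  some Taylor coefficient in variable \<open>m\<close> is nonzero somewhere on the image. The zeroth
  one is the restricted polynomial itself and vanishes there, so the least nonvanishing index is a
  successor.\<close>

lemma exists_separant:
  fixes f :: "'a::field_char_0 mpoly" and D :: "'p \<Rightarrow> nat \<Rightarrow> 'a"
  assumes "variate s f" "f \<noteq> 0" "\<And>p. mpoly_eval (D p) f = 0"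
  shows "\<exists>m<s. \<exists>c j. (\<forall>p. T_coeff f m c j (D p) = 0) \<and> (\<exists>p. T_coeff f m c (Suc j) (D p) \<noteq> 0)"
proof -
  let ?e = "\<lambda>m w c. mpoly_eval (\<lambda>i. if i < m then w i else c i) f"
  define P where "P m \<longleftrightarrow> (\<exists>c. (\<forall>p. ?e m (D p) c = 0) \<and> (\<exists>w. ?e m w c \<noteq> 0))" for m
  have "P s"
  proof -
    obtain w where "mpoly_eval w f \<noteq> 0" using mpoly_eval_nonzero[OF assms(2)] by blast
    moreover have "?e s w' c = mpoly_eval w' f" for w' c
      by (rule mpoly_eval_cong[OF assms(1)]) simp
    ultimately show ?thesis unfolding P_def using assms(3) by auto
  qed
  moreover have "\<not> P 0" by (simp add: P_def)
  ultimately obtain m where m: "m < s" "\<not> P m" "P (Suc m)"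
    using ex_least_nat_less[of P s] by blast
  obtain c w where c: "\<And>p. ?e (Suc m) (D p) c = 0" "?e (Suc m) w c \<noteq> 0"
    using m(3) unfolding P_def by blast
  have ex: "\<exists>j p. T_coeff f m c j (D p) \<noteq> 0"
  proof (rule ccontr)
    assume "\<not> ?thesis"
    then have "aeval const_poly (T_shift m c (D p)) f = 0" for p
      by (intro poly_eqI) (auto simp: T_coeff_def)
    then have zero: "mpoly_eval (\<lambda>i. if i < m then D p i else if i = m then D p m + t else c i) f = 0" for p t
      using poly_T_shift[of m c "D p" f t] by simp
    \<comment> \<open>The shift \<open>w m - D p m\<close> moves variable \<open>m\<close> to the
      prescribed value \<open>w m\<close>. If all Taylor coefficients vanished, \<open>m\<close>
      would be admissible too, against minimality.\<close>
    have "?e m (D p) (c(m := w m)) = 0" for p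
    proof -
      have "(\<lambda>i. if i < m then D p i else (c(m := w m)) i) =
          (\<lambda>i. if i < m then D p i else if i = m then D p m + (w m - D p m) else c i)"
        by (auto simp: fun_eq_iff)
      then show ?thesis using zero[of p "w m - D p m"] by (simp only:)
    qed
    with m(2) have "?e m w (c(m := w m)) = 0" unfolding P_def by blast
    moreover have "(\<lambda>i. if i < m then w i else (c(m := w m)) i) = (\<lambda>i. if i < Suc m then w i else c i)"
      by (auto simp: fun_eq_iff less_Suc_eq)
    ultimately show False using c(2) by simp
  qed
  define j where "j = (LEAST j. \<exists>p. T_coeff f m c j (D p) \<noteq> 0)"
  have j: "\<exists>p. T_coeff f m c j (D p) \<noteq> 0"
    unfolding j_def using ex by (rule LeastI_ex)
  have less: "T_coeff f m c j' (D p) = 0" if "j' < j" for j' p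
    using not_less_Least[OF that[unfolded j_def]] by blast
  have "T_coeff f m c 0 (D p) = 0" for p
  proof -
    have "T_coeff f m c 0 (D p) = poly (aeval const_poly (T_shift m c (D p)) f) 0"
      by (simp add: T_coeff_def poly_0_coeff_0)
    also have "\<dots> = ?e (Suc m) (D p) c"
      unfolding poly_T_shift by (intro arg_cong2[of _ _ _ _ mpoly_eval] refl) (auto simp: fun_eq_iff less_Suc_eq)
    finally show ?thesis using c(1) by simp
  qed
  then obtain j0 where "j = Suc j0" using j by (cases j) auto
  then show ?thesis using j less m(1) by blast
qed

section \<open>Lines of directions and good grids\<close>

lemma polydeg_line_sum:
  "(\<And>i. i \<in> I \<Longrightarrow> \<exists>n. polydeg n (f i)) \<Longrightarrow> \<exists>n. polydeg n (\<lambda>u. \<Sum>i\<in>I. f i u)"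
proof (induction I rule: infinite_finite_induct)
  case (insert i I)
  then obtain n n' where "polydeg n (f i)" "polydeg n' (\<lambda>u. \<Sum>i\<in>I. f i u)" by blast
  then have "polydeg (max n n') (\<lambda>u. f i u + (\<Sum>i\<in>I. f i u))"
    by (intro polydeg_add) (auto intro: polydeg_mono)
  then show ?case using insert.hyps by auto
qed auto

lemma polydeg_line_coeff_mult:
  fixes F G :: "'a::comm_semiring_1 \<Rightarrow> 'a poly"
  assumes "\<And>r. \<exists>n. polydeg n (\<lambda>u. coeff (F u) r)" "\<And>r. \<exists>n. polydeg n (\<lambda>u. coeff (G u) r)"
  shows "\<exists>n. polydeg n (\<lambda>u. coeff (F u * G u) r)"
  unfolding coeff_mult
proof (rule polydeg_line_sum)
  fix i
  obtain n n' where "polydeg n (\<lambda>u. coeff (F u) i)" "polydeg n' (\<lambda>u. coeff (G u) (r - i))"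
    using assms by blast
  then show "\<exists>n. polydeg n (\<lambda>u. coeff (F u) i * coeff (G u) (r - i))"
    using polydeg_mult by blast
qed

lemma polydeg_line_aeval:
  fixes x :: "'a::comm_ring_1 \<Rightarrow> nat \<Rightarrow> 'a poly"
  assumes "\<And>i r. \<exists>n. polydeg n (\<lambda>u. coeff (x u i) r)"
  shows "\<exists>n. polydeg n (\<lambda>u. coeff (aeval const_poly (x u) p) r)"
proof -
  have "\<forall>r. \<exists>n. polydeg n (\<lambda>u. coeff (aeval const_poly (x u) p) r)"
  proof (rule aeval_closed)
    fix f g :: "'a \<Rightarrow> 'a poly"
    assume f: "\<forall>r. \<exists>n. polydeg n (\<lambda>u. coeff (f u) r)" and g: "\<forall>r. \<exists>n. polydeg n (\<lambda>u. coeff (g u) r)"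
    show "\<forall>r. \<exists>n. polydeg n (\<lambda>u. coeff (f u * g u) r)"
      using f g by (intro allI polydeg_line_coeff_mult) blast+
    show "\<forall>r. \<exists>n. polydeg n (\<lambda>u. coeff (f u + g u) r)"
    proof
      fix r
      obtain n n' where "polydeg n (\<lambda>u. coeff (f u) r)" "polydeg n' (\<lambda>u. coeff (g u) r)"
        using f g by blast
      then have "polydeg (max n n') (\<lambda>u. coeff (f u) r + coeff (g u) r)"
        by (intro polydeg_add) (auto intro: polydeg_mono)
      then show "\<exists>n. polydeg n (\<lambda>u. coeff (f u + g u) r)" by auto
    qed
  qed (use assms in \<open>auto intro: polydeg_const\<close>)
  then show ?thesis by blast
qed

text \<open>Some degree is enough: it is used only to conclude that the separant has finitely many
  zeros on a line on which it is not identically zero.\<close>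

lemma polydeg_line_T_coeff_Delta:
  "\<exists>n. polydeg n (\<lambda>u. T_coeff f m c j (\<lambda>i. Delta Q i a (\<lambda>v. b v + u * l v)))"
proof -
  have D: "\<exists>n. polydeg n (\<lambda>u. Delta Q i a (\<lambda>v. b v + u * l v))" for i
    unfolding Delta_def
  proof (rule polydeg_line_aeval)
    fix v r
    have "polydeg 1 (\<lambda>u. b v + l v * u)"
      by (intro polydeg_add polydeg_cmult polydeg_id polydeg_const order_refl)
    then show "\<exists>n. polydeg n (\<lambda>u. coeff [:a v, b v + u * l v:] r)"
      by (cases "r = 0"; cases "r = 1") (auto simp: coeff_affine2 mult.commute intro: polydeg_const)
  qed
  show ?thesis unfolding T_coeff_def
  proof (rule polydeg_line_aeval)
    fix i r
    show "\<exists>n. polydeg n (\<lambda>u. coeff (T_shift m c (\<lambda>i. Delta Q i a (\<lambda>v. b v + u * l v)) i) r)"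
      using D[of i]
      by (cases "i < m"; cases "i = m"; cases "r = 0"; cases "r = 1")
        (auto simp: T_shift_def coeff_affine2 intro: polydeg_const)
  qed
qed

text \<open>The grid consists of the points \<open>b0 + \<tau> * l\<close> with \<open>l\<close> in
  the lattice \<open>{0..m} ^ K\<close>. For each of the finitely many \<open>l\<close> this gives a
  polynomial in \<tau> whose value at 0 is \<open>g b0\<close>, so some \<tau> avoids all their
  roots.\<close>

lemma exists_good_grid:
  fixes g :: "(nat \<Rightarrow> 'a::field_char_0) \<Rightarrow> 'a"
  assumes line: "\<And>l. \<exists>n. polydeg n (\<lambda>u. g (\<lambda>v. b0 v + u * l v))"
    and nz: "g b0 \<noteq> 0"
    and cong: "\<And>y y'. (\<And>v. v < K \<Longrightarrow> y v = y' v) \<Longrightarrow> g y = g y'"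
  shows "\<exists>S. (\<forall>v<K. finite (S v) \<and> card (S v) = Suc m) \<and> (\<forall>b\<in>PiE {..<K} S. g b \<noteq> 0)"
proof -
  let ?L = "PiE {..<K} (\<lambda>_. nodes m :: 'a set)"
  have "finite ?L" by (intro finite_PiE) auto
  have roots: "finite {u. g (\<lambda>v. b0 v + u * l v) = 0}" for l
  proof -
    obtain p where p: "\<And>u. g (\<lambda>v. b0 v + u * l v) = poly p u"
      using line[of l] unfolding polydeg_def by blast
    have "poly p 0 \<noteq> 0" using p[of 0] nz by simp
    then have "p \<noteq> 0" by auto
    then show ?thesis using poly_roots_finite[of p] by (simp add: p)
  qed
  have "finite (insert 0 (\<Union>l\<in>?L. {u. g (\<lambda>v. b0 v + u * l v) = 0}))"
    using \<open>finite ?L\<close> roots by blast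
  \<comment> \<open>Excluding 0 keeps the \<open>m + 1\<close> nodes of each coordinate
    distinct.\<close>
  then obtain \<tau> where \<tau>: "\<tau> \<notin> insert 0 (\<Union>l\<in>?L. {u. g (\<lambda>v. b0 v + u * l v) = 0})"
    using ex_new_if_finite[OF infinite_UNIV_char_0] by blast
  define S where "S v = (\<lambda>l. b0 v + \<tau> * l) ` nodes m" for v
  have S: "finite (S v) \<and> card (S v) = Suc m" for v
    using \<tau> by (simp add: S_def card_image inj_on_def)
  have "g b \<noteq> 0" if b: "b \<in> PiE {..<K} S" for b
  proof -
    define l where "l = (\<lambda>v\<in>{..<K}. (b v - b0 v) / \<tau>)"
    have bS: "b v \<in> S v" if "v < K" for v using b that by auto
    have "l \<in> ?L"
    proof (rule PiE_I)
      fix v assume "v \<in> {..<K}"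
      then have "b v \<in> S v" using bS by simp
      then obtain t where "t \<in> nodes m" "b v = b0 v + \<tau> * t" unfolding S_def by blast
      then show "l v \<in> nodes m" using \<open>v \<in> {..<K}\<close> \<tau> by (simp add: l_def)
    qed (simp add: l_def)
    then have "g (\<lambda>v. b0 v + \<tau> * l v) \<noteq> 0" using \<tau> by blast
    moreover have "g (\<lambda>v. b0 v + \<tau> * l v) = g b"
      using \<tau> by (intro cong) (simp add: l_def)
    ultimately show ?thesis by simp
  qed
  then show ?thesis using S by blast
qed

section \<open>First-order expansion of an annihilator\<close>

lemma T_shift_cong: "(\<And>i. i \<le> m \<Longrightarrow> w i = w' i) \<Longrightarrow> T_shift m c w = T_shift m c w'"
  by (auto simp: T_shift_def fun_eq_iff)

lemma map_poly_T_shift: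
  "map_poly (\<lambda>q. poly q t) (T_shift m (\<lambda>i. [:c i:]) U i) = T_shift m c (\<lambda>i. poly (U i) t) i"
  by (intro poly_eqI) (simp add: T_shift_def coeff_map_poly coeff_pCons split: nat.splits)

lemma poly_coeff_aeval_T_shift:
  "poly (coeff (aeval const_poly2 (T_shift m (\<lambda>i. [:c i:]) U) f) j) t = T_coeff f m c j (\<lambda>i. poly (U i) t)"
proof -
  have "poly (coeff (aeval const_poly2 (T_shift m (\<lambda>i. [:c i:]) U) f) j) t =
      coeff (map_poly (\<lambda>q. poly q t) (aeval const_poly2 (T_shift m (\<lambda>i. [:c i:]) U) f)) j"
    by (simp add: coeff_map_poly)
  also have "\<dots> = T_coeff f m c j (\<lambda>i. poly (U i) t)"
    unfolding map_poly_aeval2 map_poly_T_shift by (simp add: T_coeff_def)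
  finally show ?thesis .
qed

lemma degree_T_shift_le: "degree (T_shift m c w i) \<le> 1"
  by (simp add: T_shift_def)

text \<open>The outer variable is the Taylor variable in the \<open>m\<close>-th argument of
  \<open>f\<close>, the inner one is the variable of the arguments \<open>U i\<close>. Interpolating
  with \<open>s + 1\<close> and \<open>s * dd + 1\<close> nodes expresses the coefficient through
  values of \<open>f\<close> alone, which a circuit for \<open>f\<close> can supply.\<close>

lemma T_coeff_interpolation:
  fixes f :: "'a::field_char_0 mpoly"
  assumes "total_degree f \<le> s" "\<And>i. i \<le> m \<Longrightarrow> degree (U i) \<le> dd"
  shows "coeff (coeff (aeval const_poly2 (T_shift m (\<lambda>i. [:c i:]) U) f) j) p =
    (\<Sum>\<alpha>\<in>nodes (s * dd). \<Sum>\<beta>\<in>nodes s.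
      coeff (lagrange (nodes (s * dd)) \<alpha>) p * coeff (lagrange (nodes s) \<beta>) j *
      mpoly_eval (\<lambda>i. if i < m then poly (U i) \<alpha> else if i = m then poly (U m) \<alpha> + \<beta> else c i) f)"
proof -
  let ?G = "aeval const_poly2 (T_shift m (\<lambda>i. [:c i:]) U) f"
  let ?P = "\<lambda>n (F :: unit \<Rightarrow> 'a poly poly). \<forall>l. degree (coeff (F ()) l) \<le> n"
  have "?P (s * dd) (\<lambda>_. ?G)"
  proof (rule aeval_graded)
    fix n n' and F G :: "unit \<Rightarrow> 'a poly poly" assume "?P n F" "?P n' G"
    then show "?P (n + n') (\<lambda>u. F u * G u)"
      unfolding coeff_mult
      by (intro allI degree_sum_le order.trans[OF degree_mult_le] add_mono) auto
  next
    fix i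
    show "?P dd (\<lambda>u. T_shift m (\<lambda>i. [:c i:]) U i)"
    proof
      fix l
      show "degree (coeff (T_shift m (\<lambda>i. [:c i:]) U i) l) \<le> dd"
        using assms(2)[of i] assms(2)[of m]
        by (cases "l = 0"; cases "l = 1") (auto simp: T_shift_def coeff_affine2)
    qed
  next
    show "mon_degree mon \<le> s" if "mon \<in> keys f" for mon
      using mon_degree_le_total_degree[OF that] assms(1) by simp
  qed (auto intro: degree_add_le order.trans simp: coeff_affine2)
  then have "degree (coeff ?G j) \<le> s * dd" by blast
  then have "coeff (coeff ?G j) p =
      (\<Sum>\<alpha>\<in>nodes (s * dd). coeff (lagrange (nodes (s * dd)) \<alpha>) p * poly (coeff ?G j) \<alpha>)"
    by (intro coeff_by_interpolation) auto
  moreover have "poly (coeff ?G j) \<alpha> = (\<Sum>\<beta>\<in>nodes s. coeff (lagrange (nodes s) \<beta>) j *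
      mpoly_eval (\<lambda>i. if i < m then poly (U i) \<alpha> else if i = m then poly (U m) \<alpha> + \<beta> else c i) f)" for \<alpha>
  proof -
    have "degree (aeval const_poly (T_shift m c (\<lambda>i. poly (U i) \<alpha>)) f) \<le> s * 1"
      by (rule degree_aeval_le[OF assms(1)]) (simp_all add: degree_T_shift_le[simplified])
    then have "T_coeff f m c j (\<lambda>i. poly (U i) \<alpha>) = (\<Sum>\<beta>\<in>nodes s. coeff (lagrange (nodes s) \<beta>) j *
        poly (aeval const_poly (T_shift m c (\<lambda>i. poly (U i) \<alpha>)) f) \<beta>)"
      unfolding T_coeff_def by (intro coeff_by_interpolation) auto
    then show ?thesis by (simp add: poly_coeff_aeval_T_shift poly_T_shift)
  qed
  ultimately show ?thesis by (simp add: sum_distrib_left mult_ac)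
qed

lemma coeff_eq_0_if_dvd:
  fixes p :: "'a::comm_ring_1 poly"
  assumes "monom 1 n dvd p" "k < n"
  shows "coeff p k = 0"
  using assms by (auto elim!: dvdE simp: coeff_monom_mult)

text \<open>A first-order Taylor expansion of an annihilator in its last variable: the truncation \<open>U\<close>
  of the generator at order \<open>q\<close> determines the next coefficient through the separant.\<close>

lemma hcoeff_recurrence:
  fixes Q f :: "'a::field_char_0 mpoly" and a y z c :: "nat \<Rightarrow> 'a"
  assumes Q: "total_degree Q \<le> dd" and q: "m < q" "q \<le> dd"
    and ann: "\<And>x y. T_coeff f m c j (\<lambda>i. Delta Q i x y) = 0"
  defines "U \<equiv> \<lambda>i. \<Sum>q'\<in>{i..<q}. monom (hcoeff Q a q' i z y) (q' - i)"
  shows "of_nat (Suc j) * T_coeff f m c (Suc j) (\<lambda>i. Delta Q i a y) * hcoeff Q a q m z y =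
    - coeff (coeff (aeval const_poly2 (T_shift m (\<lambda>i. [:c i:]) U) f) j) (q - m)"
proof -
  \<comment> \<open>\<open>p\<close> is the exponent at which the unknown \<open>e\<close> enters
    coordinate \<open>m\<close>, \<epsilon> is its term there, and everything is computed modulo the
    next power \<open>X\<close>.\<close>
  define p where "p = q - m"
  define e where "e = hcoeff Q a q m z y"
  define \<epsilon> where "\<epsilon> = monom e p"
  define X where "X = (monom 1 (Suc p) :: 'a poly)"
  \<comment> \<open>\<open>W\<close> is the full generator on the ray, \<open>V\<close> the
    truncation \<open>U\<close> with the one unknown term restored.\<close>
  define W where "W i = (\<Sum>q'\<in>{i..dd}. monom (hcoeff Q a q' i z y) (q' - i))" for i
  define V where "V i = (if i = m then U m + \<epsilon> else U i)" for i
  have p: "p \<ge> 1" using q by (simp add: p_def)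
  have Xmonom: "X dvd monom c n" if "n \<ge> Suc p" for c n
  proof -
    have "monom c n = X * monom c (n - Suc p)" using that by (simp add: X_def mult_monom)
    then show ?thesis by simp
  qed
  have polyW: "poly (W i) \<alpha> = Delta Q i (\<lambda>v. a v + \<alpha> * z v) y" for i \<alpha>
    by (simp add: W_def poly_sum poly_monom Delta_shift[OF Q] mult.commute)
  have split: "W i = U i + (\<Sum>q'\<in>{q..dd}. monom (hcoeff Q a q' i z y) (q' - i))" if "i \<le> m" for i
  proof -
    have "{i..dd} = {i..<q} \<union> {q..dd}" using that q by auto
    then show ?thesis unfolding W_def U_def by (simp add: sum.union_disjoint ivl_disj_int)
  qed
  \<comment> \<open>The part of degree \<open>q\<close> enters a coordinate \<open>i < m\<close>
    only at the exponent \<open>q - i > p\<close>, so modulo \<open>X\<close> the unknown is visible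
    in coordinate \<open>m\<close> alone.\<close>
  have WV: "X dvd W i - V i" if "i \<le> m" for i
  proof (cases "i = m")
    case True
    have "{q..dd} = insert q {Suc q..dd}" using q by auto
    then have "W i - V i = (\<Sum>q'\<in>{Suc q..dd}. monom (hcoeff Q a q' m z y) (q' - m))"
      using split[OF that] True by (simp add: V_def \<epsilon>_def e_def p_def)
    also have "X dvd \<dots>" using q by (intro dvd_sum Xmonom) (auto simp: p_def)
    finally show ?thesis .
  next
    case False
    then have "W i - V i = (\<Sum>q'\<in>{q..dd}. monom (hcoeff Q a q' i z y) (q' - i))"
      using split[OF that] by (simp add: V_def)
    also have "X dvd \<dots>" using q False that by (intro dvd_sum Xmonom) (auto simp: p_def)
    finally show ?thesis .
  qed
  let ?c = "\<lambda>i. [:c i:]"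
  let ?GW = "aeval const_poly2 (T_shift m ?c W) f"
  let ?GV = "aeval const_poly2 (T_shift m ?c V) f"
  let ?GU = "aeval const_poly2 (T_shift m ?c U) f"
  have GW0: "coeff ?GW j = 0"
    by (rule poly_eqI_infinite) (simp add: poly_coeff_aeval_T_shift polyW ann)
  have "\<forall>l. X dvd coeff ?GW l - coeff ?GV l"
  proof -
    let ?P = "\<lambda>F :: bool \<Rightarrow> 'a poly poly. \<forall>l. X dvd coeff (F True) l - coeff (F False) l"
    have "?P (\<lambda>b. aeval const_poly2 (T_shift m ?c (if b then W else V)) f)"
    proof (rule aeval_closed)
      fix F G :: "bool \<Rightarrow> 'a poly poly" assume FG: "?P F" "?P G"
      show "?P (\<lambda>b. F b * G b)"
      proof
        fix l
        have "coeff (F True * G True) l - coeff (F False * G False) l =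
          (\<Sum>i\<le>l. coeff (F True) i * (coeff (G True) (l - i) - coeff (G False) (l - i)) +
            (coeff (F True) i - coeff (F False) i) * coeff (G False) (l - i))"
          by (simp add: coeff_mult algebra_simps flip: sum_subtractf)
        also have "X dvd \<dots>" using FG by (intro dvd_sum dvd_add dvd_mult dvd_mult2) auto
        finally show "X dvd coeff (F True * G True) l - coeff (F False * G False) l" .
      qed
      show "?P (\<lambda>b. F b + G b)"
      proof
        fix l
        have "coeff (F True + G True) l - coeff (F False + G False) l =
          (coeff (F True) l - coeff (F False) l) + (coeff (G True) l - coeff (G False) l)" by simp
        also have "X dvd \<dots>" using FG by (intro dvd_add) auto
        finally show "X dvd coeff (F True + G True) l - coeff (F False + G False) l" .
      qed
    next
      fix i
      show "?P (\<lambda>b. T_shift m ?c (if b then W else V) i)"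
      proof
        fix l
        show "X dvd coeff (T_shift m ?c (if True then W else V) i) l - coeff (T_shift m ?c (if False then W else V) i) l"
          using WV[of i] by (cases "l = 0"; cases "l = 1") (auto simp: T_shift_def coeff_affine2)
      qed
    qed auto
    then show ?thesis by simp
  qed
  then have 1: "X dvd coeff ?GW j - coeff ?GV j" by blast
  \<comment> \<open>\<open>T_shift\<close> adds the outer variable to coordinate \<open>m\<close>,
    so adding \<epsilon> there is a translation of that variable.\<close>
  have GV: "?GV = pcompose ?GU [:\<epsilon>, 1:]"
  proof -
    have "pcompose ?GU [:\<epsilon>, 1:] =
        aeval (\<lambda>c. pcompose [:[:c:]:] [:\<epsilon>, 1:]) (\<lambda>i. pcompose (T_shift m ?c U i) [:\<epsilon>, 1:]) f"
      by (rule aeval_hom) (simp_all add: pcompose_add pcompose_mult pcompose_1)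
    moreover have "(\<lambda>i. pcompose (T_shift m ?c U i) [:\<epsilon>, 1:]) = T_shift m ?c V"
      by (auto simp: fun_eq_iff T_shift_def V_def pcompose_pCons)
    ultimately show ?thesis by simp
  qed
  \<comment> \<open>Indices below \<open>j\<close> have too small a degree; from
    \<open>j + 2\<close> on a factor \<open>\<epsilon> ^ 2\<close> appears, and
    \<open>2 * p \<ge> p + 1\<close>. Only the linear term survives.\<close>
  have 2: "X dvd coeff ?GV j - (coeff ?GU j + of_nat (Suc j) * \<epsilon> * coeff ?GU (Suc j))"
  proof -
    define N where "N = max (degree ?GU) (Suc j)"
    have "?GV = (\<Sum>l\<le>N. smult (coeff ?GU l) ([:\<epsilon>, 1:] ^ l))"
      unfolding GV by (subst poly_as_sum_of_monoms'[of ?GU N, symmetric])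
        (simp_all add: N_def pcompose_sum monom_altdef pcompose_smult pcompose_power pcompose_pCons)
    then have "coeff ?GV j = (\<Sum>l\<le>N. coeff ?GU l * coeff ([:\<epsilon>, 1:] ^ l) j)"
      by (simp add: coeff_sum)
    also have "{..N} = {..<j} \<union> {j, Suc j} \<union> {Suc (Suc j)..N}" by (auto simp: N_def)
    also have "(\<Sum>l\<in>\<dots>. coeff ?GU l * coeff ([:\<epsilon>, 1:] ^ l) j) =
        (\<Sum>l<j. coeff ?GU l * coeff ([:\<epsilon>, 1:] ^ l) j) +
        (coeff ?GU j * coeff ([:\<epsilon>, 1:] ^ j) j + coeff ?GU (Suc j) * coeff ([:\<epsilon>, 1:] ^ Suc j) j) +
        (\<Sum>l\<in>{Suc (Suc j)..N}. coeff ?GU l * coeff ([:\<epsilon>, 1:] ^ l) j)"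
      by (subst sum.union_disjoint, simp, simp, fastforce)+ simp
    also have "(\<Sum>l<j. coeff ?GU l * coeff ([:\<epsilon>, 1:] ^ l) j) = 0"
    proof (intro sum.neutral ballI)
      fix l assume "l \<in> {..<j}"
      moreover have "degree ([:\<epsilon>, 1:] ^ l) \<le> l" by (rule order.trans[OF degree_power_le]) auto
      ultimately have "coeff ([:\<epsilon>, 1:] ^ l) j = 0" by (intro coeff_eq_0) auto
      then show "coeff ?GU l * coeff ([:\<epsilon>, 1:] ^ l) j = 0" by simp
    qed
    also have "coeff ([:\<epsilon>, 1:] ^ j) j = 1" by (simp add: coeff_linear_poly_power)
    also have "coeff ([:\<epsilon>, 1:] ^ Suc j) j = of_nat (Suc j) * \<epsilon>"
      by (subst coeff_linear_poly_power) simp_all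
    finally have "coeff ?GV j - (coeff ?GU j + of_nat (Suc j) * \<epsilon> * coeff ?GU (Suc j)) =
        (\<Sum>l\<in>{Suc (Suc j)..N}. coeff ?GU l * coeff ([:\<epsilon>, 1:] ^ l) j)"
      by (simp add: algebra_simps)
    also have "X dvd \<dots>"
    proof (intro dvd_sum dvd_mult)
      fix l assume l: "l \<in> {Suc (Suc j)..N}"
      have "\<epsilon> ^ (l - j) = \<epsilon> ^ 2 * \<epsilon> ^ (l - j - 2)" 
      proof -
        have "l - j = 2 + (l - j - 2)" using l by auto
        then show ?thesis by (metis power_add)
      qed
      moreover have "\<epsilon> ^ 2 = monom (e * e) (p + p)" by (simp add: \<epsilon>_def power2_eq_square mult_monom)
      moreover have "X dvd monom (e * e) (p + p)" using p by (intro Xmonom) auto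
      ultimately have "X dvd \<epsilon> ^ (l - j)" by (metis dvd_mult2)
      then show "X dvd coeff ([:\<epsilon>, 1:] ^ l) j"
        using l by (simp add: coeff_linear_poly_power)
    qed
    finally show ?thesis .
  qed
  have "X dvd coeff ?GW j - (coeff ?GU j + of_nat (Suc j) * \<epsilon> * coeff ?GU (Suc j))"
    using dvd_add[OF 1 2] by (simp add: algebra_simps)
  then have "coeff (coeff ?GW j - (coeff ?GU j + of_nat (Suc j) * \<epsilon> * coeff ?GU (Suc j))) p = 0"
    unfolding X_def by (rule coeff_eq_0_if_dvd) simp
  then have "coeff (coeff ?GU j) p + of_nat (Suc j) * e * coeff (coeff ?GU (Suc j)) 0 = 0"
    unfolding GW0
    by (simp add: \<epsilon>_def of_nat_poly coeff_monom_mult mult.assoc del: of_nat_Suc) (metis add.right_inverse)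
  \<comment> \<open>At argument 0 the truncation agrees with the generator at the centre, since all
    omitted terms have positive exponents.\<close>
  moreover have "coeff (coeff ?GU (Suc j)) 0 = T_coeff f m c (Suc j) (\<lambda>i. Delta Q i a y)"
  proof -
    have "poly (U i) 0 = Delta Q i a y" if "i \<le> m" for i
    proof -
      have "poly (\<Sum>q'\<in>{q..dd}. monom (hcoeff Q a q' i z y) (q' - i)) 0 = 0"
        unfolding poly_sum using q that by (intro sum.neutral) (auto simp: poly_monom)
      then have "poly (U i) 0 = poly (W i) 0" using split[OF that] by simp
      then show ?thesis by (simp add: polyW)
    qed
    then have "T_coeff f m c (Suc j) (\<lambda>i. poly (U i) 0) = T_coeff f m c (Suc j) (\<lambda>i. Delta Q i a y)"
      unfolding T_coeff_def by (subst T_shift_cong[of m "\<lambda>i. poly (U i) 0"]) auto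
    then show ?thesis by (simp add: poly_0_coeff_0[symmetric] poly_coeff_aeval_T_shift)
  qed
  ultimately show ?thesis
    by (simp add: p_def e_def algebra_simps eq_neg_iff_add_eq_0 del: of_nat_Suc)
qed

section \<open>Reconstruction from an annihilator\<close>

lemma derivable_seq:
  assumes "derivable k A B N1" "derivable k (A \<union> B) C N2"
  shows "derivable k A C (N1 + N2)"
  by (rule derivable_mono[OF derivable_trans[OF assms]]) auto

lemma derivable_Un:
  assumes "derivable k A B N1" "derivable k A C N2"
  shows "derivable k A (B \<union> C) (N1 + N2)"
  by (rule derivable_trans[OF assms(1)], rule derivable_mono[OF assms(2)]) auto

lemma sep_mono: "sep K n f \<Longrightarrow> n \<le> n' \<Longrightarrow> sep K n' f"
  unfolding sep_def by (blast intro: polydeg_mono)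

text \<open>One gate for each of the \<open>K * Suc m\<close> differences and one product gate per
  grid point; the denominators become edge scalars.\<close>

lemma derivable_lagrange_basis:
  fixes S :: "nat \<Rightarrow> 'a::field_char_0 set" and Z :: "nat \<Rightarrow> (nat \<Rightarrow> 'a) \<Rightarrow> 'a"
  assumes "\<And>v. v < K \<Longrightarrow> Z v \<in> A" "(\<lambda>x. 1) \<in> A"
    and S: "\<And>v. v < K \<Longrightarrow> finite (S v) \<and> card (S v) = Suc m"
  shows "derivable k A ((\<lambda>b x. \<Prod>v<K. poly (lagrange (S v) (b v)) (Z v x)) ` PiE {..<K} S)
    (K * Suc m + Suc m ^ K)"
proof -
  let ?I = "Sigma {..<K} S"
  let ?F = "\<lambda>(v, c') x. Z v x - c'"
  have finI: "finite ?I" using S by auto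
  have 1: "derivable k A (?F ` ?I) (card ?I)"
  proof (rule derivable_steps[OF finI])
    fix i assume "i \<in> ?I"
    then obtain v c' where i: "i = (v, c')" "v < K" by auto
    have "gate_step k A (\<lambda>x. 1 * Z v x + (- c'))"
      by (rule gate_step_affine) (use assms i in auto)
    then show "gate_step k A (?F i)" using i by simp
  qed
  have card: "card ?I = K * Suc m" using S by (subst card_SigmaI) auto
  have 2: "derivable k (A \<union> ?F ` ?I) ((\<lambda>b x. \<Prod>v<K. poly (lagrange (S v) (b v)) (Z v x)) ` PiE {..<K} S)
      (card (PiE {..<K} S))"
  proof (rule derivable_steps)
    show "finite (PiE {..<K} S)" using S by (intro finite_PiE) auto
    fix b
    let ?J = "Sigma {..<K} (\<lambda>v. S v - {b v})"
    have "gate_step k (A \<union> ?F ` ?I) (\<lambda>x. \<Prod>i\<in>?J. (case i of (v, c') \<Rightarrow> inverse (b v - c')) * ?F i x)"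
      by (rule gate_step_prod) (use S in auto)
    moreover have "(\<Prod>v<K. poly (lagrange (S v) (b v)) (Z v x)) =
        (\<Prod>i\<in>?J. (case i of (v, c') \<Rightarrow> inverse (b v - c')) * ?F i x)" for x
      unfolding poly_lagrange using S
      by (subst prod.Sigma) (auto intro!: prod.cong simp: mult.commute)
    ultimately show "gate_step k (A \<union> ?F ` ?I) (\<lambda>x. \<Prod>v<K. poly (lagrange (S v) (b v)) (Z v x))"
      by simp
  qed
  have "card (PiE {..<K} S) = Suc m ^ K" using S by (simp add: card_PiE)
  then show ?thesis using derivable_seq[OF 1 2] by (simp only: card)
qed

text \<open>The values of \<open>g\<close> on the grid are constants and become edge scalars, so
  once the basis is there every function of individual degree \<open>m\<close> costs a single sum
  gate.\<close>

lemma gate_step_sep: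
  fixes S :: "nat \<Rightarrow> 'a::field_char_0 set" and Z :: "nat \<Rightarrow> (nat \<Rightarrow> 'a) \<Rightarrow> 'a"
  assumes basis: "\<And>b. b \<in> PiE {..<K} S \<Longrightarrow> (\<lambda>x. \<Prod>v<K. poly (lagrange (S v) (b v)) (Z v x)) \<in> A"
    and S: "\<And>v. v < K \<Longrightarrow> finite (S v) \<and> card (S v) = Suc m"
    and g: "sep K m g" "\<And>y y'. (\<And>v. v < K \<Longrightarrow> y v = y' v) \<Longrightarrow> g y = g y'"
  shows "gate_step k A (\<lambda>x. g (\<lambda>v. Z v x))"
proof -
  have "g (\<lambda>v. Z v x) = (\<Sum>b\<in>PiE {..<K} S. g b * (\<Prod>v<K. poly (lagrange (S v) (b v)) (Z v x)))" for x
  proof -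
    have "g (\<lambda>v. if v < K then b v else Z v x) = g b" for b by (rule g(2)) simp
    then show ?thesis
      using grid_interpolation[OF g(1) S, where y = "\<lambda>v. Z v x"] by (simp only:)
  qed
  moreover have "gate_step k A (\<lambda>x. \<Sum>b\<in>PiE {..<K} S. g b * (\<Prod>v<K. poly (lagrange (S v) (b v)) (Z v x)))"
    using S by (intro gate_step_sum basis finite_PiE) auto
  ultimately show ?thesis by simp
qed

text \<open>By \<open>hcoeff_recurrence\<close> the new quantity is a linear combination of values
  of \<open>f\<close> at truncated generators: at each pair of interpolation nodes \<open>n\<close>
  gates for the arguments and one copy of \<open>C\<close>, and a final sum gate.\<close>

lemma derivable_next_top:
  fixes Q f :: "'a::field_char_0 mpoly" and Z :: "nat \<Rightarrow> (nat \<Rightarrow> 'a) \<Rightarrow> 'a"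
  assumes Q: "total_degree Q \<le> dd" and q: "m < q" "q \<le> dd"
    and f: "total_degree f \<le> s" "is_circuit n C" "computes C f" and m: "m < n"
    and ann: "\<And>x y. T_coeff f m c j (\<lambda>i. Delta Q i x y) = 0"
    and sep: "T_coeff f m c (Suc j) (\<lambda>i. Delta Q i a y) \<noteq> 0"
    and one: "(\<lambda>x. 1) \<in> A"
    and known: "\<And>q' i. q' < q \<Longrightarrow> i \<le> m \<Longrightarrow> (\<lambda>x. hcoeff Q a q' i (\<lambda>v. Z v x) y) \<in> A"
  shows "derivable k A {\<lambda>x. hcoeff Q a q m (\<lambda>v. Z v x) y}
    ((s * dd + 1) * (s + 1) * (n + length C) + 1)"
proof -
  let ?N = "nodes (s * dd) \<times> (nodes s :: 'a set)"
  define w :: "'a \<times> 'a \<Rightarrow> nat \<Rightarrow> (nat \<Rightarrow> 'a) \<Rightarrow> 'a" where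
    "w = (\<lambda>(\<alpha>, \<beta>) i x. if i < m then \<Sum>q'\<in>{i..<q}. \<alpha> ^ (q' - i) * hcoeff Q a q' i (\<lambda>v. Z v x) y
      else if i = m then (\<Sum>q'\<in>{m..<q}. \<alpha> ^ (q' - m) * hcoeff Q a q' m (\<lambda>v. Z v x) y) + \<beta> else c i)"
  define G where "G p = (\<lambda>x. mpoly_eval (\<lambda>i. w p i x) f)" for p
  have wstep: "gate_step k A (w p i)" for p i
  proof -
    obtain \<alpha> \<beta> where p: "p = (\<alpha>, \<beta>)" by (cases p)
    consider "i < m" | "i = m" | "i > m" by linarith
    then show ?thesis
    proof cases
      case 1
      have "gate_step k A (\<lambda>x. \<Sum>q'\<in>{i..<q}. \<alpha> ^ (q' - i) * hcoeff Q a q' i (\<lambda>v. Z v x) y)"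
        by (rule gate_step_sum) (use known 1 in auto)
      then show ?thesis using 1 by (simp add: w_def p)
    next
      case 2
      \<comment> \<open>The index \<open>q\<close>, which lies outside \<open>{m..<q}\<close>,
        stands for the constant summand \<beta>, with the function 1 as its input.\<close>
      let ?g = "\<lambda>q' x. if q' = q then 1 else hcoeff Q a q' m (\<lambda>v. Z v x) y"
      have "gate_step k A (\<lambda>x. \<Sum>q'\<in>insert q {m..<q}. (if q' = q then \<beta> else \<alpha> ^ (q' - m)) * ?g q' x)"
      proof (rule gate_step_sum)
        fix q' assume "q' \<in> insert q {m..<q}"
        then show "?g q' \<in> A" using one known by (cases "q' = q") auto
      qed simp
      moreover have "(\<Sum>q'\<in>insert q {m..<q}. (if q' = q then \<beta> else \<alpha> ^ (q' - m)) * ?g q' x) = w p i x" for x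
        using 2 by (subst sum.insert) (auto simp: w_def p intro!: sum.cong)
      ultimately show ?thesis by simp
    next
      case 3
      then have "w p i = (\<lambda>x. c i)" by (auto simp: w_def p fun_eq_iff)
      then show ?thesis using gate_step_const by metis
    qed
  qed
  have G1: "derivable k A {G p} (n + length C)" for p
  proof (rule derivable_seq)
    show "derivable k A (w p ` {..<n}) n"
      using derivable_steps[of "{..<n}" k A "w p"] wstep by simp
    show "derivable k (A \<union> w p ` {..<n}) {G p} (length C)"
      unfolding G_def by (rule derivable_substitute[OF f(2,3)]) auto
  qed
  have 1: "derivable k A (G ` ?N) (card ?N * (n + length C))"
    using derivable_family[of ?N k A "\<lambda>p. {G p}"] G1 by (simp add: UNION_singleton_eq_range)
  have card: "card ?N = (s * dd + 1) * (s + 1)" by (simp add: card_cartesian_product)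
  have 2: "derivable k (A \<union> G ` ?N) {\<lambda>x. hcoeff Q a q m (\<lambda>v. Z v x) y} 1"
  proof (rule derivable_step)
    \<comment> \<open>The separant depends on the centre and the direction only, so its inverse is a
      constant of the circuit.\<close>
    define r where "r = - inverse (of_nat (Suc j) * T_coeff f m c (Suc j) (\<lambda>i. Delta Q i a y))"
    let ?r = "\<lambda>(\<alpha>, \<beta>). r * (coeff (lagrange (nodes (s * dd)) \<alpha>) (q - m) * coeff (lagrange (nodes s) \<beta>) j)"
    have "hcoeff Q a q m (\<lambda>v. Z v x) y = (\<Sum>p\<in>?N. ?r p * G p x)" for x
    proof -
      let ?U = "\<lambda>i. \<Sum>q'\<in>{i..<q}. monom (hcoeff Q a q' i (\<lambda>v. Z v x) y) (q' - i)"
      have U: "poly (?U i) \<alpha> = (\<Sum>q'\<in>{i..<q}. \<alpha> ^ (q' - i) * hcoeff Q a q' i (\<lambda>v. Z v x) y)" for i \<alpha>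
        by (simp add: poly_sum poly_monom mult.commute)
      have nz: "of_nat (Suc j) * T_coeff f m c (Suc j) (\<lambda>i. Delta Q i a y) \<noteq> 0"
        using sep by (simp del: of_nat_Suc)
      have "hcoeff Q a q m (\<lambda>v. Z v x) y = r * coeff (coeff (aeval const_poly2 (T_shift m (\<lambda>i. [:c i:]) ?U) f) j) (q - m)"
        using hcoeff_recurrence[OF Q q ann, of a y "\<lambda>v. Z v x"] nz
        by (simp add: r_def field_simps del: of_nat_Suc)
      also have "coeff (coeff (aeval const_poly2 (T_shift m (\<lambda>i. [:c i:]) ?U) f) j) (q - m) =
        (\<Sum>\<alpha>\<in>nodes (s * dd). \<Sum>\<beta>\<in>nodes s.
          coeff (lagrange (nodes (s * dd)) \<alpha>) (q - m) * coeff (lagrange (nodes s) \<beta>) j * G (\<alpha>, \<beta>) x)"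
      proof (subst T_coeff_interpolation[OF f(1)])
        show "degree (?U i) \<le> dd" for i
          using q by (intro degree_sum_le) (auto intro!: order.trans[OF degree_monom_le])
      qed (simp add: G_def w_def U cong: if_cong)
      also have "r * \<dots> = (\<Sum>p\<in>?N. ?r p * G p x)"
        by (simp add: sum.cartesian_product sum_distrib_left case_prod_unfold mult_ac)
      finally show ?thesis .
    qed
    moreover have "gate_step k (A \<union> G ` ?N) (\<lambda>x. \<Sum>p\<in>?N. ?r p * G p x)"
      by (rule gate_step_sum) auto
    ultimately show "gate_step k (A \<union> G ` ?N) (\<lambda>x. hcoeff Q a q m (\<lambda>v. Z v x) y)" by simp
  qed
  show ?thesis using derivable_seq[OF 1 2] unfolding card .
qed

text \<open>The summands of the cost belong, in this order, to the constant 1 and the displacements,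
  the Lagrange basis, the parts of degree at most \<open>m\<close> with the Euler coefficients,
  \<open>dd\<close> rounds of the recurrence, and the final sum. The arguments \<open>X\<close> are
  arbitrary so that powers of the variables can be inserted.\<close>

lemma derivable_from_annihilator:
  fixes Q f :: "'a::field_char_0 mpoly" and X :: "nat \<Rightarrow> (nat \<Rightarrow> 'a) \<Rightarrow> 'a"
  assumes Q: "total_degree Q \<le> dd" "variate K Q"
    and f: "total_degree f \<le> s" "is_circuit n C" "computes C f" and m: "m < n"
    and ann: "\<And>x y. T_coeff f m c j (\<lambda>i. Delta Q i x y) = 0"
    and sep: "T_coeff f m c (Suc j) (\<lambda>i. Delta Q i a b0) \<noteq> 0"
    and X: "\<And>v. v < K \<Longrightarrow> X v \<in> A"
  defines "N \<equiv> Suc m ^ K"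
  shows "derivable k A {\<lambda>x. mpoly_eval (\<lambda>v. X v x) Q}
    (1 + K + (K * Suc m + N) + (Suc m * Suc m * N + Suc m * N * N) +
     dd * (N * ((s * dd + 1) * (s + 1) * (n + length C) + 1) + Suc m * N * N + Suc m * N) + 1)"
proof -
  let ?g = "\<lambda>y. T_coeff f m c (Suc j) (\<lambda>i. Delta Q i a y)"
  \<comment> \<open>The recurrence is solved in every grid direction, so the separant has to be
    nonzero in all of them.\<close>
  have "\<exists>S. (\<forall>v<K. finite (S v) \<and> card (S v) = Suc m) \<and> (\<forall>b\<in>PiE {..<K} S. ?g b \<noteq> 0)"
  proof (rule exists_good_grid[OF polydeg_line_T_coeff_Delta sep])
    fix y y' :: "nat \<Rightarrow> 'a" assume "\<And>v. v < K \<Longrightarrow> y v = y' v"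
    then have "Delta Q i a y = Delta Q i a y'" for i by (intro Delta_cong[OF Q(2)]) auto
    then show "?g y = ?g y'" by simp
  qed
  then obtain S where S: "\<And>v. v < K \<Longrightarrow> finite (S v) \<and> card (S v) = Suc m"
    and gS: "\<And>b. b \<in> PiE {..<K} S \<Longrightarrow> ?g b \<noteq> 0" by blast
  let ?G = "PiE {..<K} S"
  have finG: "finite ?G" using S by (intro finite_PiE) auto
  have cardG: "card ?G = N" using S by (simp add: card_PiE N_def)
  have "?G \<noteq> {}"
  proof -
    have "card ?G \<noteq> 0" by (simp add: cardG N_def)
    then show ?thesis by force
  qed
  then obtain y0 where y0: "y0 \<in> ?G" by blast
  define Z where "Z v = (\<lambda>x. X v x - a v)" for v
  define H where "H q i y = (\<lambda>x. hcoeff Q a q i (\<lambda>v. Z v x) y)" for q i y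
  define L where "L b = (\<lambda>x. \<Prod>v<K. poly (lagrange (S v) (b v)) (Z v x))" for b
  define W where "W i y b = (\<lambda>x. grid_coeff K m S y b i (\<lambda>v. Z v x))" for i y b
  \<comment> \<open>All that is known before degree \<open>q\<close> is treated: every order up to
    \<open>m\<close>, in every grid direction.\<close>
  define HH where "HH q = {H q' i y |q' i y. q' < q \<and> i \<le> m \<and> y \<in> ?G}" for q
  define A1 where "A1 = A \<union> ({\<lambda>x. 1} \<union> Z ` {..<K})"
  define WW where "WW = {W i y b |i y b. i \<le> m \<and> y \<in> ?G \<and> b \<in> ?G}"
  have HH_I: "H q' i y \<in> HH q" if "q' < q" "i \<le> m" "y \<in> ?G" for q' i y q
    unfolding HH_def using that by blast
  have WW_I: "W i y b \<in> WW" if "i \<le> m" "y \<in> ?G" "b \<in> ?G" for i y b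
    unfolding WW_def using that by blast
  have HH_mono: "HH q \<subseteq> HH q'" if "q \<le> q'" for q q'
    unfolding HH_def using that order_less_le_trans by blast
  define E where "E = N * ((s * dd + 1) * (s + 1) * (n + length C) + 1) + Suc m * N * N + Suc m * N"
  have s0: "derivable k A ({\<lambda>x. 1} \<union> Z ` {..<K}) (1 + K)"
  proof (rule derivable_trans)
    show "derivable k A {\<lambda>x. 1} 1" by (intro derivable_step gate_step_const)
    have "gate_step k (A \<union> {\<lambda>x. 1}) (Z v)" if "v < K" for v
    proof -
      have "gate_step k (A \<union> {\<lambda>x. 1}) (\<lambda>x. 1 * X v x + (- a v))"
        by (rule gate_step_affine) (use X that in auto)
      then show ?thesis by (simp add: Z_def)
    qed
    then show "derivable k (A \<union> {\<lambda>x. 1}) (Z ` {..<K}) K"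
      using derivable_steps[of "{..<K}" k "A \<union> {\<lambda>x. 1}" Z] by simp
  qed
  have s1: "derivable k A1 (L ` ?G) (K * Suc m + N)"
    unfolding L_def N_def by (rule derivable_lagrange_basis[OF _ _ S]) (auto simp: A1_def)
  have sepstep: "gate_step k (A1 \<union> L ` ?G) (\<lambda>x. g (\<lambda>v. Z v x))"
    if "sep K m g" "\<And>y y'. (\<And>v. v < K \<Longrightarrow> y v = y' v) \<Longrightarrow> g y = g y'" for g
  proof (rule gate_step_sep[OF _ S that])
    fix b assume "b \<in> ?G"
    then have "L b \<in> A1 \<union> L ` ?G" by blast
    then show "(\<lambda>x. \<Prod>v<K. poly (lagrange (S v) (b v)) (Z v x)) \<in> A1 \<union> L ` ?G"
      by (simp only: L_def)
  qed
  \<comment> \<open>Initial values: parts of degree at most \<open>m\<close> have individual degree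
    at most \<open>m\<close> in the displacement and are interpolated directly, as the recurrence
    works only beyond \<open>m\<close>.\<close>
  have s2: "derivable k (A1 \<union> L ` ?G) (HH (Suc m) \<union> WW) (Suc m * Suc m * N + Suc m * N * N)"
  proof (rule derivable_Un)
    let ?I = "{..m} \<times> {..m} \<times> ?G"
    have HH: "HH (Suc m) \<subseteq> (\<lambda>(q, i, y). H q i y) ` ?I"
    proof
      fix h assume "h \<in> HH (Suc m)"
      then obtain q i y where "h = H q i y" "q < Suc m" "i \<le> m" "y \<in> ?G"
        unfolding HH_def by blast
      then show "h \<in> (\<lambda>(q, i, y). H q i y) ` ?I" by (intro image_eqI[of _ _ "(q, i, y)"]) auto
    qed
    have card: "card ?I = Suc m * Suc m * N" by (simp add: card_cartesian_product cardG algebra_simps)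
    have "derivable k (A1 \<union> L ` ?G) ((\<lambda>(q, i, y). H q i y) ` ?I) (card ?I)"
    proof (rule derivable_steps)
      fix p assume "p \<in> ?I"
      then obtain q i y where p: "p = (q, i, y)" "q \<le> m" by auto
      have "gate_step k (A1 \<union> L ` ?G) (H q i y)"
        unfolding H_def
        by (rule sepstep) (use p sep_mono[OF sep_hcoeff_z] hcoeff_cong[OF Q(2)] in blast)+
      then show "gate_step k (A1 \<union> L ` ?G) ((\<lambda>(q, i, y). H q i y) p)" by (simp add: p)
    qed (use finG in auto)
    then show "derivable k (A1 \<union> L ` ?G) (HH (Suc m)) (Suc m * Suc m * N)"
      unfolding card by (rule derivable_mono) (use HH in auto)
    let ?J = "{..m} \<times> ?G \<times> ?G"
    have WW: "WW \<subseteq> (\<lambda>(i, y, b). W i y b) ` ?J"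
    proof
      fix h assume "h \<in> WW"
      then obtain i y b where "h = W i y b" "i \<le> m" "y \<in> ?G" "b \<in> ?G"
        unfolding WW_def by blast
      then show "h \<in> (\<lambda>(i, y, b). W i y b) ` ?J" by (intro image_eqI[of _ _ "(i, y, b)"]) auto
    qed
    have card: "card ?J = Suc m * N * N" by (simp add: card_cartesian_product cardG algebra_simps)
    have "derivable k (A1 \<union> L ` ?G) ((\<lambda>(i, y, b). W i y b) ` ?J) (card ?J)"
    proof (rule derivable_steps)
      fix p assume "p \<in> ?J"
      then obtain i y b where p: "p = (i, y, b)" "b \<in> ?G" by auto
      have "gate_step k (A1 \<union> L ` ?G) (W i y b)"
        unfolding W_def
      proof (rule sepstep)
        show "sep K m (grid_coeff K m S y b i)"
          by (rule sep_grid_coeff[OF S]) (use p in auto)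
        fix z z' :: "nat \<Rightarrow> 'a" assume "\<And>v. v < K \<Longrightarrow> z v = z' v"
        then show "grid_coeff K m S y b i z = grid_coeff K m S y b i z'"
          unfolding grid_coeff_def by (intro arg_cong2[of _ _ _ _ coeff] prod.cong) auto
      qed
      then show "gate_step k (A1 \<union> L ` ?G) ((\<lambda>(i, y, b). W i y b) p)" by (simp add: p)
    qed (use finG in auto)
    then show "derivable k (A1 \<union> L ` ?G) WW (Suc m * N * N)"
      unfolding card by (rule derivable_mono) (use WW in auto)
  qed
  define A2 where "A2 = A1 \<union> L ` ?G \<union> WW"
  \<comment> \<open>\<open>N\<close> uses of the recurrence, \<open>Suc m * N * N\<close> products
    with Euler coefficients and \<open>Suc m * N\<close> sums: the cost \<open>E\<close> does not
    depend on \<open>q\<close>.\<close>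
  have s3: "derivable k (A2 \<union> HH q) (HH (Suc q)) E" if q: "m < q" "q \<le> dd" for q
  proof -
    let ?A = "A2 \<union> HH q"
    let ?T = "(\<lambda>y. H q m y) ` ?G"
    have "derivable k ?A ?T (card ?G * ((s * dd + 1) * (s + 1) * (n + length C) + 1))"
    proof -
      have "derivable k ?A {H q m y} ((s * dd + 1) * (s + 1) * (n + length C) + 1)" if "y \<in> ?G" for y
        unfolding H_def
      proof (rule derivable_next_top[OF Q(1) q f m ann gS[OF that]])
        show "(\<lambda>x. 1) \<in> ?A" by (simp add: A2_def A1_def)
        fix q' i assume "q' < q" "i \<le> m"
        then have "H q' i y \<in> ?A" using HH_I that by blast
        then show "(\<lambda>x. hcoeff Q a q' i (\<lambda>v. Z v x) y) \<in> ?A" by (simp only: H_def)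
      qed
      from derivable_family[OF finG this] show ?thesis by (simp add: UNION_singleton_eq_range)
    qed
    note t1 = this[unfolded cardG]
    let ?J = "{..m} \<times> ?G \<times> ?G"
    let ?P = "\<lambda>(i, y, b) x. H q m b x * W i y b x"
    have cardJ: "card ?J = Suc m * N * N" by (simp add: card_cartesian_product cardG algebra_simps)
    have t2: "derivable k (?A \<union> ?T) (?P ` ?J) (Suc m * N * N)"
      unfolding cardJ[symmetric]
    proof (rule derivable_steps)
      fix p assume "p \<in> ?J"
      then obtain i y b where p: "p = (i, y, b)" "i \<le> m" "y \<in> ?G" "b \<in> ?G" by auto
      have "gate_step k (?A \<union> ?T) (\<lambda>x. H q m b x * W i y b x)"
        by (rule gate_step_mult) (use p WW_I in \<open>auto simp: A2_def\<close>)
      then show "gate_step k (?A \<union> ?T) (?P p)" by (simp add: p)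
    qed (use finG in auto)
    let ?I = "{..m} \<times> ?G"
    have cardI: "card ?I = Suc m * N" by (simp add: card_cartesian_product cardG algebra_simps)
    have t3: "derivable k (?A \<union> ?T \<union> ?P ` ?J) ((\<lambda>(i, y). H q i y) ` ?I) (Suc m * N)"
      unfolding cardI[symmetric]
    proof (rule derivable_steps)
      fix p assume "p \<in> ?I"
      then obtain i y where p: "p = (i, y)" "i \<le> m" "y \<in> ?G" by auto
      define r where "r = inverse (of_nat (q - i choose (m - i)) :: 'a)"
      have "q - i choose (m - i) \<noteq> 0" using q p by simp
      then have nz: "(of_nat (q - i choose (m - i)) :: 'a) \<noteq> 0" by simp
      have "H q i y x = (\<Sum>b\<in>?G. r * ?P (i, y, b) x)" for x
      proof -
        have "of_nat (q - i choose (m - i)) * hcoeff Q a q i (\<lambda>v. Z v x) y =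
          (\<Sum>b\<in>?G. hcoeff Q a q m (\<lambda>v. Z v x) b * grid_coeff K m S y b i (\<lambda>v. Z v x))"
          by (rule hcoeff_from_grid[OF Q(2) S p(2)]) (use q in auto)
        from this[symmetric] have "hcoeff Q a q i (\<lambda>v. Z v x) y =
          r * (\<Sum>b\<in>?G. hcoeff Q a q m (\<lambda>v. Z v x) b * grid_coeff K m S y b i (\<lambda>v. Z v x))"
          using nz by (simp only:) (simp add: r_def)
        then show ?thesis by (simp add: H_def W_def sum_distrib_left)
      qed
      moreover have "gate_step k (?A \<union> ?T \<union> ?P ` ?J) (\<lambda>x. \<Sum>b\<in>?G. r * ?P (i, y, b) x)"
      proof (rule gate_step_sum[OF finG])
        fix b assume "b \<in> ?G"
        then have "(i, y, b) \<in> ?J" using p by simp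
        then show "?P (i, y, b) \<in> ?A \<union> ?T \<union> ?P ` ?J" by (intro UnI2 imageI)
      qed
      ultimately have "gate_step k (?A \<union> ?T \<union> ?P ` ?J) (\<lambda>x. H q i y x)" by simp
      then show "gate_step k (?A \<union> ?T \<union> ?P ` ?J) ((\<lambda>(i, y). H q i y) p)" by (simp add: p)
    qed (use finG in auto)
    have "derivable k ?A ((\<lambda>(i, y). H q i y) ` ?I) E"
      using derivable_seq[OF derivable_trans[OF t1 t2]] t3 unfolding Un_assoc E_def by blast
    moreover have "HH (Suc q) \<subseteq> ?A \<union> (\<lambda>(i, y). H q i y) ` ?I"
    proof
      fix h assume "h \<in> HH (Suc q)"
      then obtain q' i y where h: "h = H q' i y" "q' < Suc q" "i \<le> m" "y \<in> ?G"
        unfolding HH_def by blast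
      show "h \<in> ?A \<union> (\<lambda>(i, y). H q i y) ` ?I"
      proof (cases "q' = q")
        case True
        then show ?thesis using h by (intro UnI2 image_eqI[of _ _ "(i, y)"]) auto
      next
        case False
        then show ?thesis using h HH_I[of q' q i y] by simp
      qed
    qed
    ultimately show ?thesis by (rule derivable_mono[OF _ order_refl _ order_refl])
  qed
  have s4: "derivable k (A2 \<union> HH (Suc m)) (HH (Suc m + t)) (t * E)" if "m + t \<le> dd" for t
    using that
  proof (induction t)
    case 0
    then show ?case by (simp add: derivable_refl)
  next
    case (Suc t)
    have "derivable k (A2 \<union> HH (Suc m) \<union> HH (Suc m + t)) (HH (Suc (Suc m + t))) E"
      by (rule derivable_mono[OF s3[of "Suc m + t"]]) (use Suc.prems in auto)
    moreover have "derivable k (A2 \<union> HH (Suc m)) (HH (Suc m + t)) (t * E)"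
      using Suc by simp
    ultimately have "derivable k (A2 \<union> HH (Suc m)) (HH (Suc (Suc m + t))) (t * E + E)"
      by (intro derivable_seq)
    then show ?case by (simp add: add.commute)
  qed
  have s4': "derivable k (A2 \<union> HH (Suc m)) (HH (Suc dd)) (dd * E)"
  proof (cases "m \<le> dd")
    case True
    show ?thesis
      by (rule derivable_mono[OF s4[of "dd - m"]]) (use True in auto)
  next
    case False
    \<comment> \<open>If \<open>dd < m\<close>, the initial values already cover every
      degree.\<close>
    then have "HH (Suc dd) \<subseteq> HH (Suc m)" by (intro HH_mono) auto
    then show ?thesis by (intro derivable_mono[OF derivable_refl[of "HH (Suc dd)"]]) auto
  qed
  \<comment> \<open>Order 0 does not see the direction, so any grid point \<open>y0\<close> serves;
    the homogeneous parts at the displacement add up to \<open>Q\<close> at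
    \<open>X\<close>.\<close>
  have s5: "derivable k (HH (Suc dd)) {\<lambda>x. mpoly_eval (\<lambda>v. X v x) Q} 1"
  proof (rule derivable_step)
    have "mpoly_eval (\<lambda>v. X v x) Q = (\<Sum>q\<le>dd. 1 * H q 0 y0 x)" for x
      using Delta_shift1[OF Q(1), of 0 a "\<lambda>v. Z v x" y0] by (simp add: Delta_0 H_def Z_def)
    moreover have "gate_step k (HH (Suc dd)) (\<lambda>x. \<Sum>q\<le>dd. 1 * H q 0 y0 x)"
      by (rule gate_step_sum) (auto intro!: HH_I y0)
    ultimately show "gate_step k (HH (Suc dd)) (\<lambda>x. mpoly_eval (\<lambda>v. X v x) Q)" by simp
  qed
  have "derivable k (A2 \<union> HH (Suc m)) {\<lambda>x. mpoly_eval (\<lambda>v. X v x) Q} (dd * E + 1)"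
    by (rule derivable_seq[OF s4']) (rule derivable_mono[OF s5], auto)
  then have "derivable k (A1 \<union> L ` ?G) {\<lambda>x. mpoly_eval (\<lambda>v. X v x) Q}
      ((Suc m * Suc m * N + Suc m * N * N) + (dd * E + 1))"
    by (intro derivable_seq[OF s2], elim derivable_mono) (auto simp: A2_def)
  then have "derivable k A1 {\<lambda>x. mpoly_eval (\<lambda>v. X v x) Q}
      ((K * Suc m + N) + ((Suc m * Suc m * N + Suc m * N * N) + (dd * E + 1)))"
    by (rule derivable_seq[OF s1])
  then have "derivable k A {\<lambda>x. mpoly_eval (\<lambda>v. X v x) Q}
      ((1 + K) + ((K * Suc m + N) + ((Suc m * Suc m * N + Suc m * N * N) + (dd * E + 1))))"
    unfolding A1_def by (rule derivable_seq[OF s0])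
  then show ?thesis by (simp only: add.assoc E_def)
qed

section \<open>Composable WHILE programs\<close>

fun texp_bound :: "texp \<Rightarrow> nat" where
  "texp_bound (Get x) = Suc x"
| "texp_bound LeafE = 0"
| "texp_bound (NodeE e1 e2) = max (texp_bound e1) (texp_bound e2)"
| "texp_bound (LeftE e) = texp_bound e"
| "texp_bound (RightE e) = texp_bound e"

fun prog_bound :: "prog \<Rightarrow> nat" where
  "prog_bound Skip = 0"
| "prog_bound (Assign x e) = max (Suc x) (texp_bound e)"
| "prog_bound (Seq c1 c2) = max (prog_bound c1) (prog_bound c2)"
| "prog_bound (If e c1 c2) = max (texp_bound e) (max (prog_bound c1) (prog_bound c2))"
| "prog_bound (While e c) = max (texp_bound e) (prog_bound c)"

lemma texp_value_cong:
  "(\<And>v. v < texp_bound e \<Longrightarrow> \<sigma> v = \<sigma>' v) \<Longrightarrow> texp_value e \<sigma> = texp_value e \<sigma>'"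
  by (induction e) auto

text \<open>Transports a run from the blank state of \<open>outputs_in_time\<close> to states in
  which higher variables are in use.\<close>

lemma exec_frame:
  assumes "exec p \<sigma> t \<tau>" "prog_bound p \<le> n" "\<And>v. v < n \<Longrightarrow> \<sigma>' v = \<sigma> v"
  shows "exec p \<sigma>' t (\<lambda>v. if v < n then \<tau> v else \<sigma>' v)"
  using assms
proof (induction arbitrary: \<sigma>' rule: exec.induct)
  case (exec_Skip \<sigma>)
  then have "(\<lambda>v. if v < n then \<sigma> v else \<sigma>' v) = \<sigma>'" by auto
  then show ?case by (simp only: exec.exec_Skip)
next
  case (exec_Assign x e \<sigma>)
  have "texp_value e \<sigma>' = texp_value e \<sigma>"
    using exec_Assign by (intro texp_value_cong) auto
  moreover have "(\<lambda>v. if v < n then (\<sigma>(x := texp_value e \<sigma>)) v else \<sigma>' v) = \<sigma>'(x := texp_value e \<sigma>)"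
    using exec_Assign by auto
  ultimately show ?case by (metis exec.exec_Assign)
next
  case (exec_Seq c1 \<sigma> t1 \<sigma>1 c2 t2 \<sigma>2)
  let ?s = "\<lambda>v. if v < n then \<sigma>1 v else \<sigma>' v"
  have "exec c1 \<sigma>' t1 ?s" using exec_Seq by auto
  moreover have "exec c2 ?s t2 (\<lambda>v. if v < n then \<sigma>2 v else ?s v)" using exec_Seq.prems exec_Seq.IH(2)[of ?s] by auto
  moreover have "(\<lambda>v. if v < n then \<sigma>2 v else ?s v) = (\<lambda>v. if v < n then \<sigma>2 v else \<sigma>' v)" by auto
  ultimately show ?case by (metis exec.exec_Seq)
next
  case (exec_If_True e \<sigma> c1 t \<sigma>1 c2)
  have "texp_value e \<sigma>' = texp_value e \<sigma>" using exec_If_True by (intro texp_value_cong) auto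
  then show ?case using exec_If_True by (auto intro!: exec.exec_If_True)
next
  case (exec_If_False e \<sigma> c2 t \<sigma>1 c1)
  have "texp_value e \<sigma>' = texp_value e \<sigma>" using exec_If_False by (intro texp_value_cong) auto
  then show ?case using exec_If_False by (auto intro!: exec.exec_If_False)
next
  case (exec_While_False e \<sigma> c)
  have "texp_value e \<sigma>' = texp_value e \<sigma>" using exec_While_False by (intro texp_value_cong) auto
  moreover have "(\<lambda>v. if v < n then \<sigma> v else \<sigma>' v) = \<sigma>'" using exec_While_False by auto
  ultimately show ?case using exec_While_False exec.exec_While_False[of e \<sigma>' c] by simp
next
  case (exec_While_True e \<sigma> c t1 \<sigma>1 t2 \<sigma>2)
  let ?s = "\<lambda>v. if v < n then \<sigma>1 v else \<sigma>' v"
  have "texp_value e \<sigma>' = texp_value e \<sigma>" using exec_While_True by (intro texp_value_cong) auto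
  then have "texp_value e \<sigma>' \<noteq> Leaf" using exec_While_True by simp
  moreover have "exec c \<sigma>' t1 ?s" using exec_While_True by auto
  moreover have "exec (While e c) ?s t2 (\<lambda>v. if v < n then \<sigma>2 v else ?s v)"
    using exec_While_True.prems exec_While_True.IH(2)[of ?s] by auto
  moreover have "(\<lambda>v. if v < n then \<sigma>2 v else ?s v) = (\<lambda>v. if v < n then \<sigma>2 v else \<sigma>' v)" by auto
  ultimately show ?case by (metis exec.exec_While_True)
qed

text \<open>Assignments are charged by the size of the stored value, so the running time bounds the
  growth of every variable.\<close>

lemma exec_size: "exec p \<sigma> t \<tau> \<Longrightarrow> size (\<tau> v) \<le> size (\<sigma> v) + t"
  by (induction rule: exec.induct) (auto simp: le_Suc_eq)

text \<open>Unlike \<open>outputs_in_time\<close>, such a run restores every variable except the input-output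
  variable 0, which makes programs composable.\<close>

definition runs :: "nat \<Rightarrow> prog \<Rightarrow> tree \<Rightarrow> tree \<Rightarrow> nat \<Rightarrow> bool" where
  "runs N p x y t \<longleftrightarrow> (\<forall>\<sigma>. \<sigma> 0 = x \<and> (\<forall>v. 0 < v \<and> v < N \<longrightarrow> \<sigma> v = Leaf) \<longrightarrow> exec p \<sigma> t (\<sigma>(0 := y)))"

lemma runsD: "runs N p x y t \<Longrightarrow> \<sigma> 0 = x \<Longrightarrow> (\<And>v. 0 < v \<Longrightarrow> v < N \<Longrightarrow> \<sigma> v = Leaf) \<Longrightarrow> exec p \<sigma> t (\<sigma>(0 := y))"
  unfolding runs_def by blast

lemma runs_mono: "runs N p x y t \<Longrightarrow> N \<le> N' \<Longrightarrow> runs N' p x y t"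
  by (simp add: runs_def)

lemma runs_outputs: "runs N p x y t \<Longrightarrow> outputs_in_time p x y t"
  unfolding outputs_in_time_def by (drule runsD[where \<sigma> = "(\<lambda>_. Leaf)(0 := x)"]) auto

lemma runs_size: "runs N p x y t \<Longrightarrow> size y \<le> size x + t"
  by (drule runsD[where \<sigma> = "(\<lambda>_. Leaf)(0 := x)"]) (auto dest: exec_size[where v = 0])

fun clear :: "nat \<Rightarrow> prog" where
  "clear 0 = Skip"
| "clear (Suc n) = Seq (clear n) (Assign (Suc n) LeafE)"

lemma exec_clear: "exec (clear n) \<sigma> (Suc n) (\<lambda>v. if 0 < v \<and> v \<le> n then Leaf else \<sigma> v)"
proof (induction n)
  case 0
  have "(\<lambda>v. if 0 < v \<and> v \<le> 0 then Leaf else \<sigma> v) = \<sigma>" by auto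
  then show ?case using exec_Skip[of \<sigma>] by simp
next
  case (Suc n)
  have "exec (Assign (Suc n) LeafE) (\<lambda>v. if 0 < v \<and> v \<le> n then Leaf else \<sigma> v) 1
      ((\<lambda>v. if 0 < v \<and> v \<le> n then Leaf else \<sigma> v)(Suc n := Leaf))"
    using exec_Assign[of "Suc n" LeafE] by simp
  from exec_Seq[OF Suc this]
  have "exec (clear (Suc n)) \<sigma> (Suc n + 1) ((\<lambda>v. if 0 < v \<and> v \<le> n then Leaf else \<sigma> v)(Suc n := Leaf))" by simp
  moreover have "(\<lambda>v. if 0 < v \<and> v \<le> n then Leaf else \<sigma> v)(Suc n := Leaf) =
      (\<lambda>v. if 0 < v \<and> v \<le> Suc n then Leaf else \<sigma> v)" by auto
  ultimately show ?case by simp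
qed

text \<open>An algorithm given through \<open>outputs_in_time\<close> may leave its variables in any
  state; wiping those that occur in its text makes it composable.\<close>

lemma runs_of_outputs:
  assumes "outputs_in_time A x y t" "n = prog_bound A"
  shows "runs (Suc n) (Seq A (clear n)) x y (t + Suc n)"
  unfolding runs_def
proof (intro allI impI)
  fix \<sigma> :: tstate assume \<sigma>: "\<sigma> 0 = x \<and> (\<forall>v. 0 < v \<and> v < Suc n \<longrightarrow> \<sigma> v = Leaf)"
  obtain \<tau> where \<tau>: "exec A ((\<lambda>_. Leaf)(0 := x)) t \<tau>" "\<tau> 0 = y"
    using assms(1) unfolding outputs_in_time_def by blast
  let ?s = "\<lambda>v. if v < Suc n then \<tau> v else \<sigma> v"
  have "exec A \<sigma> t ?s"
    by (rule exec_frame[OF \<tau>(1)]) (use \<sigma> assms(2) in auto)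
  from exec_Seq[OF this exec_clear]
  have "exec (Seq A (clear n)) \<sigma> (t + Suc n) (\<lambda>v. if 0 < v \<and> v \<le> n then Leaf else ?s v)" .
  moreover have "(\<lambda>v. if 0 < v \<and> v \<le> n then Leaf else ?s v) = \<sigma>(0 := y)"
    using \<sigma> \<tau>(2) by (auto simp: fun_eq_iff)
  ultimately show "exec (Seq A (clear n)) \<sigma> (t + Suc n) (\<sigma>(0 := y))" by simp
qed

section \<open>Program combinators\<close>

lemma runs_expr:
  assumes "texp_bound e \<le> 1"
  shows "runs N (Assign 0 e) x (texp_value e (\<lambda>_. x)) (Suc (size (texp_value e (\<lambda>_. x))))"
  unfolding runs_def
proof (intro allI impI)
  fix \<sigma> :: tstate assume "\<sigma> 0 = x \<and> (\<forall>v. 0 < v \<and> v < N \<longrightarrow> \<sigma> v = Leaf)"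
  moreover have "v = 0" if "v < texp_bound e" for v using that assms by linarith
  ultimately have "texp_value e \<sigma> = texp_value e (\<lambda>_. x)" by (intro texp_value_cong) auto
  then show "exec (Assign 0 e) \<sigma> (Suc (size (texp_value e (\<lambda>_. x)))) (\<sigma>(0 := texp_value e (\<lambda>_. x)))"
    using exec_Assign[of 0 e \<sigma>] by simp
qed

lemma runs_seq:
  assumes "runs N p x y t1" "runs N q y z t2"
  shows "runs N (Seq p q) x z (t1 + t2)"
  unfolding runs_def
proof (intro allI impI)
  fix \<sigma> :: tstate assume \<sigma>: "\<sigma> 0 = x \<and> (\<forall>v. 0 < v \<and> v < N \<longrightarrow> \<sigma> v = Leaf)"
  have "exec p \<sigma> t1 (\<sigma>(0 := y))" by (rule runsD[OF assms(1)]) (use \<sigma> in auto)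
  moreover have "exec q (\<sigma>(0 := y)) t2 ((\<sigma>(0 := y))(0 := z))"
    by (rule runsD[OF assms(2)]) (use \<sigma> in auto)
  ultimately show "exec (Seq p q) \<sigma> (t1 + t2) (\<sigma>(0 := z))" by (auto dest: exec_Seq)
qed

text \<open>Under \<open>runs N\<close> both subprograms leave the variables \<open>N\<close> and
  \<open>Suc N\<close> unchanged; these hold the saved input and the first result.\<close>

definition pair_prog :: "nat \<Rightarrow> prog \<Rightarrow> prog \<Rightarrow> prog" where
  "pair_prog N p q = Seq (Assign N (Get 0)) (Seq p (Seq (Assign (Suc N) (Get 0)) (Seq (Assign 0 (Get N))
     (Seq q (Seq (Assign 0 (NodeE (Get (Suc N)) (Get 0))) (Seq (Assign N LeafE) (Assign (Suc N) LeafE)))))))"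

lemma exec_AssignI: "texp_value e \<sigma> = w \<Longrightarrow> t = Suc (size w) \<Longrightarrow> \<sigma>' = \<sigma>(x := w) \<Longrightarrow> exec (Assign x e) \<sigma> t \<sigma>'"
  using exec_Assign[of x e \<sigma>] by simp

lemma runs_pair:
  assumes "runs N p x y t1" "runs N q x z t2" "N \<ge> 1"
  shows "runs (N + 2) (pair_prog N p q) x (Node y z)
    (t1 + t2 + (2 * size x + 2 * size y + size z + 7))"
  unfolding runs_def
proof (intro allI impI)
  fix \<sigma> :: tstate assume \<sigma>: "\<sigma> 0 = x \<and> (\<forall>v. 0 < v \<and> v < N + 2 \<longrightarrow> \<sigma> v = Leaf)"
  have N: "N \<noteq> 0" "Suc N \<noteq> 0" "Suc N \<noteq> N" using assms(3) by auto
  have s: "\<sigma> N = Leaf" "\<sigma> (Suc N) = Leaf" using \<sigma> N by auto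
  let ?s1 = "\<sigma>(N := x)"
  let ?s2 = "?s1(0 := y)"
  let ?s3 = "?s2(Suc N := y)"
  let ?s4 = "?s3(0 := x)"
  let ?s5 = "?s4(0 := z)"
  let ?s6 = "?s5(0 := Node y z)"
  let ?s7 = "?s6(N := Leaf)"
  let ?s8 = "?s7(Suc N := Leaf)"
  have e1: "exec (Assign N (Get 0)) \<sigma> (Suc (size x)) ?s1" using \<sigma> by (intro exec_AssignI[where w = x]) auto
  have e2: "exec p ?s1 t1 ?s2" by (rule runsD[OF assms(1)]) (use \<sigma> N in auto)
  have e3: "exec (Assign (Suc N) (Get 0)) ?s2 (Suc (size y)) ?s3" by (intro exec_AssignI[where w = y]) auto
  have e4: "exec (Assign 0 (Get N)) ?s3 (Suc (size x)) ?s4" using N by (intro exec_AssignI[where w = x]) auto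
  have e5: "exec q ?s4 t2 ?s5" by (rule runsD[OF assms(2)]) (use \<sigma> N in auto)
  have e6: "exec (Assign 0 (NodeE (Get (Suc N)) (Get 0))) ?s5 (Suc (size (Node y z))) ?s6"
    using N by (intro exec_AssignI[where w = "Node y z"]) auto
  have e7: "exec (Assign N LeafE) ?s6 1 ?s7" by (intro exec_AssignI[where w = Leaf]) auto
  have e8: "exec (Assign (Suc N) LeafE) ?s7 1 ?s8" by (intro exec_AssignI[where w = Leaf]) auto
  have "exec (pair_prog N p q) \<sigma> (Suc (size x) + (t1 + (Suc (size y) + (Suc (size x) +
      (t2 + (Suc (size (Node y z)) + (1 + 1))))))) ?s8"
    unfolding pair_prog_def by (intro exec_Seq[OF e1] exec_Seq[OF e2] exec_Seq[OF e3] exec_Seq[OF e4]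
        exec_Seq[OF e5] exec_Seq[OF e6] exec_Seq[OF e7] e8)
  moreover have "?s8 = \<sigma>(0 := Node y z)" using N s by (auto simp: fun_eq_iff)
  moreover have "Suc (size x) + (t1 + (Suc (size y) + (Suc (size x) +
      (t2 + (Suc (size (Node y z)) + (1 + 1)))))) = t1 + t2 + (2 * size x + 2 * size y + size z + 7)" by simp
  ultimately show "exec (pair_prog N p q) \<sigma> (t1 + t2 + (2 * size x + 2 * size y + size z + 7)) (\<sigma>(0 := Node y z))"
    by (simp only:)
qed

definition if_prog :: "nat \<Rightarrow> prog \<Rightarrow> prog \<Rightarrow> prog \<Rightarrow> prog" where
  "if_prog N b p q = Seq (Assign N (Get 0)) (Seq b (Seq (Assign (Suc N) (Get 0)) (Seq (Assign 0 (Get N))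
     (Seq (Assign N LeafE) (If (Get (Suc N)) (Seq (Assign (Suc N) LeafE) p) q)))))"

lemma runs_if:
  assumes "runs N b x c t1" "c \<noteq> Leaf \<Longrightarrow> runs N p x y t2" "c = Leaf \<Longrightarrow> runs N q x y t2" "N \<ge> 1"
  shows "runs (N + 2) (if_prog N b p q) x y
    (t1 + t2 + (2 * size x + size c + 5 + (if c = Leaf then 0 else 1)))"
  unfolding runs_def
proof (intro allI impI)
  fix \<sigma> :: tstate assume \<sigma>: "\<sigma> 0 = x \<and> (\<forall>v. 0 < v \<and> v < N + 2 \<longrightarrow> \<sigma> v = Leaf)"
  have N: "N \<noteq> 0" "Suc N \<noteq> 0" "Suc N \<noteq> N" using assms(4) by auto
  have s: "\<sigma> N = Leaf" "\<sigma> (Suc N) = Leaf" using \<sigma> N by auto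
  let ?s1 = "\<sigma>(N := x)"
  let ?s2 = "?s1(0 := c)"
  let ?s3 = "?s2(Suc N := c)"
  let ?s4 = "?s3(0 := x)"
  let ?s5 = "?s4(N := Leaf)"
  have s5: "?s5 = \<sigma>(Suc N := c)" using N s \<sigma> by (auto simp: fun_eq_iff)
  have e1: "exec (Assign N (Get 0)) \<sigma> (Suc (size x)) ?s1" using \<sigma> by (intro exec_AssignI[where w = x]) auto
  have e2: "exec b ?s1 t1 ?s2" by (rule runsD[OF assms(1)]) (use \<sigma> N in auto)
  have e3: "exec (Assign (Suc N) (Get 0)) ?s2 (Suc (size c)) ?s3" by (intro exec_AssignI[where w = c]) auto
  have e4: "exec (Assign 0 (Get N)) ?s3 (Suc (size x)) ?s4" using N by (intro exec_AssignI[where w = x]) auto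
  have e5: "exec (Assign N LeafE) ?s4 1 ?s5" by (intro exec_AssignI[where w = Leaf]) auto
  have e6: "exec (If (Get (Suc N)) (Seq (Assign (Suc N) LeafE) p) q) ?s5 (Suc (t2 + (if c = Leaf then 0 else 1))) (\<sigma>(0 := y))"
  proof (cases "c = Leaf")
    case True
    have s': "?s5 = \<sigma>" unfolding s5 using True s by (auto simp: fun_eq_iff)
    have "exec q \<sigma> t2 (\<sigma>(0 := y))" by (rule runsD[OF assms(3)]) (use True \<sigma> N in auto)
    then have "exec (If (Get (Suc N)) (Seq (Assign (Suc N) LeafE) p) q) \<sigma> (Suc t2) (\<sigma>(0 := y))"
      by (intro exec_If_False) (use s in auto)
    then show ?thesis unfolding s' using True by simp
  next
    case False
    have "exec (Assign (Suc N) LeafE) (\<sigma>(Suc N := c)) 1 \<sigma>"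
      using s by (intro exec_AssignI[where w = Leaf]) (auto simp: fun_eq_iff)
    moreover have "exec p \<sigma> t2 (\<sigma>(0 := y))" by (rule runsD[OF assms(2)]) (use False \<sigma> N in auto)
    ultimately have "exec (If (Get (Suc N)) (Seq (Assign (Suc N) LeafE) p) q) (\<sigma>(Suc N := c)) (Suc (1 + t2)) (\<sigma>(0 := y))"
      using False by (intro exec_If_True exec_Seq) auto
    then show ?thesis unfolding s5 using False by simp
  qed
  have "exec (if_prog N b p q) \<sigma> (Suc (size x) + (t1 + (Suc (size c) + (Suc (size x) +
      (1 + Suc (t2 + (if c = Leaf then 0 else 1))))))) (\<sigma>(0 := y))"
    unfolding if_prog_def by (intro exec_Seq[OF e1] exec_Seq[OF e2] exec_Seq[OF e3] exec_Seq[OF e4]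
        exec_Seq[OF e5] e6)
  then show "exec (if_prog N b p q) \<sigma> (t1 + t2 + (2 * size x + size c + 5 + (if c = Leaf then 0 else 1))) (\<sigma>(0 := y))"
    by (simp add: algebra_simps numeral_eq_Suc)
qed

text \<open>The loop state carries its continuation flag as left component, which is how the search
  for the degree will stop.\<close>

lemma runs_while:
  assumes "\<And>i. i < n \<Longrightarrow> runs N p (x i) (x (Suc i)) (t i)"
    and "\<And>i. i < n \<Longrightarrow> left_of (x i) \<noteq> Leaf" "left_of (x n) = Leaf"
  shows "runs N (While (LeftE (Get 0)) p) (x 0) (x n) ((\<Sum>i<n. Suc (t i)) + 1)"
  using assms
proof (induction n arbitrary: x t)
  case 0
  show ?case unfolding runs_def
  proof (intro allI impI)
    fix \<sigma> :: tstate assume \<sigma>: "\<sigma> 0 = x 0 \<and> (\<forall>v. 0 < v \<and> v < N \<longrightarrow> \<sigma> v = Leaf)"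
    then have "exec (While (LeftE (Get 0)) p) \<sigma> 1 \<sigma>" using 0 by (intro exec_While_False) auto
    moreover have "\<sigma>(0 := x 0) = \<sigma>" using \<sigma> by auto
    ultimately show "exec (While (LeftE (Get 0)) p) \<sigma> ((\<Sum>i<0. Suc (t i)) + 1) (\<sigma>(0 := x 0))" by simp
  qed
next
  case (Suc n)
  have IH: "runs N (While (LeftE (Get 0)) p) (x (Suc 0)) (x (Suc n)) ((\<Sum>i<n. Suc (t (Suc i))) + 1)"
    using Suc.IH[of "\<lambda>i. x (Suc i)" "\<lambda>i. t (Suc i)"] Suc.prems by simp
  have body: "runs N p (x 0) (x (Suc 0)) (t 0)" using Suc.prems(1)[of 0] by simp
  have sum: "(\<Sum>i<Suc n. Suc (t i)) = Suc (t 0) + (\<Sum>i<n. Suc (t (Suc i)))"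
    by (rule sum.lessThan_Suc_shift)
  show ?case unfolding runs_def
  proof (intro allI impI)
    fix \<sigma> :: tstate assume \<sigma>: "\<sigma> 0 = x 0 \<and> (\<forall>v. 0 < v \<and> v < N \<longrightarrow> \<sigma> v = Leaf)"
    have "exec p \<sigma> (t 0) (\<sigma>(0 := x (Suc 0)))" by (rule runsD[OF body]) (use \<sigma> in auto)
    moreover have "exec (While (LeftE (Get 0)) p) (\<sigma>(0 := x (Suc 0))) ((\<Sum>i<n. Suc (t (Suc i))) + 1)
        ((\<sigma>(0 := x (Suc 0)))(0 := x (Suc n)))"
      by (rule runsD[OF IH]) (use \<sigma> in auto)
    ultimately have "exec (While (LeftE (Get 0)) p) \<sigma> (Suc (t 0 + ((\<Sum>i<n. Suc (t (Suc i))) + 1)))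
        ((\<sigma>(0 := x (Suc 0)))(0 := x (Suc n)))"
      using \<sigma> Suc.prems(2)[of 0] by (intro exec_While_True) auto
    then show "exec (While (LeftE (Get 0)) p) \<sigma> ((\<Sum>i<Suc n. Suc (t i)) + 1) (\<sigma>(0 := x (Suc n)))"
      unfolding sum by simp
  qed
qed

section \<open>Polynomial time\<close>

text \<open>A single constant serves as factor and exponent, and \<open>Suc n\<close> avoids the
  base 0.\<close>

definition polyb :: "(nat \<Rightarrow> nat) \<Rightarrow> bool" where
  "polyb T \<longleftrightarrow> (\<exists>a. \<forall>n. T n \<le> a * Suc n ^ a)"

lemma polyb_le: "polyb T \<Longrightarrow> (\<And>n. S n \<le> T n) \<Longrightarrow> polyb S"
  unfolding polyb_def by (meson order.trans)

lemma poly_bound_mono: "a \<le> b \<Longrightarrow> m \<le> n \<Longrightarrow> a * Suc m ^ a \<le> b * Suc n ^ b" for a b m n :: nat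
  by (intro mult_mono) (auto intro: order.trans[OF power_mono power_increasing])

lemma polyb_const [intro]: "polyb (\<lambda>n. c)"
proof -
  have "c \<le> c * Suc n ^ c" for n by simp
  then show ?thesis unfolding polyb_def by blast
qed

lemma polyb_id [intro]: "polyb (\<lambda>n. n)"
  unfolding polyb_def by (rule exI[of _ 1]) simp

lemma polyb_add [intro]: "polyb S \<Longrightarrow> polyb T \<Longrightarrow> polyb (\<lambda>n. S n + T n)"
proof -
  assume "polyb S" "polyb T"
  then obtain a b where ab: "\<And>n. S n \<le> a * Suc n ^ a" "\<And>n. T n \<le> b * Suc n ^ b"
    unfolding polyb_def by blast
  have "S n + T n \<le> (a + b) * Suc n ^ (a + b)" for n
  proof -
    have "a * Suc n ^ a \<le> a * Suc n ^ (a + b)" "b * Suc n ^ b \<le> b * Suc n ^ (a + b)"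
      by (intro mult_left_mono power_increasing; simp)+
    then show ?thesis using ab[of n] unfolding distrib_right by linarith
  qed
  then show ?thesis unfolding polyb_def by blast
qed

lemma polyb_mult [intro]: "polyb S \<Longrightarrow> polyb T \<Longrightarrow> polyb (\<lambda>n. S n * T n)"
proof -
  assume "polyb S" "polyb T"
  then obtain a b where ab: "\<And>n. S n \<le> a * Suc n ^ a" "\<And>n. T n \<le> b * Suc n ^ b"
    unfolding polyb_def by blast
  have "S n * T n \<le> (a * b + a + b) * Suc n ^ (a * b + a + b)" for n
  proof -
    have "S n * T n \<le> (a * Suc n ^ a) * (b * Suc n ^ b)" using ab by (intro mult_mono) auto
    also have "\<dots> = a * b * Suc n ^ (a + b)" by (simp add: power_add)
    also have "\<dots> \<le> (a * b + a + b) * Suc n ^ (a * b + a + b)"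
      by (intro mult_mono power_increasing) auto
    finally show ?thesis .
  qed
  then show ?thesis unfolding polyb_def by blast
qed

lemma polyb_Suc [intro]: "polyb T \<Longrightarrow> polyb (\<lambda>n. Suc (T n))"
  using polyb_add[of T "\<lambda>_. 1"] by auto

lemma polyb_power [intro]: "polyb T \<Longrightarrow> polyb (\<lambda>n. T n ^ c)"
  by (induction c) auto

lemmas polyb_intros = polyb_add polyb_mult polyb_power polyb_Suc polyb_const polyb_id

text \<open>Polynomial time relative to encodings of input and output. The closure lemmas for
  \<open>pt\<close> amount to a small functional language, in which the generator and the point list
  are later written.\<close>

definition pt :: "('b \<Rightarrow> tree) \<Rightarrow> ('c \<Rightarrow> tree) \<Rightarrow> ('b \<Rightarrow> 'c) \<Rightarrow> bool" where
  "pt e1 e2 f \<longleftrightarrow> (\<exists>N p a. \<forall>x. \<exists>t \<le> a * Suc (size (e1 x)) ^ a. runs N p (e1 x) (e2 (f x)) t)"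

lemma ptI:
  assumes "polyb T" "\<And>x. \<exists>t \<le> T (size (e1 x)). runs N p (e1 x) (e2 (f x)) t"
  shows "pt e1 e2 f"
proof -
  obtain a where "\<And>n. T n \<le> a * Suc n ^ a" using assms(1) unfolding polyb_def by blast
  then show ?thesis unfolding pt_def using assms(2) by (meson order.trans)
qed

text \<open>The size bound follows from the time bound and is what compositions rely on;
  \<open>N \<ge> 1\<close> keeps scratch variables apart from variable 0.\<close>

lemma ptE:
  assumes "pt e1 e2 f"
  obtains N p a where "N \<ge> 1"
    "\<And>x. \<exists>t \<le> a * Suc (size (e1 x)) ^ a. runs N p (e1 x) (e2 (f x)) t"
    "\<And>x. size (e2 (f x)) \<le> size (e1 x) + a * Suc (size (e1 x)) ^ a"
proof -
  obtain N p a where 1: "\<And>x. \<exists>t \<le> a * Suc (size (e1 x)) ^ a. runs N p (e1 x) (e2 (f x)) t"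
    using assms unfolding pt_def by blast
  have 2: "\<exists>t \<le> a * Suc (size (e1 x)) ^ a. runs (max 1 N) p (e1 x) (e2 (f x)) t" for x
    using 1[of x] runs_mono by (meson max.cobounded2)
  have 3: "size (e2 (f x)) \<le> size (e1 x) + a * Suc (size (e1 x)) ^ a" for x
    using 1[of x] by (meson runs_size add_left_mono order.trans)
  show ?thesis by (rule that[OF _ 2 3]) simp
qed

lemma pt_size: "pt e1 e2 f \<Longrightarrow> \<exists>B. polyb B \<and> mono B \<and> (\<forall>x. size (e2 (f x)) \<le> B (size (e1 x)))"
proof -
  assume "pt e1 e2 f"
  then obtain a where a: "\<And>x. size (e2 (f x)) \<le> size (e1 x) + a * Suc (size (e1 x)) ^ a"
    by (rule ptE) blast
  have "polyb (\<lambda>n. n + a * Suc n ^ a)" by (intro polyb_intros)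
  moreover have "mono (\<lambda>n. n + a * Suc n ^ a)" by (intro monoI add_mono poly_bound_mono) auto
  ultimately show ?thesis using a by (intro exI[of _ "\<lambda>n. n + a * Suc n ^ a"]) simp
qed

lemma pt_comp:
  assumes "pt e1 e2 f" "pt e2 e3 g"
  shows "pt e1 e3 (\<lambda>x. g (f x))"
proof -
  obtain N p a where f: "N \<ge> 1"
    "\<And>x. \<exists>t \<le> a * Suc (size (e1 x)) ^ a. runs N p (e1 x) (e2 (f x)) t"
    "\<And>x. size (e2 (f x)) \<le> size (e1 x) + a * Suc (size (e1 x)) ^ a"
    using assms(1) by (rule ptE) blast
  obtain M q b where g: "\<And>x. \<exists>t \<le> b * Suc (size (e2 x)) ^ b. runs M q (e2 x) (e3 (g x)) t"
    using assms(2) by (rule ptE) blast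
  let ?T = "\<lambda>n. a * Suc n ^ a + b * Suc (n + a * Suc n ^ a) ^ b"
  show ?thesis
  proof (rule ptI[of ?T])
    show "polyb ?T" by (intro polyb_intros)
    fix x
    obtain t1 where t1: "t1 \<le> a * Suc (size (e1 x)) ^ a" "runs N p (e1 x) (e2 (f x)) t1" using f by blast
    obtain t2 where t2: "t2 \<le> b * Suc (size (e2 (f x))) ^ b" "runs M q (e2 (f x)) (e3 (g (f x))) t2" using g by blast
    have "t1 + t2 \<le> ?T (size (e1 x))"
      using t1(1) t2(1) poly_bound_mono[OF order_refl f(3)[of x], of b] by linarith
    moreover have "runs (max N M) (Seq p q) (e1 x) (e3 (g (f x))) (t1 + t2)"
      by (rule runs_seq[OF runs_mono[OF t1(2)] runs_mono[OF t2(2)]]) auto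
    ultimately show "\<exists>t\<le>?T (size (e1 x)). runs (max N M) (Seq p q) (e1 x) (e3 (g (f x))) t" by blast
  qed
qed

section \<open>Pairs, constants and branching in polynomial time\<close>

definition enc_pair :: "('b \<Rightarrow> tree) \<Rightarrow> ('c \<Rightarrow> tree) \<Rightarrow> 'b \<times> 'c \<Rightarrow> tree" where
  "enc_pair e1 e2 p = Node (e1 (fst p)) (e2 (snd p))"

lemma size_enc_pair [simp]: "size (enc_pair e1 e2 p) = size (e1 (fst p)) + size (e2 (snd p)) + 1"
  by (simp add: enc_pair_def)

lemma pt_pair:
  assumes "pt e e1 f" "pt e e2 g"
  shows "pt e (enc_pair e1 e2) (\<lambda>x. (f x, g x))"
proof -
  obtain N p a where f: "N \<ge> 1"
    "\<And>x. \<exists>t \<le> a * Suc (size (e x)) ^ a. runs N p (e x) (e1 (f x)) t"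
    "\<And>x. size (e1 (f x)) \<le> size (e x) + a * Suc (size (e x)) ^ a"
    using assms(1) by (rule ptE) blast
  obtain M q b where g: "\<And>x. \<exists>t \<le> b * Suc (size (e x)) ^ b. runs M q (e x) (e2 (g x)) t"
    "\<And>x. size (e2 (g x)) \<le> size (e x) + b * Suc (size (e x)) ^ b"
    using assms(2) by (rule ptE) blast
  let ?T = "\<lambda>n. a * Suc n ^ a + b * Suc n ^ b + (2 * n + 2 * (n + a * Suc n ^ a) + (n + b * Suc n ^ b) + 7)"
  show ?thesis
  proof (rule ptI[of ?T])
    show "polyb ?T" by (intro polyb_intros)
    fix x
    obtain t1 where t1: "t1 \<le> a * Suc (size (e x)) ^ a" "runs N p (e x) (e1 (f x)) t1" using f by blast
    obtain t2 where t2: "t2 \<le> b * Suc (size (e x)) ^ b" "runs M q (e x) (e2 (g x)) t2" using g by blast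
    let ?N = "max N M"
    have "runs (?N + 2) (pair_prog ?N p q) (e x) (Node (e1 (f x)) (e2 (g x)))
        (t1 + t2 + (2 * size (e x) + 2 * size (e1 (f x)) + size (e2 (g x)) + 7))"
      by (rule runs_pair[OF runs_mono[OF t1(2)] runs_mono[OF t2(2)]]) (use f(1) in auto)
    moreover have "t1 + t2 + (2 * size (e x) + 2 * size (e1 (f x)) + size (e2 (g x)) + 7) \<le> ?T (size (e x))"
      using t1(1) t2(1) f(3)[of x] g(2)[of x] by (intro add_mono mult_left_mono) auto
    ultimately show "\<exists>t\<le>?T (size (e x)). runs (?N + 2) (pair_prog ?N p q) (e x) (enc_pair e1 e2 (f x, g x)) t"
      unfolding enc_pair_def[of e1] fst_conv snd_conv by blast
  qed
qed

lemma pt_expr: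
  assumes "texp_bound ex \<le> 1" "\<And>x. e2 (f x) = texp_value ex (\<lambda>_. e1 x)"
    and "polyb B" "\<And>x. size (e2 (f x)) \<le> B (size (e1 x))"
  shows "pt e1 e2 f"
proof (rule ptI[of "\<lambda>n. Suc (B n)"])
  fix x
  have "runs 1 (Assign 0 ex) (e1 x) (e2 (f x)) (Suc (size (e2 (f x))))"
    unfolding assms(2) by (rule runs_expr[OF assms(1)])
  then show "\<exists>t\<le>Suc (B (size (e1 x))). runs 1 (Assign 0 ex) (e1 x) (e2 (f x)) t"
    using assms(4) by auto
qed (use assms(3) in auto)

lemma pt_id: "pt e e (\<lambda>x. x)"
  by (rule pt_expr[of "Get 0" _ _ _ "\<lambda>n. n"]) auto

lemma pt_fst: "pt e (enc_pair e1 e2) f \<Longrightarrow> pt e e1 (\<lambda>x. fst (f x))"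
  by (rule pt_comp, assumption, rule pt_expr[of "LeftE (Get 0)" _ _ _ "\<lambda>n. n"]) (auto simp: enc_pair_def)

lemma pt_snd: "pt e (enc_pair e1 e2) f \<Longrightarrow> pt e e2 (\<lambda>x. snd (f x))"
  by (rule pt_comp, assumption, rule pt_expr[of "RightE (Get 0)" _ _ _ "\<lambda>n. n"]) (auto simp: enc_pair_def)

fun tree_texp :: "tree \<Rightarrow> texp" where
  "tree_texp Leaf = LeafE"
| "tree_texp (Node l r) = NodeE (tree_texp l) (tree_texp r)"

lemma texp_value_tree_texp [simp]: "texp_value (tree_texp t) \<sigma> = t"
  by (induction t) auto

lemma texp_bound_tree_texp [simp]: "texp_bound (tree_texp t) = 0"
  by (induction t) auto

lemma pt_const: "pt e e' (\<lambda>x. c)"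
  by (rule pt_expr[of "tree_texp (e' c)" _ _ _ "\<lambda>n. size (e' c)"]) auto

lemma pt_if:
  assumes "pt e eb b" "\<And>x. eb (b x) \<noteq> Leaf \<longleftrightarrow> P x" "pt e e2 f" "pt e e2 g"
  shows "pt e e2 (\<lambda>x. if P x then f x else g x)"
proof -
  obtain N0 p0 a0 where b: "N0 \<ge> 1"
    "\<And>x. \<exists>t \<le> a0 * Suc (size (e x)) ^ a0. runs N0 p0 (e x) (eb (b x)) t"
    "\<And>x. size (eb (b x)) \<le> size (e x) + a0 * Suc (size (e x)) ^ a0"
    using assms(1) by (rule ptE) blast
  obtain N1 p1 a1 where f: "\<And>x. \<exists>t \<le> a1 * Suc (size (e x)) ^ a1. runs N1 p1 (e x) (e2 (f x)) t"
    using assms(3) by (rule ptE) blast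
  obtain N2 p2 a2 where g: "\<And>x. \<exists>t \<le> a2 * Suc (size (e x)) ^ a2. runs N2 p2 (e x) (e2 (g x)) t"
    using assms(4) by (rule ptE) blast
  let ?T = "\<lambda>n. a0 * Suc n ^ a0 + (a1 * Suc n ^ a1 + a2 * Suc n ^ a2) + (2 * n + (n + a0 * Suc n ^ a0) + 5 + 1)"
  let ?N = "max N0 (max N1 N2)"
  show ?thesis
  proof (rule ptI[of ?T])
    show "polyb ?T" by (intro polyb_intros)
    fix x
    obtain t0 where t0: "t0 \<le> a0 * Suc (size (e x)) ^ a0" "runs N0 p0 (e x) (eb (b x)) t0" using b by blast
    obtain t1 where t1: "t1 \<le> a1 * Suc (size (e x)) ^ a1" "runs N1 p1 (e x) (e2 (f x)) t1" using f by blast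
    obtain t2 where t2: "t2 \<le> a2 * Suc (size (e x)) ^ a2" "runs N2 p2 (e x) (e2 (g x)) t2" using g by blast
    let ?t = "if P x then t1 else t2"
    have "runs (?N + 2) (if_prog ?N p0 p1 p2) (e x) (e2 (if P x then f x else g x))
        (t0 + ?t + (2 * size (e x) + size (eb (b x)) + 5 + (if eb (b x) = Leaf then 0 else 1)))"
      by (rule runs_if[OF runs_mono[OF t0(2)]])
        (use assms(2)[of x] runs_mono[OF t1(2), of ?N] runs_mono[OF t2(2), of ?N] b(1) in auto)
    moreover have "t0 + ?t + (2 * size (e x) + size (eb (b x)) + 5 + (if eb (b x) = Leaf then 0 else 1)) \<le> ?T (size (e x))"
      using t0(1) t1(1) t2(1) b(3)[of x] by (intro add_mono) auto
    ultimately show "\<exists>t\<le>?T (size (e x)). runs (?N + 2) (if_prog ?N p0 p1 p2) (e x) (e2 (if P x then f x else g x)) t"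
      by blast
  qed
qed

section \<open>Loops over lists\<close>

definition fold_body :: "nat \<Rightarrow> prog \<Rightarrow> prog" where
  "fold_body N p = Seq (Assign 0 (NodeE (LeftE (Get N)) (Get 0))) (Seq p (Assign N (RightE (Get N))))"

definition fold_prog :: "nat \<Rightarrow> prog \<Rightarrow> prog" where
  "fold_prog N p = Seq (Assign N (LeftE (Get 0))) (Seq (Assign 0 (RightE (Get 0))) (While (Get N) (fold_body N p)))"

lemma size_enc_list_ge: "length xs \<le> size (enc_list e xs)"
  by (induction xs) auto

lemma size_enc_list_mem: "x \<in> set xs \<Longrightarrow> size (e x) \<le> size (enc_list e xs)"
  by (induction xs) auto

text \<open>\<open>R\<close> bounds the time of each step and the size of each stored value; an
  iteration consists of a test, two assignments and the step, hence
  \<open>3 * R + 3\<close>.\<close>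

lemma exec_fold_loop:
  assumes "N \<ge> 1"
    and "\<And>i. i < length xs \<Longrightarrow> \<exists>t\<le>R. runs N p (Node (ex (xs ! i)) (ea (fold step (take i xs) acc)))
      (ea (fold step (take (Suc i) xs) acc)) t"
    and "\<And>i. i < length xs \<Longrightarrow> size (Node (ex (xs ! i)) (ea (fold step (take i xs) acc))) \<le> R"
    and "size (enc_list ex xs) \<le> R"
  shows "\<exists>t\<le>length xs * (3 * R + 3) + 1. \<forall>\<sigma>. \<sigma> N = enc_list ex xs \<and> \<sigma> 0 = ea acc \<and>
    (\<forall>v. 0 < v \<and> v < N \<longrightarrow> \<sigma> v = Leaf) \<longrightarrow>
    exec (While (Get N) (fold_body N p)) \<sigma> t (\<sigma>(0 := ea (fold step xs acc), N := Leaf))"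
  using assms
proof (induction xs arbitrary: acc)
  case Nil
  have "exec (While (Get N) (fold_body N p)) \<sigma> 1 (\<sigma>(0 := ea acc, N := Leaf))"
    if "\<sigma> N = Leaf" "\<sigma> 0 = ea acc" for \<sigma>
  proof -
    have "\<sigma>(0 := ea acc, N := Leaf) = \<sigma>" using that by auto
    moreover have "exec (While (Get N) (fold_body N p)) \<sigma> 1 \<sigma>" using that by (intro exec_While_False) auto
    ultimately show ?thesis by (simp only:)
  qed
  moreover have "1 \<le> length [] * (3 * R + 3) + 1" by simp
  ultimately show ?case unfolding fold_Nil id_apply enc_list.simps by blast
next
  case (Cons x xs)
  have N: "N \<noteq> 0" using Cons.prems(1) by auto
  let ?y = "ea (step x acc)"
  let ?in = "Node (ex x) (ea acc)"
  obtain t where t: "t \<le> R" "runs N p ?in ?y t" using Cons.prems(2)[of 0] by auto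
  have sz: "size ?in \<le> R" using Cons.prems(3)[of 0] by simp
  have "\<exists>t\<le>length xs * (3 * R + 3) + 1. \<forall>\<sigma>. \<sigma> N = enc_list ex xs \<and> \<sigma> 0 = ea (step x acc) \<and>
    (\<forall>v. 0 < v \<and> v < N \<longrightarrow> \<sigma> v = Leaf) \<longrightarrow>
    exec (While (Get N) (fold_body N p)) \<sigma> t (\<sigma>(0 := ea (fold step xs (step x acc)), N := Leaf))"
  proof (rule Cons.IH)
    fix i assume "i < length xs"
    then show "\<exists>t\<le>R. runs N p (Node (ex (xs ! i)) (ea (fold step (take i xs) (step x acc))))
      (ea (fold step (take (Suc i) xs) (step x acc))) t"
      "size (Node (ex (xs ! i)) (ea (fold step (take i xs) (step x acc)))) \<le> R"
      using Cons.prems(2)[of "Suc i"] Cons.prems(3)[of "Suc i"] by auto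
  qed (use Cons.prems in auto)
  then obtain t' where t': "t' \<le> length xs * (3 * R + 3) + 1"
    "\<And>\<sigma>. \<sigma> N = enc_list ex xs \<Longrightarrow> \<sigma> 0 = ?y \<Longrightarrow> (\<And>v. 0 < v \<Longrightarrow> v < N \<Longrightarrow> \<sigma> v = Leaf) \<Longrightarrow>
      exec (While (Get N) (fold_body N p)) \<sigma> t' (\<sigma>(0 := ea (fold step xs (step x acc)), N := Leaf))" by blast
  have "exec (While (Get N) (fold_body N p)) \<sigma>
      (Suc (Suc (size ?in) + (t + Suc (size (enc_list ex xs))) + t')) (\<sigma>(0 := ea (fold step (x # xs) acc), N := Leaf))"
    if \<sigma>: "\<sigma> N = enc_list ex (x # xs)" "\<sigma> 0 = ea acc" "\<forall>v. 0 < v \<and> v < N \<longrightarrow> \<sigma> v = Leaf" for \<sigma>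
  proof -
    let ?s1 = "\<sigma>(0 := ?in)"
    let ?s2 = "?s1(0 := ?y)"
    let ?s3 = "?s2(N := enc_list ex xs)"
    have e1: "exec (Assign 0 (NodeE (LeftE (Get N)) (Get 0))) \<sigma> (Suc (size ?in)) ?s1"
      using \<sigma> by (intro exec_AssignI[where w = ?in]) auto
    have e2: "exec p ?s1 t ?s2" by (rule runsD[OF t(2)]) (use \<sigma> in auto)
    have e3: "exec (Assign N (RightE (Get N))) ?s2 (Suc (size (enc_list ex xs))) ?s3"
      using \<sigma> N by (intro exec_AssignI[where w = "enc_list ex xs"]) auto
    have body: "exec (fold_body N p) \<sigma> (Suc (size ?in) + (t + Suc (size (enc_list ex xs)))) ?s3"
      unfolding fold_body_def by (intro exec_Seq[OF e1] exec_Seq[OF e2] e3)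
    have "exec (While (Get N) (fold_body N p)) ?s3 t' (?s3(0 := ea (fold step xs (step x acc)), N := Leaf))"
      by (rule t'(2)) (use \<sigma> N in auto)
    moreover have "?s3(0 := ea (fold step xs (step x acc)), N := Leaf) = \<sigma>(0 := ea (fold step (x # xs) acc), N := Leaf)"
      by (auto simp: fun_eq_iff)
    ultimately have "exec (While (Get N) (fold_body N p)) ?s3 t' (\<sigma>(0 := ea (fold step (x # xs) acc), N := Leaf))"
      by (simp only:)
    then show ?thesis by (intro exec_While_True[OF _ body]) (use \<sigma> in auto)
  qed
  moreover have "Suc (Suc (size ?in) + (t + Suc (size (enc_list ex xs))) + t') \<le> length (x # xs) * (3 * R + 3) + 1"
    using t' t(1) sz Cons.prems(4) by simp
  ultimately show ?case by blast
qed

text \<open>Iterating a polynomial-time step may blow up the accumulator exponentially, so a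
  polynomial bound \<open>B\<close> on all intermediate accumulators has to be supplied.\<close>

lemma pt_fold_raw:
  assumes step: "pt (enc_pair ex ea) ea (\<lambda>p. step (fst p) (snd p))"
    and B: "polyb B" "\<And>xs acc i. i \<le> length xs \<Longrightarrow> size (ea (fold step (take i xs) acc)) \<le> B (size (enc_pair (enc_list ex) ea (xs, acc)))"
  shows "pt (enc_pair (enc_list ex) ea) ea (\<lambda>p. fold step (fst p) (snd p))"
proof -
  obtain N p a where p: "N \<ge> 1"
    "\<And>q. \<exists>t \<le> a * Suc (size (enc_pair ex ea q)) ^ a. runs N p (enc_pair ex ea q) (ea (step (fst q) (snd q))) t"
    using step by (rule ptE) blast
  let ?S = "\<lambda>n. Suc (n + B n)"
  let ?R = "\<lambda>n. a * Suc (?S n) ^ a + ?S n"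
  let ?T = "\<lambda>n. Suc n + (Suc n + (n * (3 * ?R n + 3) + 1))"
  show ?thesis
  proof (rule ptI[of ?T])
    show "polyb ?T" using B(1) by (intro polyb_intros)
    fix q :: "'a list \<times> 'b"
    obtain xs acc where q: "q = (xs, acc)" by (cases q)
    let ?n = "size (enc_pair (enc_list ex) ea q)"
    let ?y = "ea (fold step xs acc)"
    have in_size: "size (Node (ex (xs ! i)) (ea (fold step (take i xs) acc))) \<le> ?S ?n" if "i < length xs" for i
      using B(2)[of i xs acc] size_enc_list_mem[OF nth_mem[OF that], of ex] that by (auto simp: q)
    have steps: "\<exists>t\<le>?R ?n. runs N p (Node (ex (xs ! i)) (ea (fold step (take i xs) acc)))
      (ea (fold step (take (Suc i) xs) acc)) t" if "i < length xs" for i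
    proof -
      obtain t where t: "t \<le> a * Suc (size (enc_pair ex ea (xs ! i, fold step (take i xs) acc))) ^ a"
        "runs N p (enc_pair ex ea (xs ! i, fold step (take i xs) acc)) (ea (step (xs ! i) (fold step (take i xs) acc))) t"
        using p(2)[of "(xs ! i, fold step (take i xs) acc)"] by auto
      have "t \<le> ?R ?n"
        using t(1) poly_bound_mono[OF order_refl in_size[OF that], of a]
        unfolding enc_pair_def fst_conv snd_conv by linarith
      then show ?thesis using t(2) that by (intro exI[of _ t]) (auto simp: take_Suc_conv_app_nth enc_pair_def)
    qed
    have "\<exists>t\<le>length xs * (3 * ?R ?n + 3) + 1. \<forall>\<sigma>. \<sigma> N = enc_list ex xs \<and> \<sigma> 0 = ea acc \<and>
      (\<forall>v. 0 < v \<and> v < N \<longrightarrow> \<sigma> v = Leaf) \<longrightarrow>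
      exec (While (Get N) (fold_body N p)) \<sigma> t (\<sigma>(0 := ?y, N := Leaf))"
    proof (rule exec_fold_loop[OF p(1) steps])
      show "size (Node (ex (xs ! i)) (ea (fold step (take i xs) acc))) \<le> ?R ?n" if "i < length xs" for i
        using in_size[OF that] by linarith
      show "size (enc_list ex xs) \<le> ?R ?n" by (simp add: q)
    qed
    then obtain t where t: "t \<le> length xs * (3 * ?R ?n + 3) + 1"
      "\<And>\<sigma>. \<sigma> N = enc_list ex xs \<Longrightarrow> \<sigma> 0 = ea acc \<Longrightarrow> (\<And>v. 0 < v \<Longrightarrow> v < N \<Longrightarrow> \<sigma> v = Leaf) \<Longrightarrow>
      exec (While (Get N) (fold_body N p)) \<sigma> t (\<sigma>(0 := ?y, N := Leaf))" by blast
    let ?t = "Suc (size (enc_list ex xs)) + (Suc (size (ea acc)) + t)"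
    have "runs (N + 1) (fold_prog N p) (enc_pair (enc_list ex) ea q) ?y ?t"
      unfolding runs_def
    proof (intro allI impI)
      fix \<sigma> :: tstate
      assume \<sigma>: "\<sigma> 0 = enc_pair (enc_list ex) ea q \<and> (\<forall>v. 0 < v \<and> v < N + 1 \<longrightarrow> \<sigma> v = Leaf)"
      let ?s1 = "\<sigma>(N := enc_list ex xs)"
      let ?s2 = "?s1(0 := ea acc)"
      have e1: "exec (Assign N (LeftE (Get 0))) \<sigma> (Suc (size (enc_list ex xs))) ?s1"
        using \<sigma> by (intro exec_AssignI[where w = "enc_list ex xs"]) (auto simp: q enc_pair_def)
      have e2: "exec (Assign 0 (RightE (Get 0))) ?s1 (Suc (size (ea acc))) ?s2"
        using p(1) \<sigma> by (intro exec_AssignI[where w = "ea acc"]) (auto simp: q enc_pair_def)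
      have "exec (While (Get N) (fold_body N p)) ?s2 t (?s2(0 := ?y, N := Leaf))"
        by (rule t(2)) (use p(1) \<sigma> in auto)
      moreover have "?s2(0 := ?y, N := Leaf) = \<sigma>(0 := ?y)"
      proof
        fix v
        have "\<sigma> N = Leaf" using \<sigma> p(1) by auto
        then show "(?s2(0 := ?y, N := Leaf)) v = (\<sigma>(0 := ?y)) v" using p(1) by auto
      qed
      ultimately have "exec (While (Get N) (fold_body N p)) ?s2 t (\<sigma>(0 := ?y))" by (simp only:)
      then show "exec (fold_prog N p) \<sigma> ?t (\<sigma>(0 := ?y))"
        unfolding fold_prog_def by (intro exec_Seq[OF e1] exec_Seq[OF e2])
    qed
    moreover have "?t \<le> ?T ?n"
    proof -
      have "length xs \<le> ?n" using size_enc_list_ge[of xs ex] by (simp add: q)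
      then have "length xs * (3 * ?R ?n + 3) \<le> ?n * (3 * ?R ?n + 3)" by (rule mult_right_mono) simp
      moreover have "size (enc_list ex xs) \<le> ?n" "size (ea acc) \<le> ?n" by (simp_all add: q)
      ultimately show ?thesis using t(1) by linarith
    qed
    ultimately show "\<exists>t\<le>?T (size (enc_pair (enc_list ex) ea q)).
        runs (N + 1) (fold_prog N p) (enc_pair (enc_list ex) ea q) (ea (fold step (fst q) (snd q))) t"
      unfolding q fst_conv snd_conv by blast
  qed
qed

lemma pt_enc: "pt e e2 f \<Longrightarrow> (\<And>x. e2' (f' x) = e2 (f x)) \<Longrightarrow> pt e e2' f'"
  unfolding pt_def by simp

lemma pt_fold:
  assumes "pt (enc_pair ex ea) ea (\<lambda>p. step (fst p) (snd p))"
    and "polyb B" "\<And>xs acc i. i \<le> length xs \<Longrightarrow> size (ea (fold step (take i xs) acc)) \<le> B (size (enc_pair (enc_list ex) ea (xs, acc)))"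
    and "pt e (enc_list ex) xs" "pt e ea acc"
  shows "pt e ea (\<lambda>x. fold step (xs x) (acc x))"
  using pt_comp[OF pt_pair[OF assms(4,5)] pt_fold_raw[OF assms(1-3)]] by simp

text \<open>Growth by the size of the consumed element plus a constant adds up to a linear function
  of the input size.\<close>

lemma pt_fold_additive:
  assumes "pt (enc_pair ex ea) ea (\<lambda>p. step (fst p) (snd p))"
    and "\<And>x acc. size (ea (step x acc)) \<le> size (ex x) + size (ea acc) + c"
    and "pt e (enc_list ex) xs" "pt e ea acc"
  shows "pt e ea (\<lambda>x. fold step (xs x) (acc x))"
proof (rule pt_fold[OF assms(1) _ _ assms(3,4)])
  show "polyb (\<lambda>n. n + c * n)" by (intro polyb_intros)
  have grow: "size (ea (fold step xs acc)) \<le> size (enc_list ex xs) + size (ea acc) + c * length xs" for xs acc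
  proof (induction xs arbitrary: acc)
    case (Cons x xs)
    show ?case using Cons.IH[of "step x acc"] assms(2)[of x acc] by simp
  qed simp
  fix xs acc i
  have "size (enc_list ex (take i xs)) \<le> size (enc_list ex xs)"
    by (induction xs arbitrary: i) (auto simp: take_Cons split: nat.splits)
  moreover have "c * length (take i xs) \<le> c * size (enc_pair (enc_list ex) ea (xs, acc))"
    using size_enc_list_ge[of xs ex] by (intro mult_left_mono) auto
  moreover have "size (enc_pair (enc_list ex) ea (xs, acc)) = size (enc_list ex xs) + size (ea acc) + 1" by simp
  ultimately show "size (ea (fold step (take i xs) acc)) \<le> size (enc_pair (enc_list ex) ea (xs, acc)) +
      c * size (enc_pair (enc_list ex) ea (xs, acc))"
    using grow[of "take i xs" acc] by linarith
qed

section \<open>List functions as folds\<close>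

lemma pt_Cons: "pt e ex f \<Longrightarrow> pt e (enc_list ex) g \<Longrightarrow> pt e (enc_list ex) (\<lambda>x. f x # g x)"
proof -
  assume "pt e ex f" "pt e (enc_list ex) g"
  then have "pt e (enc_pair ex (enc_list ex)) (\<lambda>x. (f x, g x))" by (rule pt_pair)
  then show ?thesis by (rule pt_enc) (simp add: enc_pair_def)
qed

lemma pt_tl: "pt e (enc_list ex) f \<Longrightarrow> pt e (enc_list ex) (\<lambda>x. tl (f x))"
proof (rule pt_comp, assumption)
  have "enc_list ex (tl ys) = texp_value (RightE (Get 0)) (\<lambda>_. enc_list ex ys)" for ys
    by (cases ys) auto
  moreover have "size (enc_list ex (tl ys)) \<le> size (enc_list ex ys)" for ys
    by (cases ys) auto
  ultimately show "pt (enc_list ex) (enc_list ex) tl"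
    by (intro pt_expr[of "RightE (Get 0)" _ _ _ "\<lambda>n. n"]) auto
qed

lemma fold_Cons_rev: "fold (#) xs acc = rev xs @ acc"
  by (induction xs arbitrary: acc) auto

lemma pt_rev: "pt e (enc_list ex) f \<Longrightarrow> pt e (enc_list ex) (\<lambda>x. rev (f x))"
  using pt_fold_additive[OF pt_Cons[OF pt_fst[OF pt_id] pt_snd[OF pt_id]], of ex 1 e f "\<lambda>_. []"]
  by (simp add: fold_Cons_rev pt_const)

lemma pt_append:
  "pt e (enc_list ex) f \<Longrightarrow> pt e (enc_list ex) g \<Longrightarrow> pt e (enc_list ex) (\<lambda>x. f x @ g x)"
  using pt_fold_additive[OF pt_Cons[OF pt_fst[OF pt_id] pt_snd[OF pt_id]], of ex 1 e "\<lambda>x. rev (f x)" g]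
  by (simp add: fold_Cons_rev pt_rev)

lemma size_enc_list_append: "size (enc_list ex (xs @ ys)) = size (enc_list ex xs) + size (enc_list ex ys)"
  by (induction xs) auto

lemma size_enc_list_rev: "size (enc_list ex (rev xs)) = size (enc_list ex xs)"
  by (induction xs) (auto simp: size_enc_list_append)

lemma fold_append_concat: "fold (\<lambda>x acc. acc @ x) xs acc = acc @ concat xs"
  by (induction xs arbitrary: acc) auto

lemma pt_concat: "pt e (enc_list (enc_list ex)) f \<Longrightarrow> pt e (enc_list ex) (\<lambda>x. concat (f x))"
  using pt_fold_additive[OF pt_append[OF pt_snd[OF pt_id] pt_fst[OF pt_id]], of ex 0 e f "\<lambda>_. []"]
  by (simp add: fold_append_concat pt_const size_enc_list_append)

lemma size_enc_list_le:
  "(\<And>y. y \<in> set ys \<Longrightarrow> size (ey y) \<le> R) \<Longrightarrow> size (enc_list ey ys) \<le> length ys * Suc R"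
proof (induction ys)
  case (Cons y ys)
  have "size (ey y) \<le> R" "size (enc_list ey ys) \<le> length ys * Suc R" using Cons by auto
  then show ?case by simp
qed simp

text \<open>A fold step sees only the current element and the accumulator, so the environment of the
  mapped function travels in the accumulator.\<close>

lemma pt_map:
  assumes "pt e (enc_list ex) xs" "pt (enc_pair e ex) ey (\<lambda>p. g (fst p) (snd p))"
  shows "pt e (enc_list ey) (\<lambda>x. map (g x) (xs x))"
proof -
  obtain B where B: "polyb B" "mono B" "\<And>env y. size (ey (g env y)) \<le> B (size (enc_pair e ex (env, y)))"
    using pt_size[OF assms(2)] by auto
  let ?step = "\<lambda>y (p :: 'a \<times> 'c list). (fst p, g (fst p) y # snd p)"
  have fold: "fold ?step ys (env, out) = (env, rev (map (g env) ys) @ out)" for ys env out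
    by (induction ys arbitrary: out) auto
  have "pt e (enc_pair e (enc_list ey)) (\<lambda>x. fold ?step (xs x) (x, []))"
  proof (rule pt_fold[where B = "\<lambda>n. 3 * n + n * Suc (B n)"])
    have "pt (enc_pair ex (enc_pair e (enc_list ey))) ey (\<lambda>p. g (fst (snd p)) (fst p))"
      using pt_comp[OF pt_pair[OF pt_fst[OF pt_snd[OF pt_id]] pt_fst[OF pt_id]] assms(2)] by simp
    then show "pt (enc_pair ex (enc_pair e (enc_list ey))) (enc_pair e (enc_list ey)) (\<lambda>p. ?step (fst p) (snd p))"
      by (intro pt_pair pt_Cons pt_fst[OF pt_snd[OF pt_id]] pt_snd[OF pt_snd[OF pt_id]])
    show "polyb (\<lambda>n. 3 * n + n * Suc (B n))" using B(1) by (intro polyb_intros)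
    fix ys and acc :: "'a \<times> 'c list" and i
    obtain env out where acc: "acc = (env, out)" by (cases acc)
    let ?n = "size (enc_pair (enc_list ex) (enc_pair e (enc_list ey)) (ys, acc))"
    have "size (ey y) \<le> B ?n" if y: "y \<in> set (map (g env) (take i ys))" for y
    proof -
      obtain z where z: "z \<in> set ys" "y = g env z" using y by (auto dest: in_set_takeD)
      have "size (enc_pair e ex (env, z)) \<le> ?n" using size_enc_list_mem[OF z(1), of ex] by (simp add: acc)
      then show ?thesis using B(3)[of env z] monoD[OF B(2)] z(2) by (metis order.trans)
    qed
    then have "size (enc_list ey (map (g env) (take i ys))) \<le> length (map (g env) (take i ys)) * Suc (B ?n)"
      by (rule size_enc_list_le)
    also have "\<dots> \<le> ?n * Suc (B ?n)"
      using size_enc_list_ge[of ys ex] by (intro mult_right_mono) auto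
    finally show "size (enc_pair e (enc_list ey) (fold ?step (take i ys) acc)) \<le> 3 * ?n + ?n * Suc (B ?n)"
      unfolding acc fold by (simp add: size_enc_list_append size_enc_list_rev)
  qed (use assms(1) in \<open>auto intro: pt_pair pt_id pt_const\<close>)
  from pt_rev[OF pt_snd[OF this]] show ?thesis by (simp add: fold)
qed

definition enc_bool :: "bool \<Rightarrow> tree" where
  "enc_bool b = (if b then Node Leaf Leaf else Leaf)"

lemma pt_If: "pt e enc_bool b \<Longrightarrow> pt e e2 f \<Longrightarrow> pt e e2 g \<Longrightarrow> pt e e2 (\<lambda>x. if b x then f x else g x)"
  by (rule pt_if) (auto simp: enc_bool_def split: if_splits)

lemma concat_map_filter: "concat (map (\<lambda>y. if P y then [y] else []) xs) = filter P xs"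
  by (induction xs) auto

lemma pt_filter:
  assumes "pt e (enc_list ex) xs" "pt (enc_pair e ex) enc_bool (\<lambda>p. P (fst p) (snd p))"
  shows "pt e (enc_list ex) (\<lambda>x. filter (P x) (xs x))"
proof -
  have "pt e (enc_list ex) (\<lambda>x. concat (map (\<lambda>y. if P x y then [y] else []) (xs x)))"
    by (rule pt_concat pt_map assms pt_If pt_Cons pt_const pt_snd pt_id)+
  then show ?thesis by (simp only: concat_map_filter)
qed

section \<open>Arithmetic in unary\<close>

abbreviation enc_units :: "unit list \<Rightarrow> tree" where "enc_units \<equiv> enc_list (\<lambda>_. Leaf)"

text \<open>Unary numbers are lists of units, so arithmetic is list processing: sums by appending,
  products by repetition, differences by \<open>drop\<close>.\<close>

lemma enc_nat_units: "enc_nat n = enc_units (replicate n ())"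
  by (induction n) auto

lemma size_enc_nat [simp]: "size (enc_nat n) = n"
  by (induction n) auto

lemma enc_nat_eq_Leaf [simp]: "enc_nat n = Leaf \<longleftrightarrow> n = 0"
  by (cases n) auto

lemma pt_units: "pt e enc_nat f \<longleftrightarrow> pt e enc_units (\<lambda>x. replicate (f x) ())"
  unfolding pt_def by (simp add: enc_nat_units)

lemma pt_length: "pt e (enc_list ex) f \<Longrightarrow> pt e enc_nat (\<lambda>x. length (f x))"
proof -
  assume "pt e (enc_list ex) f"
  then have "pt e enc_units (\<lambda>x. map (\<lambda>_. ()) (f x))" by (rule pt_map[OF _ pt_const])
  then show ?thesis unfolding pt_units by (simp add: map_replicate_const)
qed

lemma pt_replicate: "pt e enc_nat n \<Longrightarrow> pt e ex f \<Longrightarrow> pt e (enc_list ex) (\<lambda>x. replicate (n x) (f x))"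
proof -
  assume "pt e enc_nat n" "pt e ex f"
  then have "pt e (enc_list ex) (\<lambda>x. map (\<lambda>_. f x) (replicate (n x) ()))"
    by (intro pt_map[where ex = "\<lambda>_. Leaf"] pt_comp[OF pt_fst[OF pt_id]]) (simp_all add: pt_units)
  then show ?thesis by simp
qed

lemma pt_Suc: "pt e enc_nat f \<Longrightarrow> pt e enc_nat (\<lambda>x. Suc (f x))"
  unfolding pt_units replicate_Suc by (intro pt_Cons pt_const)

lemma pt_add: "pt e enc_nat f \<Longrightarrow> pt e enc_nat g \<Longrightarrow> pt e enc_nat (\<lambda>x. f x + g x)"
  unfolding pt_units replicate_add by (intro pt_append)

lemma pt_sum_list: "pt e (enc_list enc_nat) f \<Longrightarrow> pt e enc_nat (\<lambda>x. sum_list (f x))"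
proof -
  assume *: "pt e (enc_list enc_nat) f"
  have enc: "enc_list enc_nat xs = enc_list enc_units (map (\<lambda>n. replicate n ()) xs)" for xs
    by (induction xs) (auto simp: enc_nat_units)
  have "concat (map (\<lambda>n. replicate n ()) xs) = replicate (sum_list xs) ()" for xs
    by (induction xs) (auto simp: replicate_add)
  moreover have "pt e (enc_list enc_units) (\<lambda>x. map (\<lambda>n. replicate n ()) (f x))"
    by (rule pt_enc[OF *]) (simp add: enc)
  ultimately show ?thesis unfolding pt_units by (auto dest!: pt_concat)
qed

lemma pt_mult: "pt e enc_nat f \<Longrightarrow> pt e enc_nat g \<Longrightarrow> pt e enc_nat (\<lambda>x. f x * g x)"
proof -
  assume "pt e enc_nat f" "pt e enc_nat g"
  then have "pt e enc_nat (\<lambda>x. sum_list (replicate (f x) (g x)))"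
    by (rule pt_sum_list[OF pt_replicate])
  then show ?thesis by (simp add: sum_list_replicate)
qed

lemma pt_power: "pt e enc_nat f \<Longrightarrow> pt e enc_nat (\<lambda>x. f x ^ c)"
  by (induction c) (auto intro: pt_const pt_mult)

lemma fold_pred: "fold (\<lambda>_ a. tl a) us (xs :: 'b list) = drop (length us) xs"
  by (induction us arbitrary: xs) (auto simp: drop_Suc)

lemma size_enc_list_tl: "size (enc_list ex (tl xs)) \<le> size (enc_list ex xs)"
  by (cases xs) auto

lemma pt_drop:
  assumes "pt e enc_nat n" "pt e (enc_list ex) f"
  shows "pt e (enc_list ex) (\<lambda>x. drop (n x) (f x))"
proof -
  have "pt e (enc_list ex) (\<lambda>x. fold (\<lambda>_ a. tl a) (replicate (n x) ()) (f x))"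
    by (rule pt_fold_additive[where ex = "\<lambda>_. Leaf" and c = 0])
      (use assms in \<open>auto simp: pt_units size_enc_list_tl intro: pt_tl[OF pt_snd[OF pt_id]]\<close>)
  then show ?thesis by (simp only: fold_pred length_replicate)
qed

lemma pt_take:
  assumes "pt e enc_nat n" "pt e (enc_list ex) f"
  shows "pt e (enc_list ex) (\<lambda>x. take (n x) (f x))"
proof -
  have "pt e enc_nat (\<lambda>x. length (drop (n x) (f x)))" by (rule pt_length[OF pt_drop[OF assms]])
  then have "pt e (enc_list ex) (\<lambda>x. rev (drop (length (drop (n x) (f x))) (rev (f x))))"
    by (intro pt_rev pt_drop assms)
  moreover have "rev (drop (length (drop k ys)) (rev ys)) = take k ys" for k and ys :: "'b list"
    by (cases "k \<le> length ys") (auto simp: rev_drop)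
  ultimately show ?thesis by simp
qed

lemma pt_diff: "pt e enc_nat f \<Longrightarrow> pt e enc_nat g \<Longrightarrow> pt e enc_nat (\<lambda>x. f x - g x)"
  using pt_drop[of e g "\<lambda>_. Leaf" "\<lambda>x. replicate (f x) ()"] by (simp add: pt_units)

lemma pt_eq_nat: "pt e enc_nat f \<Longrightarrow> pt e enc_nat g \<Longrightarrow> pt e enc_bool (\<lambda>x. f x = g x)"
proof -
  assume "pt e enc_nat f" "pt e enc_nat g"
  then have "pt e enc_bool (\<lambda>x. if (f x - g x) + (g x - f x) \<noteq> 0 then False else True)"
    by (intro pt_if[where eb = enc_nat and b = "\<lambda>x. (f x - g x) + (g x - f x)"] pt_const pt_add pt_diff) auto
  moreover have "(if (f x - g x) + (g x - f x) \<noteq> 0 then False else True) = (f x = g x)" for x by auto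
  ultimately show ?thesis by simp
qed

lemma pt_le_nat: "pt e enc_nat f \<Longrightarrow> pt e enc_nat g \<Longrightarrow> pt e enc_bool (\<lambda>x. f x \<le> g x)"
  using pt_eq_nat[OF pt_diff pt_const, of e f g 0] by simp

definition nth0 :: "nat list \<Rightarrow> nat \<Rightarrow> nat" where
  "nth0 xs i = (if i < length xs then xs ! i else 0)"

lemma pt_nth0: "pt e (enc_list enc_nat) f \<Longrightarrow> pt e enc_nat i \<Longrightarrow> pt e enc_nat (\<lambda>x. nth0 (f x) (i x))"
proof -
  assume "pt e (enc_list enc_nat) f" "pt e enc_nat i"
  then have "pt e (enc_list enc_nat) (\<lambda>x. drop (i x) (f x))" by (rule pt_drop[rotated])
  moreover have "pt (enc_list enc_nat) enc_nat (\<lambda>xs. nth0 xs 0)"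
  proof (rule pt_expr[of "LeftE (Get 0)" _ _ _ "\<lambda>n. n"])
    show "enc_nat (nth0 xs 0) = texp_value (LeftE (Get 0)) (\<lambda>_. enc_list enc_nat xs)" for xs
      by (cases xs) (auto simp: nth0_def)
    show "size (enc_nat (nth0 xs 0)) \<le> size (enc_list enc_nat xs)" for xs
      by (cases xs) (auto simp: nth0_def)
  qed auto
  ultimately have "pt e enc_nat (\<lambda>x. nth0 (drop (i x) (f x)) 0)" by (rule pt_comp)
  then show ?thesis by (rule pt_enc) (auto simp: nth0_def)
qed

lemma pt_upt: "pt e enc_nat f \<Longrightarrow> pt e (enc_list enc_nat) (\<lambda>x. [0..<f x])"
proof -
  assume f: "pt e enc_nat f"
  let ?step = "\<lambda>_ (p :: nat \<times> nat list). (Suc (fst p), snd p @ [fst p])"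
  have fold: "fold ?step us (i, out) = (i + length us, out @ [i..<i + length us])" for us :: "unit list" and i out
    by (induction us arbitrary: i out) (auto simp: upt_rec)
  have "pt e (enc_pair enc_nat (enc_list enc_nat)) (\<lambda>x. fold ?step (replicate (f x) ()) (0, []))"
  proof (rule pt_fold[where B = "\<lambda>n. n + n + n + n * Suc (n + n) + 1"])
    show "pt (enc_pair (\<lambda>_. Leaf) (enc_pair enc_nat (enc_list enc_nat))) (enc_pair enc_nat (enc_list enc_nat))
        (\<lambda>p. ?step (fst p) (snd p))"
      by (rule pt_pair pt_Suc pt_append pt_Cons pt_const pt_fst pt_snd pt_id)+
    show "polyb (\<lambda>n. n + n + n + n * Suc (n + n) + 1)" by (intro polyb_intros)
    fix us :: "unit list" and acc :: "nat \<times> nat list" and k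
    obtain i out where acc: "acc = (i, out)" by (cases acc)
    let ?n = "size (enc_pair enc_units (enc_pair enc_nat (enc_list enc_nat)) (us, acc))"
    let ?l = "length (take k us)"
    have l: "?l \<le> ?n" "i \<le> ?n" using size_enc_list_ge[of us "\<lambda>_. Leaf"] by (auto simp: acc)
    have "size (enc_list enc_nat [i..<i + ?l]) \<le> length [i..<i + ?l] * Suc (?n + ?n)"
      using l by (intro size_enc_list_le) auto
    also have "\<dots> \<le> ?n * Suc (?n + ?n)" using l by (intro mult_right_mono) auto
    finally show "size (enc_pair enc_nat (enc_list enc_nat) (fold ?step (take k us) acc)) \<le>
        ?n + ?n + ?n + ?n * Suc (?n + ?n) + 1"
      using l unfolding acc fold by (simp add: size_enc_list_append)
  qed (use f in \<open>auto simp: pt_units intro: pt_const\<close>)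
  from pt_snd[OF this] show ?thesis by (simp only: fold length_replicate fst_conv snd_conv add_0 append_Nil)
qed

lemmas pt_intros = pt_const pt_id pt_fst pt_snd pt_pair pt_Cons pt_append pt_rev pt_concat pt_map pt_If pt_filter
  pt_length pt_replicate pt_Suc pt_add pt_sum_list pt_mult pt_power pt_drop pt_take pt_diff pt_eq_nat pt_le_nat
  pt_nth0 pt_upt

lemma pt_divmod:
  assumes f: "pt e enc_nat f" and b: "pt e enc_nat b"
  shows "pt e (enc_pair enc_nat enc_nat) (\<lambda>x. (f x div b x, f x mod b x))"
proof -
  \<comment> \<open>Counting with a wrap-around at \<open>b\<close>. For \<open>b = 0\<close> it
    never wraps, in accordance with \<open>n div 0 = 0\<close> and
    \<open>n mod 0 = n\<close>.\<close>
  let ?step = "\<lambda>_ (p :: nat \<times> nat \<times> nat). (fst p, if Suc (snd (snd p)) = fst p then (Suc (fst (snd p)), 0)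
    else (fst (snd p), Suc (snd (snd p))))"
  have fold: "fold ?step us (b, 0, 0) = (b, length us div b, length us mod b)" for us :: "unit list" and b
    by (induction us rule: rev_induct) (auto simp: div_Suc mod_Suc)
  have "pt e (enc_pair enc_nat (enc_pair enc_nat enc_nat)) (\<lambda>x. fold ?step (replicate (f x) ()) (b x, 0, 0))"
  proof (rule pt_fold_additive[where c = 1])
    show "pt (enc_pair (\<lambda>_. Leaf) (enc_pair enc_nat (enc_pair enc_nat enc_nat)))
      (enc_pair enc_nat (enc_pair enc_nat enc_nat)) (\<lambda>p. ?step (fst p) (snd p))"
      by (rule pt_intros)+
  qed (use f b in \<open>auto simp: pt_units intro!: pt_pair pt_const\<close>)
  from pt_snd[OF this] show ?thesis by (simp only: fold length_replicate fst_conv snd_conv add_0 append_Nil)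
qed

definition digits :: "nat \<Rightarrow> nat \<Rightarrow> nat \<Rightarrow> nat list" where
  "digits b l n = map (\<lambda>u. n div b ^ u mod b) [0..<l]"

lemma pt_digits:
  assumes f: "pt e enc_nat f" and b: "pt e enc_nat b" and l: "pt e enc_nat l"
  shows "pt e (enc_list enc_nat) (\<lambda>x. digits (b x) (l x) (f x))"
proof -
  let ?step = "\<lambda>_ (p :: nat \<times> nat \<times> nat list). (fst p, fst (snd p) div fst p, snd (snd p) @ [fst (snd p) mod fst p])"
  have fold: "fold ?step us (b, n, []) = (b, n div b ^ length us, digits b (length us) n)" for us :: "unit list" and b n
    by (induction us rule: rev_induct) (auto simp: digits_def mult.commute simp flip: div_mult2_eq)
  have dm: "pt (enc_pair (\<lambda>_. Leaf) (enc_pair enc_nat (enc_pair enc_nat (enc_list enc_nat)))) (enc_pair enc_nat enc_nat)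
      (\<lambda>p. (fst (snd (snd p)) div fst (snd p), fst (snd (snd p)) mod fst (snd p)))"
    by (rule pt_divmod) (rule pt_intros)+
  have "pt e (enc_pair enc_nat (enc_pair enc_nat (enc_list enc_nat)))
    (\<lambda>x. fold ?step (replicate (l x) ()) (b x, f x, []))"
  proof (rule pt_fold_additive[where c = 1])
    show "pt (enc_pair (\<lambda>_. Leaf) (enc_pair enc_nat (enc_pair enc_nat (enc_list enc_nat))))
      (enc_pair enc_nat (enc_pair enc_nat (enc_list enc_nat))) (\<lambda>p. ?step (fst p) (snd p))"
      by (rule pt_fst[OF dm, unfolded fst_conv] pt_snd[OF dm, unfolded snd_conv] pt_intros)+
    fix u :: unit and acc :: "nat \<times> nat \<times> nat list"
    obtain b n out where acc: "acc = (b, n, out)" by (cases acc) auto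
    \<comment> \<open>Quotient and emitted remainder together do not exceed \<open>n\<close>, so a
      step adds only one list cell.\<close>
    have "n div b + n mod b \<le> n"
    proof (cases "b = 0")
      case False
      then have "n div b * 1 \<le> n div b * b" by (intro mult_left_mono) auto
      then show ?thesis using div_mult_mod_eq[of n b] by linarith
    qed simp
    then show "size (enc_pair enc_nat (enc_pair enc_nat (enc_list enc_nat)) (?step u acc)) \<le>
      size Leaf + size (enc_pair enc_nat (enc_pair enc_nat (enc_list enc_nat)) acc) + 1"
      by (simp add: acc size_enc_list_append)
  qed (use f b l in \<open>auto simp: pt_units intro!: pt_pair pt_const\<close>)
  from pt_snd[OF pt_snd[OF this]] show ?thesis by (simp only: fold length_replicate fst_conv snd_conv add_0 append_Nil)
qed

section \<open>Enumerating tuples\<close>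

text \<open>The cut-off \<open>M\<close> only serves to make the enumeration run in polynomial time on every input.\<close>

fun tuples :: "nat \<Rightarrow> nat list \<Rightarrow> nat list list \<Rightarrow> nat \<Rightarrow> nat list list" where
  "tuples M S T 0 = T"
| "tuples M S T (Suc n) = take M (concat (map (\<lambda>t. map (\<lambda>x. x # t) S) (tuples M S T n)))"

lemma size_tuples:
  "t \<in> set (tuples M S T n) \<Longrightarrow>
    size (enc_list enc_nat t) \<le> size (enc_list (enc_list enc_nat) T) + n * Suc (size (enc_list enc_nat S))"
proof (induction n arbitrary: t)
  case 0
  then show ?case using size_enc_list_mem[of t T "enc_list enc_nat"] by simp
next
  case (Suc n)
  then obtain t' x where "t = x # t'" "t' \<in> set (tuples M S T n)" "x \<in> set S"
    by (auto dest!: in_set_takeD)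
  then show ?case using Suc.IH[of t'] size_enc_list_mem[of x S enc_nat] by simp
qed

lemma length_tuples_le: "length (tuples M S T n) \<le> length T + M"
  by (cases n) auto

lemma pt_tuples:
  assumes M: "pt e enc_nat M" and S: "pt e (enc_list enc_nat) S"
    and T: "pt e (enc_list (enc_list enc_nat)) T" and n: "pt e enc_nat n"
  shows "pt e (enc_list (enc_list enc_nat)) (\<lambda>x. tuples (M x) (S x) (T x) (n x))"
proof -
  let ?step = "\<lambda>_ (p :: nat \<times> nat list \<times> nat list list). (fst p, fst (snd p),
    take (fst p) (concat (map (\<lambda>t. map (\<lambda>x. x # t) (fst (snd p))) (snd (snd p)))))"
  have fold: "fold ?step us (M, S, T) = (M, S, tuples M S T (length us))" for us :: "unit list" and M S T
    by (induction us rule: rev_induct) auto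
  let ?e = "enc_pair enc_nat (enc_pair (enc_list enc_nat) (enc_list (enc_list enc_nat)))"
  let ?B = "\<lambda>n. n + n + (n + n) * Suc (n + n * Suc n) + 2"
  have "pt e ?e (\<lambda>x. fold ?step (replicate (n x) ()) (M x, S x, T x))"
  proof (rule pt_fold[where B = ?B])
    show "pt (enc_pair (\<lambda>_. Leaf) ?e) ?e (\<lambda>p. ?step (fst p) (snd p))"
      by (rule pt_intros)+
    show "polyb ?B" by (intro polyb_intros)
    fix us :: "unit list" and acc :: "nat \<times> nat list \<times> nat list list" and k
    obtain M S T where acc: "acc = (M, S, T)" by (cases acc) auto
    let ?n = "size (enc_pair enc_units ?e (us, acc))"
    let ?l = "length (take k us)"
    have l: "?l \<le> ?n" "M \<le> ?n" "length T \<le> ?n" "size (enc_list enc_nat S) \<le> ?n"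
      "size (enc_list (enc_list enc_nat) T) \<le> ?n"
      using size_enc_list_ge[of us "\<lambda>_. Leaf"] size_enc_list_ge[of T "enc_list enc_nat"] by (auto simp: acc)
    have "size (enc_list enc_nat t) \<le> ?n + ?n * Suc ?n" if "t \<in> set (tuples M S T ?l)" for t
      by (rule order.trans[OF size_tuples[OF that]]) (use l in \<open>intro add_mono mult_mono; simp\<close>)
    then have "size (enc_list (enc_list enc_nat) (tuples M S T ?l)) \<le> length (tuples M S T ?l) * Suc (?n + ?n * Suc ?n)"
      by (rule size_enc_list_le)
    also have "\<dots> \<le> (?n + ?n) * Suc (?n + ?n * Suc ?n)"
      by (intro mult_right_mono order.trans[OF length_tuples_le] add_mono l) simp
    finally have "size (enc_list (enc_list enc_nat) (tuples M S T ?l)) \<le> (?n + ?n) * Suc (?n + ?n * Suc ?n)" .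
    moreover have "size (?e (M, S, tuples M S T ?l)) = M + size (enc_list enc_nat S) +
        size (enc_list (enc_list enc_nat) (tuples M S T ?l)) + 2" by simp
    ultimately show "size (?e (fold ?step (take k us) acc)) \<le> ?B ?n"
      using l unfolding acc fold by linarith
  qed (use M S T n in \<open>auto simp: pt_units intro!: pt_pair\<close>)
  from pt_snd[OF pt_snd[OF this]] show ?thesis by (simp only: fold length_replicate fst_conv snd_conv add_0 append_Nil)
qed

section \<open>Arithmetic expressions\<close>

lemma pt_FBin:
  assumes "pt e enc_fexp f" "pt e enc_fexp g"
    and "\<And>a b. enc_fexp (F a b) = Node (enc_nat n) (Node (enc_fexp a) (enc_fexp b))"
  shows "pt e enc_fexp (\<lambda>x. F (f x) (g x))"
proof -
  have "pt e (enc_pair enc_nat (enc_pair enc_fexp enc_fexp)) (\<lambda>x. (n, f x, g x))"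
    by (intro pt_pair pt_const assms)
  then show ?thesis by (rule pt_enc) (simp add: enc_pair_def assms(3))
qed

lemma pt_FAdd: "pt e enc_fexp f \<Longrightarrow> pt e enc_fexp g \<Longrightarrow> pt e enc_fexp (\<lambda>x. FAdd (f x) (g x))"
  by (rule pt_FBin[where n = 1]) simp_all

lemma pt_FMul: "pt e enc_fexp f \<Longrightarrow> pt e enc_fexp g \<Longrightarrow> pt e enc_fexp (\<lambda>x. FMul (f x) (g x))"
  by (rule pt_FBin[where n = 3]) (simp_all add: numeral_eq_Suc)

lemma pt_FDiv: "pt e enc_fexp f \<Longrightarrow> pt e enc_fexp g \<Longrightarrow> pt e enc_fexp (\<lambda>x. FDiv (f x) (g x))"
  by (rule pt_FBin[where n = 4]) (simp_all add: numeral_eq_Suc)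

text \<open>The numbers 0 and 1 are written with a constant \<open>i\<close> whose value is nonzero.\<close>

definition fzero :: "nat \<Rightarrow> fexp" where "fzero i = FSub (FConst i) (FConst i)"
definition fone :: "nat \<Rightarrow> fexp" where "fone i = FDiv (FConst i) (FConst i)"
definition fsum :: "nat \<Rightarrow> fexp list \<Rightarrow> fexp" where "fsum i fs = fold FAdd fs (fzero i)"
definition fprod :: "nat \<Rightarrow> fexp list \<Rightarrow> fexp" where "fprod i fs = fold FMul fs (fone i)"
definition fnum :: "nat \<Rightarrow> nat \<Rightarrow> fexp" where "fnum i n = fsum i (replicate n (fone i))"
definition fpow :: "nat \<Rightarrow> fexp \<Rightarrow> nat \<Rightarrow> fexp" where "fpow i x n = fprod i (replicate n x)"
text \<open>Falling factorial over factorial. For \<open>l > e\<close> the truncated subtraction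
  produces a factor 0, so no case distinction has to be programmed.\<close>

definition fchoose :: "nat \<Rightarrow> nat \<Rightarrow> nat \<Rightarrow> fexp" where
  "fchoose i e l = FDiv (fprod i (map (\<lambda>u. fnum i (e - u)) [0..<l])) (fprod i (map (\<lambda>u. fnum i (Suc u)) [0..<l]))"

definition fbinom :: "nat \<Rightarrow> nat \<Rightarrow> nat \<Rightarrow> nat \<Rightarrow> nat \<Rightarrow> fexp" where
  "fbinom i e l a b = FMul (fchoose i e l) (FMul (fpow i (fnum i a) (e - l)) (fpow i (fnum i b) l))"

lemma pt_fsum: "pt e (enc_list enc_fexp) f \<Longrightarrow> pt e enc_fexp (\<lambda>x. fsum i (f x))"
  unfolding fsum_def
  by (rule pt_fold_additive[where c = 3, OF pt_FAdd[OF pt_fst[OF pt_id] pt_snd[OF pt_id]]]) (auto intro: pt_const)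

lemma pt_fprod: "pt e (enc_list enc_fexp) f \<Longrightarrow> pt e enc_fexp (\<lambda>x. fprod i (f x))"
  unfolding fprod_def
  by (rule pt_fold_additive[where c = 5, OF pt_FMul[OF pt_fst[OF pt_id] pt_snd[OF pt_id]]]) (auto intro: pt_const)

lemma pt_fnum: "pt e enc_nat f \<Longrightarrow> pt e enc_fexp (\<lambda>x. fnum i (f x))"
  unfolding fnum_def by (rule pt_fsum pt_replicate pt_const | assumption)+

lemma pt_fpow: "pt e enc_fexp f \<Longrightarrow> pt e enc_nat n \<Longrightarrow> pt e enc_fexp (\<lambda>x. fpow i (f x) (n x))"
  unfolding fpow_def by (rule pt_fprod pt_replicate | assumption)+

lemma pt_fchoose: "pt e enc_nat f \<Longrightarrow> pt e enc_nat l \<Longrightarrow> pt e enc_fexp (\<lambda>x. fchoose i (f x) (l x))"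
proof -
  assume f: "pt e enc_nat f" and l: "pt e enc_nat l"
  have f': "pt (enc_pair e enc_nat) enc_nat (\<lambda>p. f (fst p))" by (rule pt_comp[OF pt_fst[OF pt_id] f])
  show ?thesis unfolding fchoose_def
    by (rule pt_FDiv pt_fprod pt_fnum f' l pt_map pt_upt pt_diff pt_Suc pt_snd pt_id)+
qed

lemma pt_fbinom:
  "pt e enc_nat f \<Longrightarrow> pt e enc_nat l \<Longrightarrow> pt e enc_nat a \<Longrightarrow> pt e enc_nat b \<Longrightarrow>
    pt e enc_fexp (\<lambda>x. fbinom i (f x) (l x) (a x) (b x))"
  unfolding fbinom_def by (rule pt_FMul pt_fchoose pt_fpow pt_fnum pt_diff | assumption)+

lemma prod_falling: "(\<Prod>u<l. e - u) = fact l * (e choose l)"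
proof (induction l)
  case (Suc l)
  have "(e - l) * (e choose l) = Suc l * (e choose Suc l)"
    by (metis Suc_times_binomial_eq binomial_absorb_comp binomial_absorption mult.commute)
  then show ?case using Suc by (simp add: algebra_simps)
qed simp

context
  fixes cs :: "'a::field_char_0 list" and i :: nat
  assumes i: "i < length cs" "cs ! i \<noteq> 0"
begin

lemma fone_value: "fexp_value cs (fone i) = 1"
  using i by (simp add: fone_def)

lemma fsum_value: "fexp_value cs (fsum i fs) = (\<Sum>f\<leftarrow>fs. fexp_value cs f)"
proof -
  have "fexp_value cs (fold FAdd fs acc) = (\<Sum>f\<leftarrow>fs. fexp_value cs f) + fexp_value cs acc" for acc
    by (induction fs arbitrary: acc) (auto simp: add_ac)
  then show ?thesis by (simp add: fsum_def fzero_def)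
qed

lemma fprod_value: "fexp_value cs (fprod i fs) = (\<Prod>f\<leftarrow>fs. fexp_value cs f)"
proof -
  have "fexp_value cs (fold FMul fs acc) = (\<Prod>f\<leftarrow>fs. fexp_value cs f) * fexp_value cs acc" for acc
    by (induction fs arbitrary: acc) (auto simp: mult_ac)
  then show ?thesis by (simp add: fprod_def fone_value)
qed

lemma fnum_value: "fexp_value cs (fnum i n) = of_nat n"
  by (simp add: fnum_def fsum_value fone_value sum_list_replicate)

lemma fpow_value: "fexp_value cs (fpow i x n) = fexp_value cs x ^ n"
  by (simp add: fpow_def fprod_value prod_list_replicate)

lemma fchoose_value: "fexp_value cs (fchoose i e l) = of_nat (e choose l)"
proof -
  have list: "(\<Prod>u\<leftarrow>[0..<l]. of_nat (h u)) = (of_nat (\<Prod>u<l. h u) :: 'a)" for h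
    by (simp add: prod.distinct_set_conv_list[symmetric] atLeast0LessThan)
  have "(\<Prod>u<l. Suc u) = fact l" by (simp add: fact_prod_Suc atLeast0LessThan)
  then show ?thesis
    by (simp add: fchoose_def fprod_value fnum_value o_def list prod_falling del: of_nat_Suc of_nat_prod)
qed

lemma fbinom_value:
  "fexp_value cs (fbinom i e l a b) = coeff ([:of_nat a, of_nat b:] ^ e) l"
proof (cases "l \<le> e")
  case True
  then show ?thesis by (simp add: fbinom_def fchoose_value fpow_value fnum_value coeff_linear_poly_power mult_ac)
next
  case False
  have "degree ([:of_nat a, of_nat b :: 'a:] ^ e) \<le> e" by (rule order.trans[OF degree_power_le]) auto
  then have "coeff ([:of_nat a, of_nat b :: 'a:] ^ e) l = 0" using False by (intro coeff_eq_0) auto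
  then show ?thesis using False by (simp add: fbinom_def fchoose_value binomial_eq_0)
qed

end

section \<open>The coordinates of the generator as expressions\<close>

text \<open>The coefficient of t^i in each product of powers (a_v + b_v t)^(e_v) is expanded over
  the orders taken from the single variables. For \<open>i < n\<close> all these orders are below
  \<open>n\<close>, so \<open>n ^ K\<close> tuples suffice whatever the degree.\<close>

definition fcoord :: "nat \<Rightarrow> nat \<Rightarrow> nat \<Rightarrow> nat \<Rightarrow> (fexp \<times> nat list) list \<Rightarrow> nat list \<Rightarrow> nat list \<Rightarrow> nat \<Rightarrow> fexp" where
  "fcoord i0 M n K ts a b i = fsum i0 (map (\<lambda>t. FMul (fst t) (fsum i0 (map (\<lambda>l. fprod i0 (map (\<lambda>v.
     fbinom i0 (nth0 (snd t) v) (nth0 l v) (nth0 a v) (nth0 b v)) [0..<K]))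
     (filter (\<lambda>l. sum_list l = i) (tuples M [0..<n] [[]] K))))) ts)"

abbreviation enc_terms :: "(fexp \<times> nat list) list \<Rightarrow> tree" where
  "enc_terms \<equiv> enc_list (enc_pair enc_fexp (enc_list enc_nat))"

lemma enc_terms_eq: "enc_list enc_term = enc_terms"
proof -
  have "enc_term = enc_pair enc_fexp (enc_list enc_nat)"
    by (auto simp: enc_term_def enc_pair_def fun_eq_iff)
  then show ?thesis by simp
qed

lemma pt_lift: "pt e e1 f \<Longrightarrow> pt (enc_pair e e2) e1 (\<lambda>p. f (fst p))"
  by (rule pt_comp[OF pt_fst[OF pt_id]])

lemma pt_fcoord:
  assumes "pt e enc_nat M" "pt e enc_nat n" "pt e enc_nat K" "pt e enc_terms ts"
    and "pt e (enc_list enc_nat) a" "pt e (enc_list enc_nat) b" "pt e enc_nat i"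
  shows "pt e enc_fexp (\<lambda>x. fcoord i0 (M x) (n x) (K x) (ts x) (a x) (b x) (i x))"
  unfolding fcoord_def
  by (rule pt_fsum pt_map pt_FMul pt_fprod pt_fbinom pt_nth0 pt_filter pt_tuples pt_upt pt_eq_nat pt_sum_list
      assms assms[THEN pt_lift] assms[THEN pt_lift, THEN pt_lift] assms[THEN pt_lift, THEN pt_lift, THEN pt_lift]
      pt_const pt_fst pt_snd pt_id)+

section \<open>Values of the coordinate expressions\<close>

fun all_tuples :: "'b list \<Rightarrow> nat \<Rightarrow> 'b list list" where
  "all_tuples S 0 = [[]]"
| "all_tuples S (Suc n) = concat (map (\<lambda>t. map (\<lambda>x. x # t) S) (all_tuples S n))"

lemma length_all_tuples: "length (all_tuples S n) = length S ^ n"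
  by (induction n) (auto simp: length_concat o_def sum_list_triv mult.commute)

lemma tuples_eq_all_tuples: "length S ^ n \<le> M \<Longrightarrow> tuples M S [[]] n = all_tuples S n"
proof (induction n)
  case (Suc n)
  show ?case
  proof (cases "S = []")
    case False
    then have "1 \<le> length S" by (cases S) auto
    then have "length S ^ n \<le> length S ^ Suc n" by (intro power_increasing) auto
    then have "length S ^ n \<le> M" using Suc.prems by linarith
    then have "tuples M S [[]] (Suc n) = take M (all_tuples S (Suc n))" using Suc.IH by simp
    then show ?thesis using Suc.prems length_all_tuples[of S "Suc n"] by (simp del: all_tuples.simps)
  next
    case True
    then show ?thesis by (simp add: map_replicate_const)
  qed
qed simp

lemma set_all_tuples: "set (all_tuples S n) = {l. length l = n \<and> set l \<subseteq> set S}"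
proof (induction n)
  case (Suc n)
  show ?case
  proof (intro set_eqI iffI)
    fix l assume "l \<in> {l. length l = Suc n \<and> set l \<subseteq> set S}"
    then show "l \<in> set (all_tuples S (Suc n))" using Suc by (cases l) auto
  qed (use Suc in auto)
qed auto

lemma sum_list_concat_map: "(\<Sum>x\<leftarrow>concat (map g xs). f x) = (\<Sum>y\<leftarrow>xs. \<Sum>x\<leftarrow>g y. f x)"
  by (induction xs) auto

lemma sum_list_swap2: "(\<Sum>x\<leftarrow>xs. \<Sum>y\<leftarrow>ys. f x y) = (\<Sum>y\<leftarrow>ys. \<Sum>x\<leftarrow>xs. (f x y :: 'c::comm_monoid_add))"
  by (induction xs) (auto simp: sum_list_addf)

text \<open>Iterated Cauchy product; orders that add up to \<open>i < n\<close> are all below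
  \<open>n\<close>, so the enumeration misses none.\<close>

lemma coeff_prod_list_tuples:
  fixes p :: "nat \<Rightarrow> 'a::comm_ring_1 poly"
  assumes "i < n"
  shows "coeff (\<Prod>v<K. p v) i = (\<Sum>l\<leftarrow>filter (\<lambda>l. sum_list l = i) (all_tuples [0..<n] K). \<Prod>v<K. coeff (p v) (l ! v))"
  using assms
proof (induction K arbitrary: p i)
  case (Suc K)
  let ?T = "all_tuples [0..<n] K"
  have "(\<Sum>l\<leftarrow>filter (\<lambda>l. sum_list l = i) (all_tuples [0..<n] (Suc K)). \<Prod>v<Suc K. coeff (p v) (l ! v)) =
    (\<Sum>t\<leftarrow>?T. \<Sum>x\<leftarrow>[0..<n]. if x + sum_list t = i then coeff (p 0) x * (\<Prod>v<K. coeff (p (Suc v)) (t ! v)) else 0)"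
    by (simp add: sum_list_map_filter' sum_list_concat_map o_def prod.lessThan_Suc_shift del: prod.lessThan_Suc cong: if_cong)
  also have "\<dots> = (\<Sum>x\<leftarrow>[0..<n]. \<Sum>t\<leftarrow>?T. if x + sum_list t = i then coeff (p 0) x * (\<Prod>v<K. coeff (p (Suc v)) (t ! v)) else 0)"
    by (rule sum_list_swap2)
  also have "\<dots> = (\<Sum>x\<leftarrow>[0..<n]. if x \<le> i then coeff (p 0) x * coeff (\<Prod>v<K. p (Suc v)) (i - x) else 0)"
  proof (intro arg_cong[of _ _ sum_list] map_cong refl)
    fix x
    show "(\<Sum>t\<leftarrow>?T. if x + sum_list t = i then coeff (p 0) x * (\<Prod>v<K. coeff (p (Suc v)) (t ! v)) else 0) =
      (if x \<le> i then coeff (p 0) x * coeff (\<Prod>v<K. p (Suc v)) (i - x) else 0)"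
    proof (cases "x \<le> i")
      case True
      have "coeff (\<Prod>v<K. p (Suc v)) (i - x) =
        (\<Sum>l\<leftarrow>filter (\<lambda>l. sum_list l = i - x) ?T. \<Prod>v<K. coeff (p (Suc v)) (l ! v))"
        by (rule Suc.IH) (use Suc.prems in auto)
      moreover have "(x + sum_list t = i) = (sum_list t = i - x)" for t using True by auto
      ultimately show ?thesis using True
        by (simp add: sum_list_map_filter' sum_list_const_mult if_distrib cong: if_cong flip: sum_list_const_mult)
    next
      case False
      then have "x + sum_list t \<noteq> i" for t by auto
      then show ?thesis using False by simp
    qed
  qed
  also have "\<dots> = (\<Sum>x<n. if x \<le> i then coeff (p 0) x * coeff (\<Prod>v<K. p (Suc v)) (i - x) else 0)"
    by (simp add: sum.distinct_set_conv_list[symmetric] atLeast0LessThan)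
  also have "\<dots> = (\<Sum>x\<le>i. coeff (p 0) x * coeff (\<Prod>v<K. p (Suc v)) (i - x))"
    using Suc.prems by (intro sum.mono_neutral_cong_right) auto
  also have "\<dots> = coeff (\<Prod>v<Suc K. p v) i"
    by (simp add: prod.lessThan_Suc_shift coeff_mult del: prod.lessThan_Suc)
  finally show ?case ..
qed simp

lemma fcoord_value:
  fixes cs :: "'a::field_char_0 list"
  assumes "i0 < length cs" "cs ! i0 \<noteq> 0" "n ^ K \<le> M" "i < n"
    and "length a = K" "length b = K" "\<And>c es. (c, es) \<in> set ts \<Longrightarrow> length es = K"
  shows "fexp_value cs (fcoord i0 M n K ts a b i) =
    (\<Sum>(c, es)\<leftarrow>ts. fexp_value cs c * coeff (\<Prod>v<K. [:of_nat (a ! v), of_nat (b ! v):] ^ (es ! v)) i)"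
proof -
  note val = fsum_value[OF assms(1,2)] fprod_value[OF assms(1,2)] fbinom_value[OF assms(1,2)]
  have tup: "tuples M [0..<n] [[]] K = all_tuples [0..<n] K"
    using assms(3) by (intro tuples_eq_all_tuples) simp
  have "(\<Prod>v\<leftarrow>[0..<K]. coeff ([:of_nat (nth0 a v), of_nat (nth0 b v):] ^ nth0 es v) (nth0 l v)) =
      (\<Prod>v<K. coeff ([:of_nat (a ! v), of_nat (b ! v) :: 'a:] ^ (es ! v)) (l ! v))"
    if "length es = K" "length l = K" for es l
    using that assms(5,6)
    by (simp add: prod.distinct_set_conv_list[symmetric] atLeast0LessThan nth0_def)
  then have "(\<Sum>l\<leftarrow>filter (\<lambda>l. sum_list l = i) (all_tuples [0..<n] K). \<Prod>v\<leftarrow>[0..<K].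
      coeff ([:of_nat (nth0 a v), of_nat (nth0 b v) :: 'a:] ^ nth0 es v) (nth0 l v)) =
      coeff (\<Prod>v<K. [:of_nat (a ! v), of_nat (b ! v):] ^ (es ! v)) i" if "length es = K" for es
    unfolding coeff_prod_list_tuples[OF assms(4)] using that
    by (intro arg_cong[of _ _ sum_list] map_cong) (auto simp: set_all_tuples)
  then show ?thesis unfolding fcoord_def tup val using assms(7)
    by (auto simp: val o_def case_prod_unfold intro!: arg_cong[of _ _ sum_list])
qed

section \<open>The search for the hard polynomial\<close>

text \<open>The given algorithm need not be polynomial in the size of its input, so it is not
  treated as a \<open>pt\<close> function: its time \<open>t\<close> on the queried input enters the
  bound next to the input size. The first component of \<open>pre x\<close> is saved during the
  call.\<close>

lemma runs_oracle:
  assumes pre: "pt e1 (enc_pair e2 e3) pre" and post: "pt (enc_pair e2 e4) e5 post"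
  shows "\<exists>N p b. \<forall>x z t. outputs_in_time A (e3 (snd (pre x))) (e4 z) t \<longrightarrow>
    (\<exists>t'\<le>b * Suc (size (e1 x) + t) ^ b. runs N p (e1 x) (e5 (post (fst (pre x), z))) t')"
proof -
  obtain N0 p0 a0 where 0: "\<And>x. \<exists>t \<le> a0 * Suc (size (e1 x)) ^ a0. runs N0 p0 (e1 x) (enc_pair e2 e3 (pre x)) t"
    "\<And>x. size (enc_pair e2 e3 (pre x)) \<le> size (e1 x) + a0 * Suc (size (e1 x)) ^ a0"
    using pre by (rule ptE) blast
  obtain N1 p1 a1 where 1: "N1 \<ge> 1"
    "\<And>y. \<exists>t \<le> a1 * Suc (size (enc_pair e2 e3 y)) ^ a1. runs N1 p1 (enc_pair e2 e3 y) (e2 (fst y)) t"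
    using pt_fst[OF pt_id, of e2 e3] by (rule ptE) blast
  obtain N2 p2 a2 where 2:
    "\<And>y. \<exists>t \<le> a2 * Suc (size (enc_pair e2 e3 y)) ^ a2. runs N2 p2 (enc_pair e2 e3 y) (e3 (snd y)) t"
    using pt_snd[OF pt_id, of e2 e3] by (rule ptE) blast
  obtain N3 p3 a3 where 3:
    "\<And>y. \<exists>t \<le> a3 * Suc (size (enc_pair e2 e4 y)) ^ a3. runs N3 p3 (enc_pair e2 e4 y) (e5 (post y)) t"
    using post by (rule ptE) blast
  define n0 where "n0 = prog_bound A"
  let ?A = "Seq A (clear n0)"
  let ?N = "max (max N1 N2) (Suc n0)"
  let ?M = "max (max N0 (?N + 2)) N3"
  let ?p = "Seq p0 (Seq (pair_prog ?N p1 (Seq p2 ?A)) p3)"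
  let ?S = "\<lambda>n. n + a0 * Suc n ^ a0"
  let ?S1 = "\<lambda>n. ?S n + ?S n + n + 1"
  let ?T = "\<lambda>n. a0 * Suc n ^ a0 + ((a1 * Suc (?S n) ^ a1 + (a2 * Suc (?S n) ^ a2 + (n + Suc n0)) +
    (2 * ?S n + 2 * ?S n + (?S n + n) + 7)) + a3 * Suc (?S1 n) ^ a3)"
  have "polyb ?T" by (intro polyb_intros)
  then obtain b where b: "\<And>n. ?T n \<le> b * Suc n ^ b" unfolding polyb_def by blast
  show ?thesis
  proof (rule exI[of _ ?M], rule exI[of _ ?p], rule exI[of _ b], intro allI impI)
    fix x z t assume A: "outputs_in_time A (e3 (snd (pre x))) (e4 z) t"
    let ?n = "size (e1 x) + t"
    let ?y = "pre x"
    obtain t0 where t0: "t0 \<le> a0 * Suc (size (e1 x)) ^ a0" "runs N0 p0 (e1 x) (enc_pair e2 e3 ?y) t0" using 0 by blast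
    obtain t1 where t1: "t1 \<le> a1 * Suc (size (enc_pair e2 e3 ?y)) ^ a1" "runs N1 p1 (enc_pair e2 e3 ?y) (e2 (fst ?y)) t1" using 1 by blast
    obtain t2 where t2: "t2 \<le> a2 * Suc (size (enc_pair e2 e3 ?y)) ^ a2" "runs N2 p2 (enc_pair e2 e3 ?y) (e3 (snd ?y)) t2" using 2 by blast
    have rA: "runs (Suc n0) ?A (e3 (snd ?y)) (e4 z) (t + Suc n0)" by (rule runs_of_outputs[OF A n0_def])
    have S0: "size (enc_pair e2 e3 ?y) \<le> ?S ?n"
      using 0(2)[of x] poly_bound_mono[OF order_refl le_add1, of a0 "size (e1 x)" t] by linarith
    obtain t3 where t3: "t3 \<le> a3 * Suc (size (enc_pair e2 e4 (fst ?y, z))) ^ a3"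
      "runs N3 p3 (enc_pair e2 e4 (fst ?y, z)) (e5 (post (fst ?y, z))) t3" using 3 by blast
    have zsize: "size (e4 z) \<le> size (e3 (snd ?y)) + t"
    proof -
      obtain \<tau> where \<tau>: "exec A ((\<lambda>_. Leaf)(0 := e3 (snd ?y))) t \<tau>" "\<tau> 0 = e4 z"
        using A unfolding outputs_in_time_def by blast
      then show ?thesis using exec_size[OF \<tau>(1), of 0] by simp
    qed
    have y1: "size (e2 (fst ?y)) \<le> ?S ?n" "size (e3 (snd ?y)) \<le> ?S ?n" using S0 by auto
    have S1: "size (enc_pair e2 e4 (fst ?y, z)) \<le> ?S1 ?n" using zsize y1 by simp
    let ?tp = "t1 + (t2 + (t + Suc n0)) + (2 * size (enc_pair e2 e3 ?y) + 2 * size (e2 (fst ?y)) + size (e4 z) + 7)"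
    have r1: "runs (?N + 2) (pair_prog ?N p1 (Seq p2 ?A)) (enc_pair e2 e3 ?y) (Node (e2 (fst ?y)) (e4 z)) ?tp"
      by (rule runs_pair[OF runs_mono[OF t1(2)] runs_seq[OF runs_mono[OF t2(2)] runs_mono[OF rA]]])
        (use 1(1) in auto)
    have le: "?N + 2 \<le> ?M" by simp
    have eq: "Node (e2 (fst ?y)) (e4 z) = enc_pair e2 e4 (fst ?y, z)" by (simp add: enc_pair_def)
    have pr: "runs ?M (pair_prog ?N p1 (Seq p2 ?A)) (enc_pair e2 e3 ?y) (enc_pair e2 e4 (fst ?y, z)) ?tp"
      using runs_mono[OF r1 le] unfolding eq .
    have "runs ?M ?p (e1 x) (e5 (post (fst ?y, z))) (t0 + (?tp + t3))"
      by (rule runs_seq[OF runs_mono[OF t0(2)] runs_seq[OF pr runs_mono[OF t3(2)]]]) auto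
    moreover have "t0 + (?tp + t3) \<le> ?T ?n"
    proof -
      have "t0 \<le> a0 * Suc ?n ^ a0" using t0(1) poly_bound_mono[OF order_refl le_add1, of a0 "size (e1 x)" t] by linarith
      moreover have "t1 \<le> a1 * Suc (?S ?n) ^ a1" using t1(1) poly_bound_mono[OF order_refl S0, of a1] by linarith
      moreover have "t2 \<le> a2 * Suc (?S ?n) ^ a2" using t2(1) poly_bound_mono[OF order_refl S0, of a2] by linarith
      moreover have "t3 \<le> a3 * Suc (?S1 ?n) ^ a3" using t3(1) poly_bound_mono[OF order_refl S1, of a3] by linarith
      moreover have "t + Suc n0 \<le> ?n + Suc n0" by simp
      moreover have "2 * size (enc_pair e2 e3 ?y) + 2 * size (e2 (fst ?y)) + size (e4 z) + 7 \<le>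
          2 * ?S ?n + 2 * ?S ?n + (?S ?n + ?n) + 7"
      proof -
        have "t \<le> ?n" by simp
        then have "size (e4 z) \<le> ?S ?n + ?n" using zsize y1(2) by (meson add_mono order.trans)
        then show ?thesis by (intro add_mono mult_left_mono S0 y1(1)) auto
      qed
      ultimately show ?thesis by linarith
    qed
    ultimately show "\<exists>t'\<le>b * Suc ?n ^ b. runs ?M ?p (e1 x) (e5 (post (fst ?y, z))) t'"
      using b[of ?n] by (meson order.trans)
  qed
qed

section \<open>The search loop\<close>

type_synonym sstate = "nat \<times> nat \<times> nat \<times> nat"

abbreviation enc_sstate :: "sstate \<Rightarrow> tree" where
  "enc_sstate \<equiv> enc_pair enc_nat (enc_pair enc_nat (enc_pair enc_nat enc_nat))"

abbreviation enc_search :: "bool \<times> sstate \<times> (fexp \<times> nat list) list \<Rightarrow> tree" where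
  "enc_search \<equiv> enc_pair enc_bool (enc_pair enc_sstate enc_terms)"

text \<open>The function \<open>k\<close> comes without an algorithm of its own; its value is read
  off the exponent vector of the first printed term.\<close>

definition nvars :: "(fexp \<times> nat list) list \<Rightarrow> nat" where
  "nvars ts = length (concat (map snd (take 1 ts)))"

text \<open>\<open>X\<close> and \<open>M\<close> hold \<open>(s + 2) ^ j\<close> and
  \<open>(s + 2) ^ (j * j)\<close>, the latter updated by (j + 1)^2 = j^2 + 2 j + 1. The second
  component of the result is the next degree to be queried.\<close>

definition search_pre :: "nat \<Rightarrow> bool \<times> sstate \<times> (fexp \<times> nat list) list \<Rightarrow> sstate \<times> nat" where
  "search_pre C x = (case x of (fl, (s, j, X, M), ts) \<Rightarrow>
     ((s, Suc j, X * Suc (Suc s), M * (X * X * Suc (Suc s))), (X * Suc (Suc s)) ^ C))"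

definition search_post :: "sstate \<times> (fexp \<times> nat list) list \<Rightarrow> bool \<times> sstate \<times> (fexp \<times> nat list) list" where
  "search_post y = (if nvars (snd y) \<le> fst (snd (fst y)) then False else True, y)"

definition search_state :: "nat \<Rightarrow> nat \<Rightarrow> sstate" where
  "search_state s j = (s, j, (s + 2) ^ j, (s + 2) ^ (j * j))"

lemma pt_search_pre: "pt enc_search (enc_pair enc_sstate enc_nat) (search_pre C)"
proof -
  have "pt enc_search (enc_pair enc_sstate enc_nat) (\<lambda>x. ((fst (fst (snd x)), Suc (fst (snd (fst (snd x)))),
    fst (snd (snd (fst (snd x)))) * Suc (Suc (fst (fst (snd x)))),
    snd (snd (snd (fst (snd x)))) * (fst (snd (snd (fst (snd x)))) * fst (snd (snd (fst (snd x)))) * Suc (Suc (fst (fst (snd x)))))),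
    (fst (snd (snd (fst (snd x)))) * Suc (Suc (fst (fst (snd x))))) ^ C))"
    by (rule pt_intros)+
  then show ?thesis by (rule pt_enc) (simp add: search_pre_def case_prod_unfold)
qed

lemma pt_nvars: "pt e enc_terms f \<Longrightarrow> pt e enc_nat (\<lambda>x. nvars (f x))"
  unfolding nvars_def by (rule pt_length pt_concat pt_map pt_take pt_const pt_snd pt_id | assumption)+

lemma pt_search_post: "pt (enc_pair enc_sstate enc_terms) enc_search search_post"
  unfolding search_post_def by (rule pt_nvars pt_intros)+

text \<open>Before the stop \<open>k\<close> exceeds \<open>j\<close> at the queried degrees, but by
  monotonicity all these values are bounded by the one at the stop, hence by \<open>J s\<close>. So
  the time of every call of \<open>A\<close> is polynomial in
  \<open>(s + 2) ^ (J s * J s)\<close>.\<close>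

lemma search_program:
  fixes tsf :: "nat \<Rightarrow> (fexp \<times> nat list) list"
  assumes A: "\<And>d. outputs_in_time A (enc_nat d) (enc_terms (tsf d)) (tf d)"
    and tf: "\<And>d. tf d \<le> c * (d ^ k d) ^ c + c"
    and k: "\<And>d. d \<ge> 1 \<Longrightarrow> nvars (tsf d) = k d" "mono k"
    and ex: "\<And>s. \<exists>j\<ge>1. k ((s + 2) ^ (j * C)) \<le> j"
    and F: "pt enc_search eF F"
  defines "J \<equiv> \<lambda>s. LEAST j. j \<ge> 1 \<and> k ((s + 2) ^ (j * C)) \<le> j"
  shows "\<exists>p a. \<forall>s. \<exists>t\<le>a * Suc ((s + 2) ^ (J s * J s)) ^ a.
    outputs_in_time p (enc_nat s) (eF (F (False, search_state s (J s), tsf ((s + 2) ^ (J s * C))))) t"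
proof -
  obtain N p b where body: "\<And>x z t. outputs_in_time A (enc_nat (snd (search_pre C x))) (enc_terms z) t \<Longrightarrow>
    \<exists>t'\<le>b * Suc (size (enc_search x) + t) ^ b. runs N p (enc_search x) (enc_search (search_post (fst (search_pre C x), z))) t'"
    using runs_oracle[OF pt_search_pre pt_search_post, of A] by blast
  have "pt enc_nat enc_search (\<lambda>s. (True, (s, 0, 1, 1), []))" by (rule pt_intros)+
  then obtain Ni pi ai where init:
    "\<And>s. \<exists>t \<le> ai * Suc (size (enc_nat s)) ^ ai. runs Ni pi (enc_nat s) (enc_search (True, (s, 0, 1, 1), [])) t"
    by (rule ptE) blast
  obtain Nf pf af where fin:
    "\<And>x. \<exists>t \<le> af * Suc (size (enc_search x)) ^ af. runs Nf pf (enc_search x) (eF (F x)) t"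
    using F by (rule ptE) blast
  let ?U = "\<lambda>M. c * (M ^ C) ^ c + c"
  let ?V = "\<lambda>M. 4 * M + (M ^ C + ?U M) + 6"
  let ?W = "\<lambda>M. b * Suc (?V M + ?U M) ^ b"
  let ?T = "\<lambda>M. ai * Suc M ^ ai + ((M * Suc (?W M) + 1) + af * Suc (?V M) ^ af)"
  have "polyb ?T" by (intro polyb_intros)
  then obtain a where a: "\<And>n. ?T n \<le> a * Suc n ^ a" unfolding polyb_def by blast
  let ?p = "Seq pi (Seq (While (LeftE (Get 0)) p) pf)"
  show ?thesis
  proof (rule exI[of _ ?p], rule exI[of _ a], rule allI)
    fix s :: nat
    define B where "B = s + 2"
    define n where "n = J s"
    define M where "M = B ^ (n * n)"
    have B: "B \<ge> 2" by (simp add: B_def)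
    have n: "n \<ge> 1 \<and> k (B ^ (n * C)) \<le> n"
      unfolding n_def J_def B_def by (rule LeastI_ex[OF ex])
    have less: "\<not> k (B ^ (j * C)) \<le> j" if "1 \<le> j" "j < n" for j
      using not_less_Least[of j "\<lambda>j. j \<ge> 1 \<and> k ((s + 2) ^ (j * C)) \<le> j"] that
      unfolding n_def J_def B_def by blast
    \<comment> \<open>At \<open>j = 0\<close> the flag is set without a query, since candidates
      start at 1.\<close>
    define x where "x j = (if j = 0 then (True, (s, 0, 1, 1), [])
      else (\<not> k (B ^ (j * C)) \<le> j, search_state s j, tsf (B ^ (j * C))))" for j
    have kn: "nvars (tsf (B ^ j)) = k (B ^ j)" for j by (rule k(1)) (simp add: B_def)
    have pre: "search_pre C (x j) = (search_state s (Suc j), B ^ (Suc j * C))" for j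
    proof -
      have SB: "Suc (Suc s) = B" by (simp add: B_def)
      have 1: "B ^ j * B = B ^ Suc j" by simp
      have "Suc j * Suc j = j * j + (j + j + 1)" by simp
      then have "B ^ (Suc j * Suc j) = B ^ (j * j + (j + j + 1))" by (simp only:)
      then have 2: "B ^ (j * j) * (B ^ j * B ^ j * B) = B ^ (Suc j * Suc j)" by (simp only: power_add power_one_right)
      have pm: "(B ^ Suc j) ^ C = B ^ (Suc j * C)" by (simp only: power_mult)
      have "fst (snd (x j)) = (s, j, B ^ j, B ^ (j * j))"
        by (simp add: x_def search_state_def B_def)
      then obtain fl ts where "x j = (fl, (s, j, B ^ j, B ^ (j * j)), ts)" by (metis prod.collapse)
      then show ?thesis
        by (simp only: search_pre_def prod.case SB 1 2 search_state_def B_def[symmetric] pm)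
    qed
    have post: "search_post (search_state s (Suc j), tsf (B ^ (Suc j * C))) = x (Suc j)" for j
      by (simp add: search_post_def kn x_def search_state_def del: mult_Suc)
    have nM: "n \<le> M" "s \<le> M"
    proof -
      have "n < B ^ n" using B by (intro power_gt_expt) auto
      also have "B ^ n \<le> M" unfolding M_def using B by (intro power_increasing) auto
      finally show "n \<le> M" by simp
      have "B ^ 1 \<le> M" unfolding M_def using B n by (intro power_increasing) (auto simp: Suc_le_eq)
      then show "s \<le> M" by (simp add: B_def)
    qed
    have dM: "B ^ (j * C) \<le> M ^ C" if "j \<le> n" for j
    proof -
      have "j \<le> n * n" using that n by (meson le_square order.trans)
      then have "B ^ j \<le> M" unfolding M_def using B by (intro power_increasing) auto
      then show ?thesis by (simp add: power_mult power_mono)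
    qed
    have tU: "tf (B ^ (j * C)) \<le> ?U M" if "j \<le> n" for j
    proof -
      have "B ^ (j * C) \<le> B ^ (n * C)" using B that by (intro power_increasing) auto
      then have "k (B ^ (j * C)) \<le> n" using n monoD[OF k(2)] by (meson order.trans)
      then have "(B ^ (j * C)) ^ k (B ^ (j * C)) \<le> (B ^ (j * C)) ^ n"
        using B by (intro power_increasing) auto
      also have "\<dots> \<le> (B ^ (n * C)) ^ n" using \<open>B ^ (j * C) \<le> B ^ (n * C)\<close> by (intro power_mono) auto
      also have "\<dots> = M ^ C" by (simp add: M_def mult_ac flip: power_mult)
      finally have "c * ((B ^ (j * C)) ^ k (B ^ (j * C))) ^ c + c \<le> ?U M"
        by (intro add_mono mult_left_mono power_mono) auto
      then show ?thesis using tf[of "B ^ (j * C)"] by linarith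
    qed
    have xV: "size (enc_search (x j)) \<le> ?V M" if "j \<le> n" for j
    proof (cases "j = 0")
      case True
      have "size (enc_search (x j)) \<le> 4 * M + 6"
        using True nM n by (simp add: x_def enc_bool_def)
      then show ?thesis by linarith
    next
      case False
      obtain \<tau> where \<tau>: "exec A ((\<lambda>_. Leaf)(0 := enc_nat (B ^ (j * C)))) (tf (B ^ (j * C))) \<tau>"
        "\<tau> 0 = enc_terms (tsf (B ^ (j * C)))"
        using A unfolding outputs_in_time_def by blast
      have "size (enc_terms (tsf (B ^ (j * C)))) \<le> B ^ (j * C) + tf (B ^ (j * C))"
        using exec_size[OF \<tau>(1), of 0] \<tau>(2) by simp
      then have 1: "size (enc_terms (tsf (B ^ (j * C)))) \<le> M ^ C + ?U M" using dM[OF that] tU[OF that] by linarith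
      have "B ^ (j * j) \<le> M" "B ^ j \<le> M"
        unfolding M_def using B that by (intro power_increasing mult_mono; auto intro: order.trans[OF _ le_square])+
      then have 2: "size (enc_sstate (search_state s j)) \<le> 4 * M + 3"
        using nM that by (simp add: search_state_def B_def)
      have 3: "size (enc_search (x j)) \<le> 1 + size (enc_sstate (search_state s j)) + size (enc_terms (tsf (B ^ (j * C)))) + 2"
        using False by (simp add: x_def enc_bool_def)
      show ?thesis using 1 2 3 by linarith
    qed
    have step: "\<exists>t\<le>?W M. runs N p (enc_search (x j)) (enc_search (x (Suc j))) t" if "j < n" for j
    proof -
      have "outputs_in_time A (enc_nat (snd (search_pre C (x j)))) (enc_terms (tsf (B ^ (Suc j * C)))) (tf (B ^ (Suc j * C)))"
        unfolding pre snd_conv by (rule A)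
      from body[OF this] obtain t where t: "t \<le> b * Suc (size (enc_search (x j)) + tf (B ^ (Suc j * C))) ^ b"
        "runs N p (enc_search (x j)) (enc_search (x (Suc j))) t"
        unfolding pre fst_conv post by blast
      have "size (enc_search (x j)) + tf (B ^ (Suc j * C)) \<le> ?V M + ?U M"
        using xV[of j] tU[of "Suc j"] that by (intro add_mono) auto
      then have "t \<le> ?W M" using t(1) poly_bound_mono[OF order_refl, of _ _ b] by (meson order.trans)
      then show ?thesis using t(2) by blast
    qed
    then obtain tt where tt: "\<And>j. j < n \<Longrightarrow> tt j \<le> ?W M \<and> runs N p (enc_search (x j)) (enc_search (x (Suc j))) (tt j)"
      by metis
    have loop: "runs N (While (LeftE (Get 0)) p) (enc_search (x 0)) (enc_search (x n)) ((\<Sum>j<n. Suc (tt j)) + 1)"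
    proof (rule runs_while)
      show "\<And>i. i < n \<Longrightarrow> runs N p (enc_search (x i)) (enc_search (x (Suc i))) (tt i)" using tt by blast
      show "left_of (enc_search (x i)) \<noteq> Leaf" if "i < n" for i
        using less[of i] that by (cases "i = 0") (auto simp: x_def enc_pair_def enc_bool_def)
      show "left_of (enc_search (x n)) = Leaf"
        using n by (auto simp: x_def enc_pair_def enc_bool_def)
    qed
    have loopt: "(\<Sum>j<n. Suc (tt j)) + 1 \<le> M * Suc (?W M) + 1"
    proof -
      have "(\<Sum>j<n. Suc (tt j)) \<le> (\<Sum>j<n. Suc (?W M))" using tt by (intro sum_mono) auto
      also have "\<dots> \<le> M * Suc (?W M)" using nM(1) by (simp del: mult_Suc_right)
      finally show ?thesis by simp
    qed
    obtain ti where ti: "ti \<le> ai * Suc (size (enc_nat s)) ^ ai" "runs Ni pi (enc_nat s) (enc_search (x 0)) ti"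
      using init[of s] by (auto simp: x_def)
    obtain te where te: "te \<le> af * Suc (size (enc_search (x n))) ^ af" "runs Nf pf (enc_search (x n)) (eF (F (x n))) te"
      using fin by blast
    let ?t = "ti + ((\<Sum>j<n. Suc (tt j)) + 1 + te)"
    let ?N = "max Ni (max N Nf)"
    have "runs ?N ?p (enc_nat s) (eF (F (x n))) ?t"
      by (rule runs_seq[OF runs_mono[OF ti(2)] runs_seq[OF runs_mono[OF loop] runs_mono[OF te(2)]]]) auto
    then have out: "outputs_in_time ?p (enc_nat s) (eF (F (x n))) ?t" by (rule runs_outputs)
    have "ti \<le> ai * Suc M ^ ai" using ti(1) poly_bound_mono[OF order_refl nM(2), of ai]
      unfolding size_enc_nat by linarith
    moreover have "te \<le> af * Suc (?V M) ^ af" using te(1) poly_bound_mono[OF order_refl xV[OF order_refl], of af] by linarith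
    ultimately have "?t \<le> ?T M" using loopt by linarith
    then have "?t \<le> a * Suc M ^ a" using a[of M] by linarith
    moreover have "x n = (False, search_state s n, tsf (B ^ (n * C)))" using n by (simp add: x_def)
    ultimately show "\<exists>t\<le>a * Suc ((s + 2) ^ (J s * J s)) ^ a.
      outputs_in_time ?p (enc_nat s) (eF (F (False, search_state s (J s), tsf ((s + 2) ^ (J s * C))))) t"
      using out unfolding n_def M_def B_def by auto
  qed
qed

section \<open>The list of points\<close>

definition split_term :: "nat \<Rightarrow> nat \<Rightarrow> fexp \<times> nat list \<Rightarrow> fexp \<times> nat list" where
  "split_term b L t = (fst t, concat (map (digits b (Suc L)) (snd t)))"

text \<open>\<open>K * b\<close> bounds the degree of the split polynomial, so
  \<open>s * (K * b)\<close> bounds the individual degree of \<open>f\<close> composed with the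
  generator; the grid has one node more per coordinate.\<close>

definition seeds :: "nat \<Rightarrow> nat \<Rightarrow> nat \<Rightarrow> nat \<Rightarrow> nat list list" where
  "seeds R s K b = tuples R [0..<Suc (s * (K * b))] [[]] K"

definition gen_points :: "nat \<Rightarrow> nat \<Rightarrow> nat \<Rightarrow> nat \<Rightarrow> nat \<Rightarrow> (fexp \<times> nat list) list \<Rightarrow> fexp list list" where
  "gen_points i0 R s K b ts = concat (map (\<lambda>x. map (\<lambda>y. map (fcoord i0 R s K ts x y) [0..<s]) (seeds R s K b)) (seeds R s K b))"

text \<open>Distinct seeds may have equal images. The constant points at the end give the set a
  guaranteed minimal cardinality against which the running time can be measured.\<close>

definition hit_points :: "nat \<Rightarrow> nat \<Rightarrow> nat \<Rightarrow> nat \<Rightarrow> bool \<times> sstate \<times> (fexp \<times> nat list) list \<Rightarrow> fexp list list" where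
  "hit_points i0 g L w x = (case x of (fl, (s, j, X, M), ts) \<Rightarrow>
     gen_points i0 (M ^ w) s (nvars ts * Suc L) (X ^ g) (map (split_term (X ^ g) L) ts) @
     map (\<lambda>u. replicate s (fnum i0 u)) [0..<M ^ w])"

lemma pt_split_terms:
  assumes "pt e enc_nat b" "pt e enc_terms ts"
  shows "pt e enc_terms (\<lambda>x. map (split_term (b x) L) (ts x))"
  unfolding split_term_def
  by (rule pt_map pt_pair pt_concat pt_digits assms assms[THEN pt_lift] assms[THEN pt_lift, THEN pt_lift]
      pt_const pt_fst pt_snd pt_id)+

lemma pt_seeds:
  assumes "pt e enc_nat R" "pt e enc_nat s" "pt e enc_nat K" "pt e enc_nat b"
  shows "pt e (enc_list (enc_list enc_nat)) (\<lambda>x. seeds (R x) (s x) (K x) (b x))"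
  unfolding seeds_def by (rule pt_tuples pt_upt pt_Suc pt_mult pt_const assms)+

lemma pt_gen_points:
  assumes "pt e enc_nat R" "pt e enc_nat s" "pt e enc_nat K" "pt e enc_nat b" "pt e enc_terms ts"
  shows "pt e (enc_list (enc_list enc_fexp)) (\<lambda>x. gen_points i0 (R x) (s x) (K x) (b x) (ts x))"
  unfolding gen_points_def
  by (rule pt_concat pt_map pt_seeds pt_fcoord pt_upt assms assms[THEN pt_lift] assms[THEN pt_lift, THEN pt_lift]
      assms[THEN pt_lift, THEN pt_lift, THEN pt_lift] pt_fst pt_snd pt_id)+

lemma pt_hit_points: "pt enc_search (enc_list (enc_list enc_fexp)) (hit_points i0 g L w)"
proof -
  have "pt enc_search (enc_list (enc_list enc_fexp)) (\<lambda>x.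
    gen_points i0 (snd (snd (snd (fst (snd x)))) ^ w) (fst (fst (snd x))) (nvars (snd (snd x)) * Suc L)
      (fst (snd (snd (fst (snd x)))) ^ g) (map (split_term (fst (snd (snd (fst (snd x)))) ^ g) L) (snd (snd x))) @
    map (\<lambda>u. replicate (fst (fst (snd x))) (fnum i0 u)) [0..<snd (snd (snd (fst (snd x)))) ^ w])"
    by (rule pt_append pt_gen_points pt_split_terms pt_power pt_mult pt_nvars pt_map pt_replicate pt_fnum pt_upt
        pt_const pt_fst pt_snd pt_id)+
  then show ?thesis by (rule pt_enc) (simp add: hit_points_def case_prod_unfold)
qed

section \<open>Splitting exponents into digits\<close>

lemma digit_expansion:
  fixes b n l :: nat
  assumes "n < b ^ l"
  shows "(\<Sum>u<l. (n div b ^ u mod b) * b ^ u) = n"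
  using assms
proof (induction l arbitrary: n)
  case (Suc l)
  have "n div b < b ^ l" using Suc.prems by (simp add: less_mult_imp_div_less mult.commute)
  have "(\<Sum>u<Suc l. (n div b ^ u mod b) * b ^ u) = n mod b + (\<Sum>u<l. (n div b ^ Suc u mod b) * b ^ Suc u)"
    by (subst sum.lessThan_Suc_shift) simp
  also have "(\<Sum>u<l. (n div b ^ Suc u mod b) * b ^ Suc u) = b * (\<Sum>u<l. ((n div b) div b ^ u mod b) * b ^ u)"
    by (simp add: sum_distrib_left div_mult2_eq mult_ac)
  also have "\<dots> = b * (n div b)" using Suc.IH[OF \<open>n div b < b ^ l\<close>] by simp
  finally show ?case by simp
qed simp

definition split_exps :: "nat \<Rightarrow> nat \<Rightarrow> nat list \<Rightarrow> nat list" where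
  "split_exps b L es = concat (map (digits b (Suc L)) es)"

lemma length_split_exps: "length (split_exps b L es) = length es * Suc L"
  by (induction es) (auto simp: split_exps_def digits_def)

lemma nth_split_exps:
  "i < length es \<Longrightarrow> u < Suc L \<Longrightarrow> split_exps b L es ! (i * Suc L + u) = es ! i div b ^ u mod b"
proof (induction es arbitrary: i)
  case (Cons e es)
  have split: "split_exps b L (e # es) = digits b (Suc L) e @ split_exps b L es"
    by (simp add: split_exps_def)
  have len: "length (digits b (Suc L) e) = Suc L" by (simp add: digits_def)
  show ?case
  proof (cases i)
    case 0
    then show ?thesis using Cons.prems(2) by (simp only: split nth_append len) (simp add: digits_def del: upt_Suc)
  next
    case (Suc i')
    then have "i * Suc L + u - Suc L = i' * Suc L + u" "\<not> i * Suc L + u < Suc L" by auto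
    then have "split_exps b L (e # es) ! (i * Suc L + u) = split_exps b L es ! (i' * Suc L + u)"
      by (simp only: split nth_append len if_False)
    then show ?thesis using Cons.IH[of i'] Cons.prems Suc by simp
  qed
qed simp

lemma split_exps_less: "b \<ge> 1 \<Longrightarrow> e \<in> set (split_exps b L es) \<Longrightarrow> e < b"
  by (auto simp: split_exps_def digits_def)

definition split_mon :: "nat \<Rightarrow> nat \<Rightarrow> nat \<Rightarrow> (nat \<Rightarrow>\<^sub>0 nat) \<Rightarrow> (nat \<Rightarrow>\<^sub>0 nat)" where
  "split_mon b L k mon = Poly_Mapping.nth (split_exps b L (map (lookup mon) [0..<k]))"

definition split_poly :: "nat \<Rightarrow> nat \<Rightarrow> nat \<Rightarrow> 'a::comm_monoid_add mpoly \<Rightarrow> 'a mpoly" where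
  "split_poly b L k p = (\<Sum>mon\<in>keys p. Poly_Mapping.single (split_mon b L k mon) (lookup p mon))"

lemma split_poly_add: "split_poly b L k (p + q) = split_poly b L k p + split_poly b L k q"
proof -
  have sup: "split_poly b L k r = (\<Sum>mon\<in>keys p \<union> keys q. Poly_Mapping.single (split_mon b L k mon) (lookup r mon))"
    if "keys r \<subseteq> keys p \<union> keys q" for r
    unfolding split_poly_def using that
    by (intro sum.mono_neutral_left) (auto simp: not_in_keys_iff_lookup_eq_zero)
  have "split_poly b L k (p + q) = (\<Sum>mon\<in>keys p \<union> keys q. Poly_Mapping.single (split_mon b L k mon) (lookup (p + q) mon))"
    by (rule sup) (rule Poly_Mapping.keys_add)
  also have "\<dots> = split_poly b L k p + split_poly b L k q"
    by (simp add: sup lookup_add single_add sum.distrib)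
  finally show ?thesis .
qed

lemma split_poly_single: "split_poly b L k (Poly_Mapping.single mon c) = Poly_Mapping.single (split_mon b L k mon) c"
  by (cases "c = 0") (auto simp: split_poly_def)

lemma split_poly_sum_list: "split_poly b L k (\<Sum>y\<leftarrow>ys. f y) = (\<Sum>y\<leftarrow>ys. split_poly b L k (f y))"
  by (induction ys) (auto simp: split_poly_add, simp add: split_poly_def)

lemma lookup_nth_eq: "lookup (Poly_Mapping.nth xs) i = (if i < length xs then xs ! i else 0)"
  by (simp add: lookup_nth nth_default_def)

lemma keys_nth_subset: "keys (Poly_Mapping.nth xs) \<subseteq> {..<length xs}"
  by (auto simp: in_keys_iff lookup_nth_eq simp del: lookup_nth keys_nth split: if_splits)

lemma map_lookup_nth: "length es = k \<Longrightarrow> map (lookup (Poly_Mapping.nth es)) [0..<k] = es"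
  by (auto intro!: nth_equalityI simp: lookup_nth_eq simp del: lookup_nth)

lemma mon_eval_nth: "mon_eval x (Poly_Mapping.nth xs) = (\<Prod>v<length xs. x v ^ (xs ! v))"
  by (subst mon_eval_superset[of "{..<length xs}"]) (simp_all add: keys_nth_subset lookup_nth_eq del: lookup_nth keys_nth)

lemma keys_split_poly: "keys (split_poly b L k p) \<subseteq> split_mon b L k ` keys p"
  unfolding split_poly_def by (rule order.trans[OF keys_sum]) auto

lemma keys_split_mon: "keys (split_mon b L k mon) \<subseteq> {..<k * Suc L}"
  unfolding split_mon_def by (rule order.trans[OF keys_nth_subset]) (simp add: length_split_exps)

lemma variate_split_poly: "variate (k * Suc L) (split_poly b L k p)"
  using keys_split_poly[of b L k p] keys_split_mon[of b L k] unfolding variate_def by blast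

text \<open>All digits are below \<open>b\<close>: this is the drop in degree for which the
  exponents are split.\<close>

lemma total_degree_split_poly:
  assumes "b \<ge> 1"
  shows "total_degree (split_poly b L k p) \<le> k * Suc L * b"
proof -
  have "mon_degree (split_mon b L k mon) \<le> k * Suc L * b" for mon
  proof -
    let ?ds = "split_exps b L (map (lookup mon) [0..<k])"
    have len: "length ?ds = k * Suc L" by (simp add: length_split_exps)
    have "mon_degree (split_mon b L k mon) = (\<Sum>v<k * Suc L. lookup (split_mon b L k mon) v)"
      unfolding mon_degree_def using keys_split_mon[of b L k mon]
      by (intro sum.mono_neutral_left) (auto simp: not_in_keys_iff_lookup_eq_zero)
    also have "\<dots> \<le> (\<Sum>v<k * Suc L. b)"
    proof (rule sum_mono)
      fix v assume "v \<in> {..<k * Suc L}"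
      then have "?ds ! v \<in> set ?ds" using len by (intro nth_mem) auto
      from split_exps_less[OF assms this] show "lookup (split_mon b L k mon) v \<le> b"
        by (simp add: split_mon_def lookup_nth_eq del: lookup_nth)
    qed
    finally show ?thesis by simp
  qed
  then show ?thesis unfolding total_degree_def using keys_split_poly[of b L k p] by auto
qed

text \<open>The variable with index \<open>i * Suc L + u\<close> stands for the \<open>i\<close>-th
  original variable raised to \<open>b ^ u\<close>; this substitution undoes the splitting.\<close>

definition power_vars :: "nat \<Rightarrow> nat \<Rightarrow> (nat \<Rightarrow> 'a::comm_semiring_1) \<Rightarrow> nat \<Rightarrow> 'a" where
  "power_vars b L x v = x (v div Suc L) ^ b ^ (v mod Suc L)"

lemma mon_eval_split_mon:
  assumes "keys mon \<subseteq> {..<k}" "\<And>i. lookup mon i < b ^ Suc L"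
  shows "mon_eval (power_vars b L x) (split_mon b L k mon) = mon_eval x mon"
proof -
  let ?es = "map (lookup mon) [0..<k]"
  let ?h = "\<lambda>v. power_vars b L x v ^ (split_exps b L ?es ! v)"
  have "mon_eval (power_vars b L x) (split_mon b L k mon) = (\<Prod>v<k * Suc L. ?h v)"
    unfolding split_mon_def mon_eval_nth by (simp add: length_split_exps)
  also have "\<dots> = (\<Prod>i<k. \<Prod>v\<in>{i * Suc L..<i * Suc L + Suc L}. ?h v)"
    by (rule prod.nat_group[symmetric])
  also have "\<dots> = (\<Prod>i<k. x i ^ lookup mon i)"
  proof (rule prod.cong[OF refl])
    fix i assume "i \<in> {..<k}"
    then have i: "i < length ?es" by simp
    have "(\<Prod>v\<in>{i * Suc L..<i * Suc L + Suc L}. ?h v) = (\<Prod>u<Suc L. ?h (i * Suc L + u))"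
      by (rule prod.reindex_bij_witness[of _ "\<lambda>u. i * Suc L + u" "\<lambda>v. v - i * Suc L"]) auto
    also have "\<dots> = (\<Prod>u<Suc L. x i ^ ((lookup mon i div b ^ u mod b) * b ^ u))"
    proof (rule prod.cong[OF refl])
      fix u assume "u \<in> {..<Suc L}"
      then have u: "u < Suc L" by simp
      have dm: "(i * Suc L + u) div Suc L = i" "(i * Suc L + u) mod Suc L = u" 
        using u div_mult_self3[of "Suc L" i u] mod_mult_self3[of i "Suc L" u]
        by (simp_all del: mult_Suc_right div_mult_self3 mod_mult_self3)
      have "split_exps b L ?es ! (i * Suc L + u) = lookup mon i div b ^ u mod b"
        using nth_split_exps[OF i u] i by simp
      then show "?h (i * Suc L + u) = x i ^ ((lookup mon i div b ^ u mod b) * b ^ u)"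
        unfolding power_vars_def dm by (simp add: mult.commute flip: power_mult)
    qed
    also have "\<dots> = x i ^ lookup mon i"
      by (subst power_sum[symmetric], subst digit_expansion[OF assms(2)]) simp
    finally show "(\<Prod>v\<in>{i * Suc L..<i * Suc L + Suc L}. ?h v) = x i ^ lookup mon i" .
  qed
  also have "\<dots> = mon_eval x mon" using assms(1) by (intro mon_eval_superset[symmetric]) auto
  finally show ?thesis .
qed

lemma lookup_le_mon_degree: "lookup mon i \<le> mon_degree mon"
proof (cases "i \<in> keys mon")
  case True
  then show ?thesis unfolding mon_degree_def by (intro member_le_sum) auto
next
  case False
  then show ?thesis by (simp add: in_keys_iff)
qed

lemma mpoly_eval_split_poly:
  fixes p :: "'a::comm_ring_1 mpoly"
  assumes "variate k p" "total_degree p < b ^ Suc L"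
  shows "mpoly_eval (power_vars b L x) (split_poly b L k p) = mpoly_eval x p"
proof -
  have "mpoly_eval (power_vars b L x) (split_poly b L k p) =
    (\<Sum>mon\<in>keys p. lookup p mon * mon_eval (power_vars b L x) (split_mon b L k mon))"
    by (simp add: split_poly_def mpoly_eval_sum mpoly_eval_single)
  also have "\<dots> = (\<Sum>mon\<in>keys p. lookup p mon * mon_eval x mon)"
  proof (rule sum.cong[OF refl])
    fix mon assume mon: "mon \<in> keys p"
    have "lookup mon i < b ^ Suc L" for i
      using lookup_le_mon_degree[of mon i] mon_degree_le_total_degree[OF mon] assms(2) by linarith
    then have "mon_eval (power_vars b L x) (split_mon b L k mon) = mon_eval x mon"
      using assms(1) mon by (intro mon_eval_split_mon) (auto simp: variate_def)
    then show "lookup p mon * mon_eval (power_vars b L x) (split_mon b L k mon) = lookup p mon * mon_eval x mon" by simp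
  qed
  finally show ?thesis by (simp add: mpoly_eval_eq_aeval aeval_def)
qed

text \<open>A product gate may have arbitrarily many parallel edges, so any power of a variable is a
  single gate, however large \<open>b ^ u\<close> is.\<close>

lemma derivable_power_vars:
  "derivable k {} ((\<lambda>v x. power_vars b L x v) ` {..<k * Suc L}) (k + k * Suc L)"
proof (rule derivable_seq)
  have "derivable k {} ((\<lambda>i x. x i) ` {..<k}) (card {..<k})"
    by (rule derivable_steps) (auto intro: gate_step_var)
  then show "derivable k {} ((\<lambda>i (x :: nat \<Rightarrow> 'a). x i) ` {..<k}) k" by simp
  let ?A = "{} \<union> (\<lambda>i (x :: nat \<Rightarrow> 'a). x i) ` {..<k}"
  have "derivable k ?A ((\<lambda>v x. power_vars b L x v) ` {..<k * Suc L}) (card {..<k * Suc L})"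
  proof (rule derivable_steps)
    fix v assume "v \<in> {..<k * Suc L}"
    then have "v div Suc L < k" by (simp add: less_mult_imp_div_less)
    then show "gate_step k ?A (\<lambda>x. power_vars b L x v)"
      unfolding power_vars_def by (intro gate_step_power) auto
  qed simp
  then show "derivable k ?A ((\<lambda>v x. power_vars b L x v) ` {..<k * Suc L}) (k * Suc L)" by simp
qed

section \<open>The generator hits\<close>

text \<open>The cost in \<open>derivable_from_annihilator\<close> with \<open>Suc m\<close>,
  \<open>n\<close> and \<open>length C\<close> estimated by \<open>s\<close>, plus
  \<open>2 * K\<close> for the variables and their powers.\<close>

definition circuit_bound :: "nat \<Rightarrow> nat \<Rightarrow> nat \<Rightarrow> nat" where
  "circuit_bound s K dd = (let N = s ^ K in
    2 * K + (1 + K + (K * s + N) + (s * s * N + s * N * N) +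
      dd * (N * ((s * dd + 1) * (s + 1) * (s + s) + 1) + s * N * N + s * N) + 1))"

lemma generator_nonzero:
  fixes p f :: "'a::field_char_0 mpoly"
  assumes p: "variate k p" "total_degree p = d" "p \<notin> circuit_class k d (real d powr \<delta>)"
    and b: "d < b ^ Suc L" "b \<ge> 1"
    and size: "real (circuit_bound s (k * Suc L) (k * Suc L * b)) \<le> real d powr \<delta>"
    and f: "f \<in> circuit_class s s (real s)" "f \<noteq> 0"
  shows "\<exists>x y. mpoly_eval (\<lambda>i. Delta (split_poly b L k p) i x y) f \<noteq> 0"
proof (rule ccontr)
  assume "\<not> ?thesis"
  then have zero: "\<And>x y. mpoly_eval (\<lambda>i. Delta (split_poly b L k p) i x y) f = 0" by blast
  let ?Q = "split_poly b L k p"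
  let ?K = "k * Suc L"
  let ?dd = "k * Suc L * b"
  obtain C where C: "variate s f" "total_degree f \<le> s" "is_circuit s C" "length C \<le> s" "computes C f"
    using f(1) unfolding circuit_class_def by auto
  have "\<exists>m<s. \<exists>c j. (\<forall>q. T_coeff f m c j ((\<lambda>q i. Delta ?Q i (fst q) (snd q)) q) = 0) \<and>
    (\<exists>q. T_coeff f m c (Suc j) ((\<lambda>q i. Delta ?Q i (fst q) (snd q)) q) \<noteq> 0)"
    by (rule exists_separant[OF C(1) f(2)]) (simp add: zero)
  then obtain m c j q where m: "m < s" and ann': "\<And>q. T_coeff f m c j (\<lambda>i. Delta ?Q i (fst q) (snd q)) = 0"
    and sep: "T_coeff f m c (Suc j) (\<lambda>i. Delta ?Q i (fst q) (snd q)) \<noteq> 0" by blast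
  have ann: "T_coeff f m c j (\<lambda>i. Delta ?Q i x y) = 0" for x y using ann'[of "(x, y)"] by simp
  let ?X = "\<lambda>v x. power_vars b L x v"
  let ?N = "Suc m ^ ?K"
  have 1: "derivable k ({} \<union> ?X ` {..<?K}) {\<lambda>x. mpoly_eval (\<lambda>v. ?X v x) ?Q}
    (1 + ?K + (?K * Suc m + ?N) + (Suc m * Suc m * ?N + Suc m * ?N * ?N) +
     ?dd * (?N * ((s * ?dd + 1) * (s + 1) * (s + length C) + 1) + Suc m * ?N * ?N + Suc m * ?N) + 1)"
    by (rule derivable_from_annihilator[OF total_degree_split_poly[OF b(2)] variate_split_poly C(2,3,5) m ann sep]) auto
  have N: "?N \<le> s ^ ?K" using m by (intro power_mono) auto
  have "derivable k ({} \<union> ?X ` {..<?K}) {\<lambda>x. mpoly_eval (\<lambda>v. ?X v x) ?Q}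
    (1 + ?K + (?K * s + s ^ ?K) + (s * s * s ^ ?K + s * s ^ ?K * s ^ ?K) +
     ?dd * (s ^ ?K * ((s * ?dd + 1) * (s + 1) * (s + s) + 1) + s * s ^ ?K * s ^ ?K + s * s ^ ?K) + 1)"
    by (rule derivable_mono[OF 1]) (use m C(4) N in \<open>auto simp del: mult_Suc mult_Suc_right intro!: add_mono mult_mono\<close>)
  from derivable_seq[OF derivable_power_vars this]
  have "derivable k {} {\<lambda>x. mpoly_eval (\<lambda>v. ?X v x) ?Q} (circuit_bound s ?K ?dd)"
    by (rule derivable_mono) (simp_all add: circuit_bound_def Let_def)
  \<comment> \<open>At the power variables the split polynomial is the hard polynomial again, so the
    reconstruction is a circuit for \<open>p\<close>.\<close>
  moreover have "mpoly_eval (\<lambda>v. ?X v x) ?Q = mpoly_eval x p" for x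
    using mpoly_eval_split_poly[OF p(1), of b L x] b(1) p(2) by (simp add: eta_contract_eq)
  ultimately have "derivable k {} {\<lambda>x. mpoly_eval x p} (circuit_bound s ?K ?dd)" by simp
  then have "p \<in> circuit_class k d (real d powr \<delta>)"
    by (rule derivable_circuit_class[OF _ size mpoly_eqI p(1)]) (use p(2) in auto)
  then show False using p(3) by blast
qed

section \<open>Nonvanishing on a grid of seeds\<close>

lemma polydeg_Delta:
  fixes Q :: "'a::comm_ring_1 mpoly"
  assumes "total_degree Q \<le> dd" "\<And>v. \<exists>n\<le>1. polydeg n (\<lambda>u. x u v)" "\<And>v. \<exists>n\<le>1. polydeg n (\<lambda>u. y u v)"
  shows "polydeg dd (\<lambda>u. Delta Q i (x u) (y u))"
proof -
  have "\<forall>r. polydeg (dd * 1) (\<lambda>u. coeff (aeval const_poly (\<lambda>v. [:x u v, y u v:]) Q) r)"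
  proof (rule aeval_graded[where Pr = "\<lambda>n F. \<forall>r. polydeg n (\<lambda>u. coeff (F u) r)"])
    show "mon_degree mon \<le> dd" if "mon \<in> keys Q" for mon
      using mon_degree_le_total_degree[OF that] assms(1) by simp
    show "\<forall>r. polydeg 1 (\<lambda>u. coeff [:x u v, y u v:] r)" for v
    proof
      fix r
      have "polydeg 1 (\<lambda>u. x u v)" "polydeg 1 (\<lambda>u. y u v)" using assms(2,3) polydeg_mono by blast+
      then show "polydeg 1 (\<lambda>u. coeff [:x u v, y u v:] r)"
        by (cases "r = 0"; cases "r = 1") (simp_all add: coeff_affine2)
    qed
    show "\<forall>r. polydeg (n + n') (\<lambda>u. coeff (F u * G u) r)"
      if "\<forall>r. polydeg n (\<lambda>u. coeff (F u) r)" "\<forall>r. polydeg n' (\<lambda>u. coeff (G u) r)" for n n' and F G :: "'a \<Rightarrow> 'a poly"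
      using that by (intro allI polydeg_coeff_mult) blast+
  qed (auto intro: polydeg_add polydeg_mono)
  then show ?thesis by (simp add: Delta_def)
qed

text \<open>Base point and direction are joined into one point with \<open>K + K\<close>
  coordinates, in which the composition with \<open>f\<close> has individual degree at most
  \<open>s * dd\<close>.\<close>

lemma generator_hits_grid:
  fixes Q f :: "'a::field_char_0 mpoly"
  assumes Q: "variate K Q" "total_degree Q \<le> dd" and f: "total_degree f \<le> s"
    and nz: "mpoly_eval (\<lambda>i. Delta Q i x y) f \<noteq> 0"
  shows "\<exists>a b. length a = K \<and> length b = K \<and> set a \<subseteq> {..s * dd} \<and> set b \<subseteq> {..s * dd} \<and>
    mpoly_eval (\<lambda>i. Delta Q i (\<lambda>v. of_nat (a ! v)) (\<lambda>v. of_nat (b ! v))) f \<noteq> 0"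
proof -
  define F where "F w = mpoly_eval (\<lambda>i. Delta Q i (\<lambda>v. w v) (\<lambda>v. w (K + v))) f" for w :: "nat \<Rightarrow> 'a"
  have sepF: "sep (K + K) (s * dd) F"
    unfolding sep_def
  proof (intro allI impI)
    fix v w
    have D: "polydeg dd (\<lambda>u. Delta Q i (\<lambda>v'. (w(v := u)) v') (\<lambda>v'. (w(v := u)) (K + v')))" for i
    proof (rule polydeg_Delta[OF Q(2)])
      show "\<exists>n\<le>1. polydeg n (\<lambda>u. (w(v := u)) v')" for v'
        by (cases "v' = v") (auto intro!: exI[of _ 1] polydeg_id)
      show "\<exists>n\<le>1. polydeg n (\<lambda>u. (w(v := u)) (K + v'))" for v'
        by (cases "K + v' = v") (auto intro!: exI[of _ 1] polydeg_id)
    qed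
    show "polydeg (s * dd) (\<lambda>u. F (w(v := u)))"
      unfolding F_def mpoly_eval_eq_aeval
    proof (rule aeval_graded[where Pr = polydeg])
      show "mon_degree mon \<le> s" if "mon \<in> keys f" for mon
        using mon_degree_le_total_degree[OF that] f by simp
      show "polydeg dd (\<lambda>u. Delta Q i (\<lambda>v'. (w(v := u)) v') (\<lambda>v'. (w(v := u)) (K + v')))" for i
        by (rule D)
    qed (auto intro: polydeg_add polydeg_mono polydeg_mult)
  qed
  define w where "w v = (if v < K then x v else y (v - K))" for v
  have "F w = mpoly_eval (\<lambda>i. Delta Q i x y) f"
    unfolding F_def by (intro arg_cong2[of _ _ _ _ mpoly_eval] ext refl Delta_cong[OF Q(1)]) (auto simp: w_def)
  then have "F w \<noteq> 0" using nz by simp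
  then obtain z where z: "\<And>v. v < K + K \<Longrightarrow> z v \<in> nodes (s * dd)" "F z \<noteq> 0"
    using sep_vanish[OF sepF, of "\<lambda>_. nodes (s * dd)" w] nodes_props by blast
  have "\<exists>t\<le>s * dd. z v = of_nat t" if "v < K + K" for v using z(1)[OF that] by (auto simp: nodes_def)
  then obtain t where t: "\<And>v. v < K + K \<Longrightarrow> t v \<le> s * dd \<and> z v = of_nat (t v)" by metis
  let ?a = "map t [0..<K]" and ?b = "map (\<lambda>v. t (K + v)) [0..<K]"
  have "mpoly_eval (\<lambda>i. Delta Q i (\<lambda>v. of_nat (?a ! v)) (\<lambda>v. of_nat (?b ! v))) f = F z"
    unfolding F_def by (intro arg_cong2[of _ _ _ _ mpoly_eval] ext refl Delta_cong[OF Q(1)]) (auto simp: t)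
  then show ?thesis using z(2) t by (intro exI[of _ ?a] exI[of _ ?b]) auto
qed

text \<open>The list of terms may repeat monomials, whose coefficients may even cancel. Since
  \<open>split_poly\<close> is additive, the program can nevertheless split term by term.\<close>

lemma Delta_split_poly:
  fixes ts :: "('a::field_char_0 \<times> nat list) list"
  assumes "\<And>c es. (c, es) \<in> set ts \<Longrightarrow> length es = k"
    and "p = (\<Sum>(c, es)\<leftarrow>ts. Poly_Mapping.single (Poly_Mapping.nth es) c)"
  shows "Delta (split_poly b L k p) i x y =
    (\<Sum>(c, es)\<leftarrow>ts. c * coeff (\<Prod>v<k * Suc L. [:x v, y v:] ^ (split_exps b L es ! v)) i)"
proof -
  have "split_poly b L k p = (\<Sum>(c, es)\<leftarrow>ts. Poly_Mapping.single (split_mon b L k (Poly_Mapping.nth es)) c)"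
    unfolding assms(2) split_poly_sum_list by (simp add: split_poly_single case_prod_unfold)
  also have "\<dots> = (\<Sum>(c, es)\<leftarrow>ts. Poly_Mapping.single (Poly_Mapping.nth (split_exps b L es)) c)"
    using assms(1) by (intro arg_cong[of _ _ sum_list] map_cong) (auto simp: split_mon_def map_lookup_nth simp del: lookup_nth)
  finally have "aeval const_poly (\<lambda>v. [:x v, y v:]) (split_poly b L k p) =
    (\<Sum>(c, es)\<leftarrow>ts. [:c:] * (\<Prod>v<length (split_exps b L es). [:x v, y v:] ^ (split_exps b L es ! v)))"
    by (simp add: aeval_sum_list case_prod_unfold aeval_single mon_eval_nth)
  also have "\<dots> = (\<Sum>(c, es)\<leftarrow>ts. [:c:] * (\<Prod>v<k * Suc L. [:x v, y v:] ^ (split_exps b L es ! v)))"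
    using assms(1) by (intro arg_cong[of _ _ sum_list] map_cong) (auto simp: length_split_exps)
  finally have *: "aeval const_poly (\<lambda>v. [:x v, y v:]) (split_poly b L k p) =
    (\<Sum>(c, es)\<leftarrow>ts. [:c:] * (\<Prod>v<k * Suc L. [:x v, y v:] ^ (split_exps b L es ! v)))" .
  have "coeff (sum_list (map g ts)) i = (\<Sum>t\<leftarrow>ts. coeff (g t) i)" for g :: "'a \<times> nat list \<Rightarrow> 'a poly"
    by (induction ts) auto
  then show ?thesis unfolding Delta_def * by (simp add: case_prod_unfold)
qed

section \<open>Parameters\<close>

text \<open>The factor \<open>D ^ 2\<close> has two sources: the \<open>dd\<close> rounds of the
  recurrence and the \<open>s * dd + 1\<close> interpolation nodes within a round. The numerical
  factor 16 is absorbed by \<open>y ^ 4\<close>.\<close>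

lemma circuit_bound_le:
  assumes K: "K \<le> y" "s ^ K \<le> y" "s + 1 \<le> y" "2 \<le> y" and D: "dd \<le> D" "1 \<le> D"
  shows "circuit_bound s K dd \<le> y ^ 8 * D ^ 2"
proof -
  have s: "s \<le> y" "1 \<le> y" using K by auto
  have "(s * dd + 1) * (s + 1) * (s + s) \<le> (y * D + y * D) * y * (y + y)"
    using K s D by (intro mult_mono add_mono) (auto simp: Suc_le_eq)
  then have "s ^ K * ((s * dd + 1) * (s + 1) * (s + s) + 1) \<le> y * ((y * D + y * D) * y * (y + y) + y ^ 3 * D)"
    using K s D by (intro mult_mono add_mono) (auto simp: Suc_le_eq)
  moreover have "s * s ^ K * s ^ K + s * s ^ K \<le> y * y * y + y * y"
    using K s by (intro add_mono mult_mono) auto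
  ultimately have "dd * (s ^ K * ((s * dd + 1) * (s + 1) * (s + s) + 1) + s * s ^ K * s ^ K + s * s ^ K) \<le>
    D * (y * ((y * D + y * D) * y * (y + y) + y ^ 3 * D) + (y * y * y + y * y))"
    using D by (intro mult_mono) auto
  moreover have "2 * K + (1 + K + (K * s + s ^ K) + (s * s * s ^ K + s * s ^ K * s ^ K)) \<le>
    2 * y + (y + y + (y * y + y) + (y * y * y + y * y * y))"
    using K s by (intro add_mono mult_mono) auto
  ultimately have "circuit_bound s K dd \<le> 2 * y + (y + y + (y * y + y) + (y * y * y + y * y * y)) +
    (D * (y * ((y * D + y * D) * y * (y + y) + y ^ 3 * D) + (y * y * y + y * y)) + y)"
    unfolding circuit_bound_def Let_def using s by linarith
  also have "\<dots> \<le> 16 * (y ^ 4 * D ^ 2)"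
  proof -
    have p: "y ^ a * D ^ b \<le> y ^ 4 * D ^ 2" if "a \<le> 4" "b \<le> 2" for a b
      using s D that by (intro mult_mono power_increasing) auto
    have "y \<le> y ^ 4 * D ^ 2" "y ^ 2 \<le> y ^ 4 * D ^ 2" "y ^ 3 \<le> y ^ 4 * D ^ 2" "y ^ 2 * D \<le> y ^ 4 * D ^ 2" "y ^ 3 * D \<le> y ^ 4 * D ^ 2"
      using p[of 1 0] p[of 2 0] p[of 3 0] p[of 2 1] p[of 3 1] by auto
    moreover have "2 * y + (y + y + (y * y + y) + (y * y * y + y * y * y)) +
      (D * (y * ((y * D + y * D) * y * (y + y) + y ^ 3 * D) + (y * y * y + y * y)) + y) =
      6 * y + y ^ 2 + 2 * y ^ 3 + (5 * (y ^ 4 * D ^ 2) + y ^ 3 * D + y ^ 2 * D)"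
      by (simp add: algebra_simps power2_eq_square power3_eq_cube power4_eq_xxxx)
    ultimately show ?thesis by linarith
  qed
  also have "16 \<le> y ^ 4" using power_mono[OF K(4), of 4] by simp
  then have "16 * (y ^ 4 * D ^ 2) \<le> y ^ 4 * (y ^ 4 * D ^ 2)" by (rule mult_right_mono) simp
  also have "\<dots> = y ^ 8 * D ^ 2" by (simp flip: mult.assoc power_add)
  finally show ?thesis .
qed

lemma less_two_power_le: "2 \<le> x \<Longrightarrow> n < x ^ n" for x n :: nat
  by (rule power_gt_expt) auto

text \<open>The degree will be \<open>x ^ (g * L)\<close>, that is \<open>b ^ L\<close>. The
  reconstruction costs at most \<open>x ^ (10 * Suc L + 2 * g)\<close>, which for this
  \<open>g\<close> is \<open>x ^ (7 * g)\<close>, while \<open>L * \<delta> \<ge> 8\<close> lifts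
  the lower bound to at least \<open>x ^ (8 * g)\<close>. The exponent \<open>w\<close> combines the
  side \<open>x ^ (L + 3 + g)\<close> of the seed grid with its dimension
  \<open>K \<le> j * Suc L\<close>, measured in powers of \<open>(s + 2) ^ (j * j)\<close>.\<close>

locale parameters =
  fixes L g w s j K x b :: nat and \<delta> :: real
  assumes L: "L * \<delta> \<ge> 8" "\<delta> > 0" and g: "g = 2 * L + 2" and w: "w = (L + 3 + g) * Suc L"
    and j: "j \<ge> 1" and x: "x = (s + 2) ^ j" and K: "K \<le> j * Suc L" and b: "b = x ^ g"
begin

lemma x_ge: "s + 2 \<le> x" "2 \<le> x"
proof -
  have "(s + 2) ^ 1 \<le> (s + 2) ^ j" using j by (intro power_increasing) auto
  then show "s + 2 \<le> x" "2 \<le> x" by (auto simp: x)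
qed

lemma K_le: "K \<le> x ^ Suc L"
proof -
  have "j \<le> x" using less_two_power_le[of "s + 2" j] by (simp add: x)
  moreover have "Suc L \<le> x ^ L" using less_two_power_le[OF x_ge(2), of L] by simp
  ultimately have "j * Suc L \<le> x * x ^ L" by (rule mult_mono) auto
  then show ?thesis using K by simp
qed

lemma sK_le: "(s + 2) ^ K \<le> x ^ Suc L"
proof -
  have "(s + 2) ^ K \<le> (s + 2) ^ (j * Suc L)" using K by (intro power_increasing) auto
  then show ?thesis by (simp only: x power_mult)
qed

lemma degree_bound: "K * b \<le> x ^ (Suc L + g)"
  using K_le by (simp add: b power_add)

lemma b_ge: "b \<ge> 2"
proof -
  have "x ^ 1 \<le> x ^ g" using x_ge by (intro power_increasing) (auto simp: g)
  then show ?thesis using x_ge(2) by (simp add: b)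
qed

lemma size_bound: "real (circuit_bound s K (K * b)) \<le> real (x ^ (g * L)) powr \<delta>"
proof -
  have "circuit_bound s K (K * b) \<le> (x ^ Suc L) ^ 8 * (x ^ (Suc L + g)) ^ 2"
  proof (rule circuit_bound_le)
    show "s ^ K \<le> x ^ Suc L" using sK_le power_mono[of s "s + 2" K] by linarith
    have "x ^ 1 \<le> x ^ Suc L" using x_ge by (intro power_increasing) auto
    then have "x \<le> x ^ Suc L" by (simp only: power_one_right)
    then show "s + 1 \<le> x ^ Suc L" using x_ge(1) by linarith
    show "2 \<le> x ^ Suc L" using \<open>x \<le> x ^ Suc L\<close> x_ge(2) by linarith
    show "1 \<le> x ^ (Suc L + g)" using x_ge by simp
  qed (rule K_le degree_bound)+
  also have "\<dots> = x ^ (Suc L * 8 + (Suc L + g) * 2)" by (simp only: power_mult power_add)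
  also have "Suc L * 8 + (Suc L + g) * 2 = 10 * Suc L + 2 * g" by simp
  finally have "real (circuit_bound s K (K * b)) \<le> real x ^ (10 * Suc L + 2 * g)"
    by (metis of_nat_le_iff of_nat_power)
  also have "\<dots> = real x powr real (10 * Suc L + 2 * g)" using x_ge by (subst powr_realpow) auto
  also have "\<dots> \<le> real x powr (real (g * L) * \<delta>)"
  proof (rule powr_mono)
    have "real (10 * Suc L + 2 * g) \<le> 8 * real g" by (simp add: g)
    also have "\<dots> \<le> (L * \<delta>) * real g" using L by (intro mult_right_mono) auto
    finally show "real (10 * Suc L + 2 * g) \<le> real (g * L) * \<delta>" by (simp add: mult_ac)
  qed (use x_ge in auto)
  also have "\<dots> = real (x ^ (g * L)) powr \<delta>"
    by (simp only: powr_powr[symmetric] of_nat_power) (subst powr_realpow, use x_ge in auto)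
  finally show ?thesis .
qed

lemma M_power: "x ^ (c * (j * Suc L)) = ((s + 2) ^ (j * j)) ^ (c * Suc L)"
  by (simp only: x flip: power_mult) (simp add: algebra_simps)

lemma seeds_bound: "Suc (s * (K * b)) ^ K \<le> ((s + 2) ^ (j * j)) ^ w"
proof -
  have "s * (K * b) + 1 \<le> x * x ^ (Suc L + g) + x * x ^ (Suc L + g)"
    using x_ge degree_bound by (intro add_mono mult_mono) auto
  also have "\<dots> = 2 * x ^ (Suc L + g + 1)" by simp
  also have "\<dots> \<le> x * x ^ (Suc L + g + 1)" using x_ge by (intro mult_right_mono) auto
  also have "\<dots> = x ^ (L + 3 + g)" by (simp add: power_add numeral_eq_Suc)
  finally have "Suc (s * (K * b)) ^ K \<le> (x ^ (L + 3 + g)) ^ K" by (intro power_mono) auto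
  also have "\<dots> \<le> (x ^ (L + 3 + g)) ^ (j * Suc L)" using x_ge K by (intro power_increasing) auto
  also have "\<dots> = ((s + 2) ^ (j * j)) ^ w" unfolding w M_power[symmetric] by (simp only: power_mult)
  finally show ?thesis .
qed

lemma orders_bound: "s ^ K \<le> ((s + 2) ^ (j * j)) ^ w"
proof -
  have "s ^ K \<le> x ^ K" using x_ge by (intro power_mono) auto
  also have "\<dots> \<le> x ^ ((L + 3 + g) * (j * Suc L))"
    using x_ge K by (intro power_increasing) (auto intro: order.trans)
  also have "\<dots> = ((s + 2) ^ (j * j)) ^ w" unfolding w M_power ..
  finally show ?thesis .
qed

end

text \<open>This includes quotients, as \<open>0 / 0 = 0\<close>. Hence an explicit family with a
  nonzero member has a nonzero constant in \<open>cs\<close>, with which 1 can be written.\<close>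

lemma fexp_value_zero: "(\<And>i. i < length cs \<Longrightarrow> cs ! i = 0) \<Longrightarrow> fexp_value cs e = 0"
  by (induction e) auto

lemma total_degree_0 [simp]: "total_degree 0 = 0"
  by (simp add: total_degree_def)

lemma variate_0_total_degree: "variate 0 p \<Longrightarrow> total_degree p = 0"
proof -
  assume "variate 0 p"
  then have "mon_degree mon = 0" if "mon \<in> keys p" for mon
    using that by (auto simp: variate_def mon_degree_def)
  then have "insert 0 (mon_degree ` keys p) = {0}" by auto
  then show ?thesis by (simp only: total_degree_def Max_singleton)
qed

section \<open>The hitting set\<close>

lemma length_seeds: "Suc (s * (K * b)) ^ K \<le> R \<Longrightarrow> seeds R s K b = all_tuples [0..<Suc (s * (K * b))] K"
  unfolding seeds_def by (rule tuples_eq_all_tuples) simp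

context
  fixes cs :: "'a::field_char_0 list" and i0 R s K b :: nat
  assumes i0: "i0 < length cs" "cs ! i0 \<noteq> 0"
    and R: "Suc (s * (K * b)) ^ K \<le> R" "s ^ K \<le> R"
begin

text \<open>The listed expressions evaluate to the generator of the split polynomial at pairs of
  grid seeds; the bounds on \<open>R\<close> guarantee that neither enumeration, of seeds or of
  orders, is cut off.\<close>

lemma gen_points_hit:
  fixes f p :: "'a mpoly"
  assumes ts: "\<And>c es. (c, es) \<in> set ts \<Longrightarrow> length es = k" "K = k * Suc L"
    and p: "p = (\<Sum>(c, es)\<leftarrow>ts. Poly_Mapping.single (Poly_Mapping.nth es) (fexp_value cs c))"
    and f: "variate s f" "total_degree f \<le> s" and b: "b \<ge> 1"
    and nz: "mpoly_eval (\<lambda>i. Delta (split_poly b L k p) i x y) f \<noteq> 0"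
  shows "\<exists>q\<in>set (gen_points i0 R s K b (map (split_term b L) ts)).
    mpoly_eval (\<lambda>i. map (fexp_value cs) q ! i) f \<noteq> 0"
proof -
  let ?Q = "split_poly b L k p"
  obtain u v where uv: "length u = K" "length v = K" "set u \<subseteq> {..s * (K * b)}" "set v \<subseteq> {..s * (K * b)}"
    "mpoly_eval (\<lambda>i. Delta ?Q i (\<lambda>n. of_nat (u ! n)) (\<lambda>n. of_nat (v ! n))) f \<noteq> 0"
    using generator_hits_grid[OF variate_split_poly total_degree_split_poly[OF b] f(2) nz] unfolding ts(2) by blast
  let ?ts = "map (split_term b L) ts"
  let ?q = "map (fcoord i0 R s K ?ts u v) [0..<s]"
  have mem: "u \<in> set (seeds R s K b)" "v \<in> set (seeds R s K b)"
    unfolding length_seeds[OF R(1)] set_all_tuples using uv by (auto simp: less_Suc_eq_le simp del: upt_Suc)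
  then have q: "?q \<in> set (gen_points i0 R s K b ?ts)" unfolding gen_points_def by auto
  have coord: "map (fexp_value cs) ?q ! i = Delta ?Q i (\<lambda>n. of_nat (u ! n)) (\<lambda>n. of_nat (v ! n))" if i: "i < s" for i
  proof -
    let ?vs = "map (\<lambda>(c, es). (fexp_value cs c, es)) ts"
    have "map (fexp_value cs) ?q ! i = fexp_value cs (fcoord i0 R s K ?ts u v i)" using i by simp
    also have "\<dots> = (\<Sum>(c, es)\<leftarrow>?ts. fexp_value cs c * coeff (\<Prod>n<K. [:of_nat (u ! n), of_nat (v ! n):] ^ (es ! n)) i)"
      by (rule fcoord_value[OF i0 R(2) i uv(1,2)])
        (use ts in \<open>auto simp: split_term_def split_exps_def[symmetric] length_split_exps\<close>)
    also have "\<dots> = (\<Sum>(c, es)\<leftarrow>?vs. c * coeff (\<Prod>n<k * Suc L. [:of_nat (u ! n), of_nat (v ! n):] ^ (split_exps b L es ! n)) i)"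
      by (simp add: o_def case_prod_unfold split_term_def ts(2) flip: split_exps_def)
    also have "\<dots> = Delta ?Q i (\<lambda>n. of_nat (u ! n)) (\<lambda>n. of_nat (v ! n))"
      by (rule Delta_split_poly[symmetric]) (use ts(1) p in \<open>auto simp: o_def case_prod_unfold\<close>)
    finally show ?thesis .
  qed
  have "mpoly_eval (\<lambda>i. map (fexp_value cs) ?q ! i) f =
      mpoly_eval (\<lambda>i. Delta ?Q i (\<lambda>n. of_nat (u ! n)) (\<lambda>n. of_nat (v ! n))) f"
    by (rule mpoly_eval_cong[OF f(1)]) (rule coord)
  then show ?thesis using uv(5) q by (intro bexI[of _ ?q]) auto
qed

lemma length_gen_points: "length (gen_points i0 R s K b ts) \<le> R * R"
proof -
  have len: "length (seeds R s K b) \<le> R"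
    by (subst length_seeds[OF R(1)], subst length_all_tuples) (use R(1) in simp)
  have "length (gen_points i0 R s K b ts) = length (seeds R s K b) * length (seeds R s K b)"
    by (simp add: gen_points_def length_concat o_def sum_list_triv)
  also have "\<dots> \<le> R * R" by (rule mult_mono[OF len len]) auto
  finally show ?thesis .
qed

text \<open>The lower bound comes from the padding: in characteristic zero its points differ already
  in their first coordinate, which exists for \<open>s \<ge> 1\<close>.\<close>

lemma card_points:
  fixes ts :: "(fexp \<times> nat list) list"
  defines "H \<equiv> set (map (map (fexp_value cs)) (gen_points i0 R s K b ts @ map (\<lambda>u. replicate s (fnum i0 u)) [0..<R]))"
  shows "card H \<le> R * R + R" "s \<ge> 1 \<Longrightarrow> R \<le> card H" "H \<subseteq> {a. length a = s}"
proof -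
  show "card H \<le> R * R + R"
    unfolding H_def using length_gen_points[of ts] by (intro order.trans[OF card_length]) simp
  show "H \<subseteq> {a. length a = s}" unfolding H_def gen_points_def by auto
  assume s: "s \<ge> 1"
  let ?pad = "\<lambda>u. map (fexp_value cs) (replicate s (fnum i0 u))"
  have "inj_on ?pad {0..<R}"
  proof (rule inj_onI)
    fix u v assume "?pad u = ?pad v"
    then have "?pad u ! 0 = ?pad v ! 0" by (simp only:)
    then show "u = v" using s by (simp add: fnum_value[OF i0])
  qed
  then have "R = card (?pad ` {0..<R})" by (simp add: card_image)
  also have "\<dots> \<le> card H" unfolding H_def by (intro card_mono) auto
  finally show "R \<le> card H" .
qed

end

section \<open>Existence and size of the search index\<close>

text \<open>At degree \<open>(s + 2) ^ (j * C)\<close> the root of the logarithm grows only like the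
  square root of \<open>j\<close>, so it falls below \<open>j\<close>.\<close>

lemma exists_search_index:
  assumes "(\<lambda>d. real (k d)) \<in> o(\<lambda>d. sqrt (log 2 (real d)))"
  shows "\<exists>j\<ge>1. k ((s + 2) ^ (j * C)) \<le> j"
proof (cases "C = 0")
  case True
  then show ?thesis by (intro exI[of _ "max 1 (k 1)"]) simp
next
  case False
  have "eventually (\<lambda>d. norm (real (k d)) \<le> 1 * norm (sqrt (log 2 (real d)))) at_top"
    using landau_o.smallD[OF assms, of 1] by simp
  then obtain d0 where d0: "\<And>d. d \<ge> d0 \<Longrightarrow> real (k d) \<le> \<bar>sqrt (log 2 (real d))\<bar>"
    by (auto simp: eventually_at_top_linorder)
  define l where "l = nat \<lceil>log 2 (real (s + 2))\<rceil>"
  \<comment> \<open>\<open>d0\<close> brings the degree into the asymptotic range, and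
    \<open>C * l\<close> yields \<open>j * C * l \<le> j * j\<close>.\<close>
  define j where "j = max 1 (max d0 (C * l))"
  let ?d = "(s + 2) ^ (j * C)"
  have "d0 * 1 \<le> j * C" using False by (intro mult_le_mono) (auto simp: j_def)
  then have "d0 \<le> j * C" by simp
  also have "\<dots> \<le> ?d" using less_two_power_le[of "s + 2" "j * C"] by simp
  finally have "real (k ?d) \<le> \<bar>sqrt (log 2 (real ?d))\<bar>" by (rule d0)
  also have "log 2 (real ?d) = real (j * C) * log 2 (real (s + 2))"
    by (subst of_nat_power, subst log_nat_power) auto
  also have "\<bar>sqrt (real (j * C) * log 2 (real (s + 2)))\<bar> \<le> real j"
  proof -
    have "log 2 (real (s + 2)) \<le> real l" unfolding l_def by linarith
    then have "real (j * C) * log 2 (real (s + 2)) \<le> real (j * C) * real l" by (intro mult_left_mono) auto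
    also have "\<dots> = real j * real (C * l)" by simp
    also have "C * l \<le> j" by (simp add: j_def)
    then have "real j * real (C * l) \<le> real j * real j"
      by (intro mult_left_mono) (simp_all only: of_nat_le_iff of_nat_0_le_iff)
    finally have "sqrt (real (j * C) * log 2 (real (s + 2))) \<le> real j"
      by (intro real_le_lsqrt) (auto simp: power2_eq_square)
    moreover have "0 \<le> real (j * C) * log 2 (real (s + 2))" by (intro mult_nonneg_nonneg) auto
    ultimately show ?thesis by simp
  qed
  finally show ?thesis by (intro exI[of _ j]) (auto simp: j_def)
qed

text \<open>The candidate \<open>j = ktilde k s\<close> passes the test itself: it is o(log s), so
  \<open>(s + 2) ^ (j * C)\<close> stays below the argument of \<open>k\<close> in
  \<open>ktilde\<close>, and \<open>k\<close> is monotone.\<close>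

lemma eventually_search_index_le:
  assumes o: "(\<lambda>d. real (k d)) \<in> o(\<lambda>d. sqrt (log 2 (real d)))"
    and k: "mono k" "\<And>d. d \<ge> 1 \<Longrightarrow> k d \<ge> 1" and C: "C \<ge> 1"
  shows "eventually (\<lambda>s. (LEAST j. j \<ge> 1 \<and> k ((s + 2) ^ (j * C)) \<le> j) \<le> ktilde k s) at_top"
proof -
  \<comment> \<open>The factor 2 in the constant pays for the estimate of \<open>s + 2\<close> by
    \<open>s ^ 2\<close>.\<close>
  have "eventually (\<lambda>d. norm (real (k d)) \<le> 1 / (2 * C) * norm (sqrt (log 2 (real d)))) at_top"
    using landau_o.smallD[OF o, of "1 / (2 * C)"] C by simp
  then obtain d0 where d0: "\<And>d. d \<ge> d0 \<Longrightarrow> real (k d) \<le> 1 / (2 * C) * \<bar>sqrt (log 2 (real d))\<bar>"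
    by (auto simp: eventually_at_top_linorder)
  have "(LEAST j. j \<ge> 1 \<and> k ((s + 2) ^ (j * C)) \<le> j) \<le> ktilde k s" if s: "s \<ge> max 2 d0" for s
  proof (rule Least_le)
    define D where "D = nat \<lfloor>real s powr log 2 (real s)\<rfloor>"
    define l where "l = log 2 (real s)"
    define q where "q = ktilde k s"
    have q: "q = k D" by (simp add: q_def ktilde_def D_def)
    have l: "l \<ge> 1" using s by (simp add: l_def)
    have "real s powr 1 \<le> real s powr l" using s l by (intro powr_mono) auto
    then have big: "real s \<le> real s powr l" using s by simp
    then have D: "s \<le> D" unfolding D_def l_def by linarith
    have Dle: "real D \<le> real s powr l" unfolding D_def l_def by (simp add: of_nat_nat)
    have "log 2 (real D) \<le> log 2 (real s powr l)" using D s Dle by (subst log_le_cancel_iff) auto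
    also have "\<dots> = l ^ 2" using s by (simp add: log_powr l_def power2_eq_square)
    finally have "sqrt (log 2 (real D)) \<le> l" using l by (intro real_le_lsqrt) auto
    moreover have "0 \<le> log 2 (real D)" using D s by simp
    ultimately have "\<bar>sqrt (log 2 (real D))\<bar> \<le> l" by simp
    then have "real q \<le> 1 / (2 * C) * l"
      using d0[of D] D s C unfolding q by (meson mult_left_mono order.trans max.boundedE divide_nonneg_nonneg of_nat_0_le_iff mult_nonneg_nonneg zero_le_one zero_le_numeral)
    then have ql: "2 * real (q * C) \<le> l" using C by (simp add: field_simps)
    have "real ((s + 2) ^ (q * C)) \<le> real (s ^ 2) ^ (q * C)"
    proof -
      have "2 * s \<le> s * s" using s by (intro mult_right_mono) auto
      then have "s + 2 \<le> s ^ 2" using s unfolding power2_eq_square by linarith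
      then have "(s + 2) ^ (q * C) \<le> (s ^ 2) ^ (q * C)" by (intro power_mono) auto
      then show ?thesis by (metis of_nat_le_iff of_nat_power)
    qed
    also have "\<dots> = real s ^ (2 * (q * C))" by (simp only: of_nat_power power_mult)
    also have "\<dots> = real s powr real (2 * (q * C))" using s by (subst powr_realpow) auto
    also have "\<dots> \<le> real s powr l" using s ql by (intro powr_mono) auto
    finally have "(s + 2) ^ (q * C) \<le> D" unfolding D_def l_def by linarith
    then have "k ((s + 2) ^ (q * C)) \<le> q" unfolding q by (rule monoD[OF k(1)])
    moreover have "q \<ge> 1" unfolding q using D s by (intro k(2)) auto
    ultimately show "1 \<le> ktilde k s \<and> k ((s + 2) ^ (ktilde k s * C)) \<le> ktilde k s" by (simp add: q_def)
  qed
  then show ?thesis unfolding eventually_at_top_linorder by blast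
qed

theorem theorem3p3:
  fixes \<delta> :: real
    and k :: "nat \<Rightarrow> nat"
    and P :: "nat \<Rightarrow> 'a::field_char_0 mpoly"
  assumes "\<delta> > 0"
    and "mono k"
    and "(\<lambda>d. real (k d)) \<in> o(\<lambda>d. sqrt (log 2 (real d)))"
    and "explicit_poly_family k P"
    and "\<And>d. variate (k d) (P d)"
    and "\<And>d. total_degree (P d) = d"
    and "\<And>d. P d \<notin> circuit_class (k d) d (real d powr \<delta>)"
  shows "\<exists>(H :: nat \<Rightarrow> 'a list set) e.
           explicit_set_family H \<and>
           (\<forall>s. hitting_set s (circuit_class s s (real s)) (H s)) \<and>
           e \<in> O(\<lambda>s. real (ktilde k s) ^ 2) \<and>
           (\<forall>s\<ge>2. real (card (H s)) \<le> real s powr e s)"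
proof -
  obtain A cs c0 where A0: "\<And>d. \<exists>ts t. outputs_in_time A (enc_nat d) (enc_list enc_term ts) t \<and>
      t \<le> c0 * (d ^ k d) ^ c0 + c0 \<and> (\<forall>(a, es) \<in> set ts. length es = k d) \<and>
      P d = (\<Sum>(a, es)\<leftarrow>ts. Poly_Mapping.single (Poly_Mapping.nth es) (fexp_value cs a))"
    using assms(4) unfolding explicit_poly_family_def by blast
  then obtain tsf tf where A: "\<And>d. outputs_in_time A (enc_nat d) (enc_terms (tsf d)) (tf d)"
    and tf: "\<And>d. tf d \<le> c0 * (d ^ k d) ^ c0 + c0"
    and len: "\<And>d a es. (a, es) \<in> set (tsf d) \<Longrightarrow> length es = k d"
    and P: "\<And>d. P d = (\<Sum>(a, es)\<leftarrow>tsf d. Poly_Mapping.single (Poly_Mapping.nth es) (fexp_value cs a))"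
    unfolding enc_terms_eq by (metis (mono_tags, lifting) case_prodD)
  have P0: "P d \<noteq> 0" if "d \<ge> 1" for d using assms(6)[of d] that by auto
  have "\<exists>i0<length cs. cs ! i0 \<noteq> 0"
  proof (rule ccontr)
    assume "\<not> ?thesis"
    then have "fexp_value cs a = 0" for a by (intro fexp_value_zero) auto
    then have "P 1 = 0" unfolding P by (simp add: case_prod_unfold sum_list_0)
    then show False using P0[of 1] by simp
  qed
  then obtain i0 where i0: "i0 < length cs" "cs ! i0 \<noteq> 0" by blast
  have nv: "nvars (tsf d) = k d" if "d \<ge> 1" for d
  proof -
    have "tsf d \<noteq> []" using P[of d] P0[OF that] by auto
    then obtain a es r where "tsf d = (a, es) # r" by (metis list.exhaust prod.exhaust)
    then show ?thesis using len[of a es d] by (simp add: nvars_def)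
  qed
  \<comment> \<open>A polynomial of positive degree contains a variable. This makes
    \<open>ktilde k s\<close> an admissible index, as candidates start at 1.\<close>
  have k1: "k d \<ge> 1" if "d \<ge> 1" for d
  proof (rule ccontr)
    assume "\<not> ?thesis"
    then have "total_degree (P d) = 0" using assms(5)[of d] by (intro variate_0_total_degree) (simp add: not_le)
    then show False using assms(6)[of d] that by simp
  qed
  define L where "L = nat \<lceil>8 / \<delta>\<rceil>"
  define g where "g = 2 * L + 2"
  define C where "C = g * L"
  define w where "w = (L + 3 + g) * Suc L"
  have L: "real L * \<delta> \<ge> 8"
  proof -
    have "8 / \<delta> \<le> real L" unfolding L_def by linarith
    then show ?thesis using assms(1) by (simp add: field_simps)
  qed
  have "L \<noteq> 0" by (rule notI) (use L in simp)
  then have C1: "C \<ge> 1" by (simp add: C_def g_def)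
  define J where "J s = (LEAST j. j \<ge> 1 \<and> k ((s + 2) ^ (j * C)) \<le> j)" for s
  have ex: "\<exists>j\<ge>1. k ((s + 2) ^ (j * C)) \<le> j" for s by (rule exists_search_index[OF assms(3)])
  have J: "J s \<ge> 1 \<and> k ((s + 2) ^ (J s * C)) \<le> J s" for s
    unfolding J_def by (rule LeastI_ex[OF ex])
  define d where "d s = (s + 2) ^ (J s * C)" for s
  define x where "x s = (s + 2) ^ J s" for s
  define M where "M s = (s + 2) ^ (J s * J s)" for s
  define b where "b s = x s ^ g" for s
  define K where "K s = k (d s) * Suc L" for s
  define pts where "pts s = hit_points i0 g L w (False, search_state s (J s), tsf (d s))" for s
  define H where "H s = set (map (map (fexp_value cs)) (pts s))" for s
  have d1: "d s \<ge> 1" for s by (simp add: d_def)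
  have dx: "d s = x s ^ (g * L)" for s by (simp add: d_def x_def C_def power_mult)
  have par: "parameters L g w s (J s) (K s) (x s) (b s) \<delta>" for s
  proof
    show "K s \<le> J s * Suc L" unfolding K_def d_def using J[of s] by (intro mult_right_mono) auto
  qed (use L assms(1) J in \<open>auto simp: g_def w_def x_def b_def\<close>)
  have seedsR: "Suc (s * (K s * b s)) ^ K s \<le> M s ^ w" "s ^ K s \<le> M s ^ w" for s
    using parameters.seeds_bound[OF par] parameters.orders_bound[OF par] by (simp_all add: M_def)
  have pts: "pts s = gen_points i0 (M s ^ w) s (K s) (b s) (map (split_term (b s) L) (tsf (d s))) @
      map (\<lambda>u. replicate s (fnum i0 u)) [0..<M s ^ w]" for s
    by (simp add: pts_def hit_points_def search_state_def nv[OF d1] K_def M_def b_def x_def)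
  have card: "card (H s) \<le> M s ^ w * M s ^ w + M s ^ w" "s \<ge> 1 \<Longrightarrow> M s ^ w \<le> card (H s)"
    "H s \<subseteq> {a. length a = s}" for s
    unfolding H_def pts by (rule card_points[OF i0 seedsR]; assumption?)+
  have M2: "M s ^ w \<ge> M s" "M s \<ge> 2" for s
  proof -
    have "(s + 2) ^ 1 \<le> M s" unfolding M_def using J[of s] by (intro power_increasing) auto
    then show "M s \<ge> 2" by simp
    then have "M s ^ 1 \<le> M s ^ w" by (intro power_increasing) (auto simp: w_def)
    then show "M s ^ w \<ge> M s" by simp
  qed
  have hit: "hitting_set s (circuit_class s s (real s)) (H s)" for s
    unfolding hitting_set_def
  proof (intro conjI ballI impI)
    show "H s \<subseteq> {a. length a = s}" by (rule card(3))
    fix f :: "'a mpoly" assume f: "f \<in> circuit_class s s (real s)" "f \<noteq> 0"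
    have b2: "b s \<ge> 2" by (rule parameters.b_ge[OF par])
    \<comment> \<open>The degree is exactly \<open>b s ^ L\<close>, so \<open>L\<close> digits would
      just fail to represent it.\<close>
    have "d s < b s ^ Suc L"
    proof -
      have "d s = b s ^ L" by (simp add: dx b_def power_mult)
      moreover have "b s ^ L < b s ^ Suc L" using b2 by (intro power_strict_increasing) auto
      ultimately show ?thesis by simp
    qed
    moreover have "real (circuit_bound s (K s) (K s * b s)) \<le> real (d s) powr \<delta>"
      unfolding dx by (rule parameters.size_bound[OF par])
    ultimately obtain y z where nz: "mpoly_eval (\<lambda>i. Delta (split_poly (b s) L (k (d s)) (P (d s))) i y z) f \<noteq> 0"
      using generator_nonzero[OF assms(5) assms(6) assms(7) _ _ _ f, of "d s" "b s" L] b2 unfolding K_def by auto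
    have "\<exists>q\<in>set (gen_points i0 (M s ^ w) s (K s) (b s) (map (split_term (b s) L) (tsf (d s)))).
        mpoly_eval (\<lambda>i. map (fexp_value cs) q ! i) f \<noteq> 0"
      by (rule gen_points_hit[OF i0 seedsR len K_def P _ _ _ nz])
        (use f(1) b2 in \<open>auto simp: circuit_class_def\<close>)
    then show "\<exists>a\<in>H s. mpoly_eval (\<lambda>i. a ! i) f \<noteq> 0" unfolding H_def pts by auto
  qed
  have "explicit_set_family H"
  proof -
    obtain p a where p: "\<And>s. \<exists>t\<le>a * Suc (M s) ^ a.
        outputs_in_time p (enc_nat s) (enc_list (enc_list enc_fexp) (pts s)) t"
      using search_program[OF A tf nv assms(2) ex pt_hit_points] unfolding pts_def d_def M_def J_def by blast
    \<comment> \<open>For \<open>s = 0\<close> every point is the empty list and the cardinality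
      does not bound the time, so the time at \<open>s = 0\<close> is put into the additive
      constant.\<close>
    define c where "c = a * 2 ^ a + a * Suc (M 0) ^ a + a"
    have bound: "a * Suc (M s) ^ a \<le> c * card (H s) ^ c + c" for s
    proof (cases "s = 0")
      case True
      then show ?thesis by (simp add: c_def)
    next
      case False
      have "M s \<le> card (H s)" using card(2)[of s] False M2(1)[of s] by simp
      then have "Suc (M s) \<le> 2 * card (H s)" "card (H s) \<ge> 1" using M2(2)[of s] by auto
      then have "a * Suc (M s) ^ a \<le> a * (2 * card (H s)) ^ a" by (intro mult_left_mono power_mono) auto
      also have "\<dots> = (a * 2 ^ a) * card (H s) ^ a" by (simp add: power_mult_distrib)
      also have "\<dots> \<le> c * card (H s) ^ c"
        using \<open>card (H s) \<ge> 1\<close> by (intro mult_mono power_increasing) (auto simp: c_def)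
      finally show ?thesis by simp
    qed
    show ?thesis unfolding explicit_set_family_def
    proof (rule exI[of _ p], rule exI[of _ cs], rule exI[of _ c], rule allI)
      fix s
      obtain t where t: "t \<le> a * Suc (M s) ^ a" "outputs_in_time p (enc_nat s) (enc_list (enc_list enc_fexp) (pts s)) t"
        using p by blast
      then show "\<exists>L t. outputs_in_time p (enc_nat s) (enc_list (enc_list enc_fexp) L) t \<and>
          t \<le> c * card (H s) ^ c + c \<and> H s = set (map (map (fexp_value cs)) L)"
        using order.trans[OF t(1) bound[of s]] H_def by blast
    qed
  qed
  \<comment> \<open>The exponent is defined through \<open>J s\<close>, not
    \<open>ktilde k s\<close>: it has to be valid for every \<open>s \<ge> 2\<close>, whereas
    \<open>J s \<le> ktilde k s\<close> is known only for large \<open>s\<close>.\<close>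
  moreover define e where "e s = real (6 * w * (J s) ^ 2)" for s
  have ev: "eventually (\<lambda>s. J s \<le> ktilde k s) at_top"
    unfolding J_def by (rule eventually_search_index_le[OF assms(3,2) _ C1]) (rule k1)
  have "e \<in> O(\<lambda>s. real (ktilde k s) ^ 2)"
  proof (rule bigoI)
    show "eventually (\<lambda>s. norm (e s) \<le> real (6 * w) * norm (real (ktilde k s) ^ 2)) at_top"
      using ev
    proof eventually_elim
      case (elim s)
      then have "6 * w * (J s) ^ 2 \<le> 6 * w * (ktilde k s) ^ 2" by (intro mult_left_mono power_mono) auto
      then have "e s \<le> real (6 * w * (ktilde k s) ^ 2)" unfolding e_def by (simp only: of_nat_le_iff)
      then show ?case by (simp add: e_def)
    qed
  qed
  moreover have "real (card (H s)) \<le> real s powr e s" if s: "s \<ge> 2" for s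
  proof -
    let ?R = "M s ^ w"
    have R2: "2 \<le> ?R" using M2[of s] by linarith
    \<comment> \<open>Origin of the 6: a factor 3 from \<open>?R * ?R + ?R \<le> ?R ^ 3\<close> and
      a factor 2 from \<open>s + 2 \<le> s ^ 2\<close>.\<close>
    have "card (H s) \<le> ?R * ?R + ?R" by (rule card(1))
    also have "\<dots> \<le> ?R * ?R + ?R * ?R" using R2 by (intro add_left_mono) (simp add: Suc_le_eq)
    also have "\<dots> = 2 * (?R * ?R)" by simp
    also have "\<dots> \<le> ?R * (?R * ?R)" using R2 by (rule mult_right_mono) simp
    also have "\<dots> = M s ^ (3 * w)" by (simp add: numeral_eq_Suc power_add)
    also have "\<dots> = (s + 2) ^ (3 * w * (J s) ^ 2)" by (simp add: M_def power2_eq_square mult_ac flip: power_mult)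
    also have "\<dots> \<le> (s ^ 2) ^ (3 * w * (J s) ^ 2)"
    proof (rule power_mono)
      have "2 * s \<le> s * s" using s by (intro mult_right_mono) auto
      then show "s + 2 \<le> s ^ 2" using s unfolding power2_eq_square by linarith
    qed simp
    also have "\<dots> = s ^ (6 * w * (J s) ^ 2)" by (simp add: mult_ac flip: power_mult)
    finally have "real (card (H s)) \<le> real s ^ (6 * w * (J s) ^ 2)" by (metis of_nat_le_iff of_nat_power)
    also have "\<dots> = real s powr e s" unfolding e_def using s by (subst powr_realpow) auto
    finally show ?thesis .
  qed
  ultimately show ?thesis using hit by blast
qed

end
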